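(* Assume: (1) $(A,B)$ is stabilizable; (2) $(A,C)$ is observable; (3) $S$ has no eigenvalues with negative real parts; (4) $\operatorname{rank}\begin{bmatrix} A-\lambda I_n & B\\ C & \mathbf 0\end{bmatrix}=n+p$ for every eigenvalue $\lambda$ of $S$; (5) the minimal polynomial of $S$ is known. Let $(G_1,G_2)$ be the minimal $p$-copy internal model of $S$, let $L\in\mathbb R^{n\times p}$ be such that $A-LC$ is Hurwitz, and let $R=R^T>0$ in $\mathbb R^{m\times m}$. Then for any symmetric positive definite $\bar Q\in\mathbb R^{(p+n_z)\times(p+n_z)}$, with $Q_\xi=\bar C^T\bar Q\bar C$ and $Q_\rho=W^TQ_\xi W$, the algebraic Riccati equation $$A_\rho^TP_\rho^*+P_\rho^*A_\rho+Q_\rho-P_\rho^*B_\rho R^{-1}B_\rho^TP_\rho^*=0$$ admits a unique positive semidefinite solution, namely $P_\rho^*=W^TP_\xi^*W$, where $P_\xi^*$ is the unique positive definite solution of $$Y^TP_\xi^*+P_\xi^*Y+Q_\xi-P_\xi^*JR^{-1}J^TP_\xi^*=0.$$ Consequently, the solution of the LQR problem $$\min_{\bar u}\int_0^\infty\left(\bar\rho^TQ_\rho\bar\rho+\bar u^TR\bar u\right)dt\quad\text{subject to}\quad\dot{\bar\rho}=A_\rho\bar\rho+B_\rho\bar u$$ is given by $\bar u^*=K_\rho^*\bar\rho$, where $K_\rho^*=-R^{-1}B_\rho^TP_\rho^*=-R^{-1}B_\rho^TW^TP_\xi^*W=K_\xi^*W$ with $K_\xi^*=-R^{-1}J^TP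_\xi^*$.
   Context: Data: real matrices $A\in\mathbb R^{n\times n}$, $B\in\mathbb R^{n\times m}$, $C\in\mathbb R^{p\times n}$, $S\in\mathbb R^{q\times q}$, coming from the plant $\dot x=Ax+Bu+Ev$, $y=Cx$, $e=Cx+Fv$ and exosystem $\dot v=Sv$. A matrix is Hurwitz if all its eigenvalues have negative real parts. Assumption (5) is purely informational (it makes the internal model available) and imposes no mathematical restriction. Minimal $p$-copy internal model of $S$: $G_1=\mathrm{blockdiag}(\beta,\dots,\beta)$ and $G_2=\mathrm{blockdiag}(\sigma,\dots,\sigma)$ ($p$ copies each), where $\beta$ is a constant real square matrix whose characteristic polynomial equals the minimal polynomial of $S$ and $\sigma$ is a constant column vector such that $(\beta,\sigma)$ is controllable. $n_z$ is the size of $G_1$. Objects built from $L$: let $\Lambda(s)=\det(sI_n-A+LC)=s^n+\alpha_{n-1}s^{n-1}+\cdots+\alpha_1s+\alpha_0$ and write $(sI_n-A+LC)^{-1}=\dfrac{D_{n-1}s^{n-1}+\cdots+D_1s+D_0}{\Lambda(s)}$ with $D_i\in\mathbb R^{n\times n}$. $\mathcal A\in\mathbb R^{n\times n}$ is the companion matrix with ones on the superdiagonal, last row $(-\alpha_0,-\alpha_1,\dots,-\alpha_{n-1})$ and all other entries zero; $b=(0,\dots,0,1)^T\in\mathbb R^n$. $M=[M_1,\dots,M_{m+p}]\in\mathbb R^{n\times n(m+p)}$ with $M_i=[D_0f_i,\dots,D_{n-1}f_i]$, where $f_i$ is the $i$-th column of $B$ for $1\le i\le m$ and the $(i-m)$-th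 column of $L$ for $m+1\le i\le m+p$. $B_\zeta=\begin{bmatrix}I_m\otimes b\\ \mathbf 0\end{bmatrix}$, $E_\zeta=\begin{bmatrix}\mathbf 0\\ I_p\otimes b\end{bmatrix}$, $A_\zeta=(I_{m+p}\otimes\mathcal A)+E_\zeta CM$. Further notation: $Y=\begin{bmatrix}A&\mathbf 0\\ G_2C&G_1\end{bmatrix}$, $J=\begin{bmatrix}B\\ \mathbf 0\end{bmatrix}$, $A_\rho=\begin{bmatrix}A_\zeta&\mathbf 0\\ G_2CM&G_1\end{bmatrix}$, $B_\rho=\begin{bmatrix}B_\zeta\\ \mathbf 0\end{bmatrix}$, $W=\mathrm{blockdiag}(M,I_{n_z})$, $\bar C=\begin{bmatrix}C&\mathbf 0\\ \mathbf 0&I_{n_z}\end{bmatrix}$. In the LQR problem, $\bar\rho\in\mathbb R^{n(m+p)+n_z}$ has an arbitrary given initial value $\bar\rho(0)$ and the minimization is over (locally square-integrable) control inputs $\bar u:[0,\infty)\to\mathbb R^m$. Under the stated assumptions $(Y,J)$ is stabilizable and $(Y,\sqrt{\bar Q}\,\bar C)$ is observable, which is what makes $P_\xi^*$ exist uniquely. *)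

theory Defs
  imports
    "HOL-Analysis.Analysis"
    "Jordan_Normal_Form.Char_Poly"
    "Jordan_Normal_Form.DL_Rank"
    "Jordan_Normal_Form.Gauss_Jordan_Elimination"
begin

unbundle no vec_syntax and no inner_syntax

abbreviation cmat :: "real mat \<Rightarrow> complex mat" where
  "cmat A \<equiv> map_mat complex_of_real A"

definition mat_rank :: "'a :: field mat \<Rightarrow> nat" where
  "mat_rank A = vec_space.rank (dim_row A) A"

text \<open>Only applied to invertible matrices; the option is \<open>None\<close> exactly for singular ones.\<close>

definition mat_inv :: "real mat \<Rightarrow> real mat" where
  "mat_inv A = the (mat_inverse A)"

definition kron :: "real mat \<Rightarrow> real mat \<Rightarrow> real mat" where
  "kron A B = mat (dim_row A * dim_row B) (dim_col A * dim_col B)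
     (\<lambda>(i, j). A $$ (i div dim_row B, j div dim_col B) * B $$ (i mod dim_row B, j mod dim_col B))"

definition pos_def :: "nat \<Rightarrow> real mat \<Rightarrow> bool" where
  "pos_def k P \<longleftrightarrow> P \<in> carrier_mat k k \<and> P\<^sup>T = P \<and>
     (\<forall>x \<in> carrier_vec k. x \<noteq> 0\<^sub>v k \<longrightarrow> 0 < x \<bullet> (P *\<^sub>v x))"

definition pos_semidef :: "nat \<Rightarrow> real mat \<Rightarrow> bool" where
  "pos_semidef k P \<longleftrightarrow> P \<in> carrier_mat k k \<and> P\<^sup>T = P \<and>
     (\<forall>x \<in> carrier_vec k. 0 \<le> x \<bullet> (P *\<^sub>v x))"


section \<open>Linear systems\<close>

definition hurwitz :: "real mat \<Rightarrow> bool" where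
  "hurwitz F \<longleftrightarrow> (\<forall>\<mu>. eigenvalue (cmat F) \<mu> \<longrightarrow> Re \<mu> < 0)"

definition stabilizable :: "real mat \<Rightarrow> real mat \<Rightarrow> bool" where
  "stabilizable A B \<longleftrightarrow> (\<exists>K \<in> carrier_mat (dim_col B) (dim_row A). hurwitz (A + B * K))"

text \<open>The Kalman matrices \<open>[B, A B, \<dots>, A\<^sup>n\<^sup>-\<^sup>1 B]\<close> and \<open>[C; C A; \<dots>; C A\<^sup>n\<^sup>-\<^sup>1]\<close>.\<close>

definition controllability_mat :: "real mat \<Rightarrow> real mat \<Rightarrow> real mat" where
  "controllability_mat A B = (let n = dim_row A; m = dim_col B in
     mat n (n * m) (\<lambda>(i, j). ((A ^\<^sub>m (j div m)) * B) $$ (i, j mod m)))"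

definition observability_mat :: "real mat \<Rightarrow> real mat \<Rightarrow> real mat" where
  "observability_mat A C = (let n = dim_row A; p = dim_row C in
     mat (n * p) n (\<lambda>(i, j). (C * (A ^\<^sub>m (i div p))) $$ (i mod p, j)))"

definition controllable :: "real mat \<Rightarrow> real mat \<Rightarrow> bool" where
  "controllable A B \<longleftrightarrow> mat_rank (controllability_mat A B) = dim_row A"

definition observable :: "real mat \<Rightarrow> real mat \<Rightarrow> bool" where
  "observable A C \<longleftrightarrow> mat_rank (observability_mat A C) = dim_row A"


section \<open>Internal model\<close>

definition poly_mat :: "real poly \<Rightarrow> real mat \<Rightarrow> real mat" where
  "poly_mat f A = mat (dim_row A) (dim_row A)
     (\<lambda>(i, j). \<Sum>k \<le> degree f. coeff f k * (A ^\<^sub>m k) $$ (i, j))"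

definition is_minimal_poly :: "real mat \<Rightarrow> real poly \<Rightarrow> bool" where
  "is_minimal_poly A f \<longleftrightarrow> lead_coeff f = 1 \<and> poly_mat f A = 0\<^sub>m (dim_row A) (dim_row A) \<and>
     (\<forall>g. g \<noteq> 0 \<and> poly_mat g A = 0\<^sub>m (dim_row A) (dim_row A) \<longrightarrow> degree f \<le> degree g)"

definition minimal_internal_model :: "nat \<Rightarrow> real mat \<Rightarrow> real mat \<Rightarrow> real mat \<Rightarrow> bool" where
  "minimal_internal_model p S G1 G2 \<longleftrightarrow>
     (\<exists>d \<beta> \<sigma>. \<beta> \<in> carrier_mat d d \<and> \<sigma> \<in> carrier_mat d 1 \<and>
        is_minimal_poly S (char_poly \<beta>) \<and> controllable \<beta> \<sigma> \<and>
        G1 = diag_block_mat (replicate p \<beta>) \<and> G2 = diag_block_mat (replicate p \<sigma>))"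


section \<open>Matrices built from the observer gain\<close>

text \<open>The numerator coefficients \<open>D\<^sub>k\<close> in
  \<open>(s I - F)\<^sup>-\<^sup>1 = (D\<^sub>n\<^sub>-\<^sub>1 s\<^sup>n\<^sup>-\<^sup>1 + \<dots> + D\<^sub>0) / det (s I - F)\<close>, read off from the adjugate of \<open>s I - F\<close>;
  the identity itself is lemma \<open>resolvent_expansion\<close> below.\<close>

definition resolvent_coeff :: "real mat \<Rightarrow> nat \<Rightarrow> real mat" where
  "resolvent_coeff F k = map_mat (\<lambda>a. coeff a k) (adj_mat (char_poly_matrix F))"

lemma degree_adj_char_poly_matrix:
  assumes F: "F \<in> carrier_mat n n" and ij: "i < n" "j < n"
  shows "degree (adj_mat (char_poly_matrix F) $$ (i, j)) < n"
proof -
  let ?X = "char_poly_matrix F"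
  have X: "?X \<in> carrier_mat n n" using F by simp
  have deg1: "degree (?X $$ (k, l)) \<le> 1" if "k < n" "l < n" for k l
    using that F by (auto simp: char_poly_matrix_def)
  have "degree (det (mat_delete ?X j i)) \<le> 1 * (n - 1)"
  proof (rule degree_det_le)
    show "mat_delete ?X j i \<in> carrier_mat (n - 1) (n - 1)"
      using X by (rule mat_delete_carrier)
    show "degree (mat_delete ?X j i $$ (k, l)) \<le> 1" if "k < n - 1" "l < n - 1" for k l
      using that X by (auto simp: mat_delete_def intro!: deg1[unfolded One_nat_def])
  qed
  moreover have "degree (cofactor ?X j i) \<le> degree (det (mat_delete ?X j i))"
    unfolding cofactor_def by (cases "even (j + i)") auto
  ultimately show ?thesis using ij X by (auto simp: adj_mat_def)
qed

lemma resolvent_expansion: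
  assumes F: "F \<in> carrier_mat n n" and s: "poly (char_poly F) s \<noteq> 0"
  defines "N \<equiv> mat n n (\<lambda>(i, j). \<Sum>k<n. resolvent_coeff F k $$ (i, j) * s ^ k)"
  shows "(s \<cdot>\<^sub>m 1\<^sub>m n - F) * ((1 / poly (char_poly F) s) \<cdot>\<^sub>m N) = 1\<^sub>m n"
proof -
  let ?X = "char_poly_matrix F"
  have X: "?X \<in> carrier_mat n n" using F by simp
  have adj: "adj_mat ?X \<in> carrier_mat n n" by (rule adj_mat(1)[OF X])
  have N: "N $$ (i, j) = poly (adj_mat ?X $$ (i, j)) s" if "i < n" "j < n" for i j
  proof -
    have "poly (adj_mat ?X $$ (i, j)) s = (\<Sum>k<n. coeff (adj_mat ?X $$ (i, j)) k * s ^ k)"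
      unfolding poly_altdef
      by (rule sum.mono_neutral_left)
        (use degree_adj_char_poly_matrix[OF F that] in \<open>auto simp: coeff_eq_0\<close>)
    then show ?thesis using that adj by (simp add: N_def resolvent_coeff_def)
  qed
  have Ncar: "N \<in> carrier_mat n n" by (simp add: N_def)
  have sF: "s \<cdot>\<^sub>m 1\<^sub>m n - F \<in> carrier_mat n n" using F by (rule minus_carrier_mat)
  have "(s \<cdot>\<^sub>m 1\<^sub>m n - F) * N = poly (char_poly F) s \<cdot>\<^sub>m 1\<^sub>m n"
  proof (rule eq_matI)
    fix i j assume ij: "i < dim_row (poly (char_poly F) s \<cdot>\<^sub>m 1\<^sub>m n)"
      "j < dim_col (poly (char_poly F) s \<cdot>\<^sub>m 1\<^sub>m n)"
    then have i: "i < n" and j: "j < n" by auto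
    have "((s \<cdot>\<^sub>m 1\<^sub>m n - F) * N) $$ (i, j) =
        (\<Sum>k = 0..<n. (s \<cdot>\<^sub>m 1\<^sub>m n - F) $$ (i, k) * N $$ (k, j))"
      using i j sF Ncar F by (simp add: scalar_prod_def)
    also have "\<dots> = (\<Sum>k = 0..<n. poly (?X $$ (i, k)) s * poly (adj_mat ?X $$ (k, j)) s)"
      using i j F by (intro sum.cong refl) (simp add: N char_poly_matrix_def)
    also have "\<dots> = poly ((?X * adj_mat ?X) $$ (i, j)) s"
      using i j X adj by (simp add: scalar_prod_def poly_sum)
    also have "\<dots> = (poly (char_poly F) s \<cdot>\<^sub>m 1\<^sub>m n) $$ (i, j)"
      unfolding adj_mat(2)[OF X] char_poly_def using i j by simp
    finally show "((s \<cdot>\<^sub>m 1\<^sub>m n - F) * N) $$ (i, j) = (poly (char_poly F) s \<cdot>\<^sub>m 1\<^sub>m n) $$ (i, j)" .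
  qed (use F Ncar in auto)
  then show ?thesis
    unfolding mult_smult_distrib[OF sF Ncar] using s by (intro eq_matI) auto
qed

definition companion :: "real poly \<Rightarrow> real mat" where
  "companion f = (let n = degree f in
     mat n n (\<lambda>(i, j). if i = n - 1 then - coeff f j else if j = i + 1 then 1 else 0))"

definition last_unit :: "nat \<Rightarrow> real mat" where
  "last_unit n = mat n 1 (\<lambda>(i, j). if i = n - 1 then 1 else 0)"

text \<open>\<open>M = [M\<^sub>1, \<dots>, M\<^sub>m\<^sub>+\<^sub>p]\<close> with \<open>M\<^sub>i = [D\<^sub>0 f\<^sub>i, \<dots>, D\<^sub>n\<^sub>-\<^sub>1 f\<^sub>i]\<close>, counted from zero: column
  \<open>i n + k\<close> is \<open>D\<^sub>k f\<^sub>i\<close>, where \<open>f\<^sub>0, f\<^sub>1, \<dots>\<close> are the columns of \<open>B\<close> followed by those of \<open>L\<close>.\<close>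

definition param_mat :: "real mat \<Rightarrow> real mat \<Rightarrow> real mat \<Rightarrow> real mat \<Rightarrow> real mat" where
  "param_mat A B C L = (let n = dim_row A; m = dim_col B; p = dim_col L;
       f = (\<lambda>i. if i < m then col B i else col L (i - m)) in
     mat n (n * (m + p))
       (\<lambda>(r, j). (resolvent_coeff (A - L * C) (j mod n) *\<^sub>v f (j div n)) $ r))"


section \<open>Riccati equation and linear-quadratic regulator\<close>

definition riccati :: "real mat \<Rightarrow> real mat \<Rightarrow> real mat \<Rightarrow> real mat \<Rightarrow> real mat \<Rightarrow> bool" where
  "riccati A B Q R P \<longleftrightarrow>
     A\<^sup>T * P + P * A + Q - P * B * mat_inv R * B\<^sup>T * P = 0\<^sub>m (dim_row A) (dim_row A)"

definition lqr_input :: "nat \<Rightarrow> (real \<Rightarrow> real vec) \<Rightarrow> bool" where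
  "lqr_input m u \<longleftrightarrow> (\<forall>t \<ge> 0. u t \<in> carrier_vec m) \<and>
     (\<forall>i < m. (\<lambda>t. u t $ i) \<in> borel_measurable (lebesgue_on {0..}) \<and>
        (\<forall>T \<ge> 0. integrable (lebesgue_on {0..T}) (\<lambda>t. (u t $ i)\<^sup>2)))"

text \<open>For an input that is merely locally square-integrable, \<open>\<rho>' = A \<rho> + B u\<close> is meant in the
  Caratheodory sense, i.e. as the componentwise integral equation.\<close>

definition lqr_admissible ::
  "real mat \<Rightarrow> real mat \<Rightarrow> real vec \<Rightarrow> (real \<Rightarrow> real vec) \<Rightarrow> (real \<Rightarrow> real vec) \<Rightarrow> bool" where
  "lqr_admissible A B \<rho>0 \<rho> u \<longleftrightarrow> lqr_input (dim_col B) u \<and> \<rho> 0 = \<rho>0 \<and>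
     (\<forall>t \<ge> 0. \<rho> t \<in> carrier_vec (dim_row A) \<and>
        (\<forall>i < dim_row A.
           ((\<lambda>s. (A *\<^sub>v \<rho> s + B *\<^sub>v u s) $ i) has_integral (\<rho> t $ i - \<rho>0 $ i)) {0..t}))"

text \<open>The cost takes values in \<open>[0, \<infinity>]\<close>; \<open>ennreal\<close> truncates nothing, as \<open>Q\<close> and \<open>R\<close> will be
  positive semidefinite.\<close>

definition lqr_cost ::
  "real mat \<Rightarrow> real mat \<Rightarrow> (real \<Rightarrow> real vec) \<Rightarrow> (real \<Rightarrow> real vec) \<Rightarrow> ennreal" where
  "lqr_cost Q R \<rho> u =
     (\<integral>\<^sup>+t. ennreal (\<rho> t \<bullet> (Q *\<^sub>v \<rho> t) + u t \<bullet> (R *\<^sub>v u t)) \<partial>lebesgue_on {0..})"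

definition lqr_optimal :: "real mat \<Rightarrow> real mat \<Rightarrow> real mat \<Rightarrow> real mat \<Rightarrow> real vec \<Rightarrow>
    (real \<Rightarrow> real vec) \<Rightarrow> (real \<Rightarrow> real vec) \<Rightarrow> bool" where
  "lqr_optimal A B Q R \<rho>0 \<rho> u \<longleftrightarrow> lqr_admissible A B \<rho>0 \<rho> u \<and> lqr_cost Q R \<rho> u < \<infinity> \<and>
     (\<forall>\<rho>' u'. lqr_admissible A B \<rho>0 \<rho>' u' \<longrightarrow> lqr_cost Q R \<rho> u \<le> lqr_cost Q R \<rho>' u')"

text \<open>The feedback \<open>u = K \<rho>\<close> solves the problem from every initial value: the closed loop is
  realizable, and the optimal pairs are exactly the closed-loop ones (inputs being identified
  when they agree almost everywhere).\<close>

definition lqr_solution :: "real mat \<Rightarrow> real mat \<Rightarrow> real mat \<Rightarrow> real mat \<Rightarrow> real mat \<Rightarrow> bool" where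
  "lqr_solution A B Q R K \<longleftrightarrow> (\<forall>\<rho>0 \<in> carrier_vec (dim_row A).
     (\<exists>\<rho> u. lqr_admissible A B \<rho>0 \<rho> u \<and> (\<forall>t \<ge> 0. u t = K *\<^sub>v \<rho> t)) \<and>
     (\<forall>\<rho> u. lqr_admissible A B \<rho>0 \<rho> u \<longrightarrow>
        (lqr_optimal A B Q R \<rho>0 \<rho> u \<longleftrightarrow> (AE t in lebesgue_on {0..}. u t = K *\<^sub>v \<rho> t))))"

end

theory Submission
  imports Defs "Jordan_Normal_Form.Spectral_Radius"
begin

text \<open>The matrix \<open>W\<close> maps the parametrized state \<open>\<rho>\<close> to the state of the plant augmented by the internal
  model. Comparing coefficients in the resolvent of \<open>A - L C\<close> gives \<open>M (I \<otimes> \<A>) = (A - L C) M\<close>,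
  \<open>M B\<zeta> = B\<close> and \<open>M E\<zeta> = L\<close> (lemmas \<open>param_mat_companion\<close> and \<open>param_mat_input\<close>), and therefore
  \<open>W A\<rho> = Y W\<close> and \<open>W B\<rho> = J\<close>. Because of this intertwining a solution \<open>P\<xi>\<close> of the Riccati equation of
  the augmented plant pulls back to the solution \<open>W\<^sup>T P\<xi> W\<close> of the equation for \<open>\<rho>\<close>
  (\<open>riccati_pullback\<close>), and the gains correspond in the same way.

  Uniqueness and optimality follow for both systems from one argument, the locale \<open>lq_detectable\<close>.
  The running cost sees \<open>C x\<close> and \<open>z\<close>, hence output injection turns \<open>Y\<close> into
  \<open>diag (A - L C, - I)\<close> and \<open>A\<rho>\<close> into \<open>diag (I \<otimes> \<A>, - I)\<close>, and these matrices are Hurwitz. A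
  trajectory of finite cost is therefore square-integrable and comes arbitrarily close to zero at
  late times (\<open>state_returns_to_zero\<close>). For a positive semidefinite solution \<open>P\<close>, completing the
  square shows that the cost up to time \<open>T\<close> plus \<open>x(T) \<bullet> P x(T)\<close> equals \<open>x(0) \<bullet> P x(0)\<close> plus the
  weighted square of the deviation from the feedback law (\<open>cost_identity\<close>). At the late times just
  mentioned the terminal term disappears: \<open>x(0) \<bullet> P x(0)\<close> is the least cost, and exactly the
  feedback law attains it. As the least cost determines the quadratic form, there is only one such
  \<open>P\<close>.

  A solution for the augmented plant exists because that plant is stabilizable: Kleinman's policy
  iteration starts from a stabilizing gain and converges (\<open>riccati_solvable\<close>). The Lyapunov and
  Sylvester equations on the way are solved by geometric series after a Cayley transform. For
  stabilizability, a Sylvester equation decouples the internal model from the prestabilized plant,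
  which is possible since their spectra lie in the closed right and the open left half plane, and
  the internal model is then stabilized by Bass's gain; the Hautus test that this needs comes from the rank condition at
  the eigenvalues of \<open>S\<close> and from the controllability of \<open>(\<beta>, \<sigma>)\<close> (\<open>augmented_stabilizable\<close>).
  Observability of \<open>(A, C)\<close> makes the solution positive definite
  (\<open>augmented_riccati_pos_def\<close>).\<close>

section \<open>Matrix algebra\<close>

text \<open>The ring laws with their side conditions phrased as equations between dimensions, which the
  simplifier discharges for nested expressions; membership in a carrier would leave it guessing
  the intermediate dimension.\<close>

lemma mat_assoc:
  fixes A B C :: "'a :: comm_ring_1 mat"
  shows "dim_col A = dim_row B \<Longrightarrow> dim_col B = dim_row C \<Longrightarrow> A * B * C = A * (B * C)"
  by (rule assoc_mult_mat[of _ "dim_row A" "dim_row B" _ "dim_row C" _ "dim_col C"]) auto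

lemma mat_distrib:
  fixes A B C :: "'a :: comm_ring_1 mat"
  assumes "dim_row A = dim_row B" "dim_col A = dim_col B"
  shows "dim_col A = dim_row C \<Longrightarrow> (A + B) * C = A * C + B * C"
    and "dim_col A = dim_row C \<Longrightarrow> (A - B) * C = A * C - B * C"
    and "dim_col C = dim_row A \<Longrightarrow> C * (A + B) = C * A + C * B"
    and "dim_col C = dim_row A \<Longrightarrow> C * (A - B) = C * A - C * B"
  using assms
  by (auto intro!: eq_matI simp: scalar_prod_def sum.distrib sum_subtractf sum_negf sum_distrib_left
      algebra_simps)

lemma mat_scale:
  fixes A B :: "'a :: comm_ring_1 mat"
  assumes "dim_col A = dim_row B"
  shows "(c \<cdot>\<^sub>m A) * B = c \<cdot>\<^sub>m (A * B)" "A * (c \<cdot>\<^sub>m B) = c \<cdot>\<^sub>m (A * B)"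
    "(- A) * B = - (A * B)" "A * (- B) = - (A * B)"
  using assms
  by (auto intro!: eq_matI simp: scalar_prod_def sum.distrib sum_subtractf sum_negf sum_distrib_left
      algebra_simps)

lemma smult_smult_mat: "c \<cdot>\<^sub>m (d \<cdot>\<^sub>m A) = (c * d :: 'a :: comm_ring_1) \<cdot>\<^sub>m A"
  by (auto intro!: eq_matI simp: mult.assoc)

lemma mat_one:
  fixes A :: "'a :: comm_ring_1 mat"
  shows "dim_row A = k \<Longrightarrow> 1\<^sub>m k * A = A" "dim_col A = k \<Longrightarrow> A * 1\<^sub>m k = A"
  by auto

lemma mat_zero:
  fixes A :: "'a :: comm_ring_1 mat"
  shows "dim_row A = k \<Longrightarrow> 0\<^sub>m r k * A = 0\<^sub>m r (dim_col A)"
    "dim_col A = k \<Longrightarrow> A * 0\<^sub>m k r = 0\<^sub>m (dim_row A) r"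
  by auto

lemma scalar_prod_commute:
  fixes x y :: "'a :: comm_ring_1 vec"
  shows "dim_vec x = dim_vec y \<Longrightarrow> x \<bullet> y = y \<bullet> x"
  by (simp add: scalar_prod_def mult.commute)

lemma mat_transpose:
  fixes A B :: "'a :: comm_ring_1 mat"
  shows "dim_col A = dim_row B \<Longrightarrow> (A * B)\<^sup>T = B\<^sup>T * A\<^sup>T"
    and "dim_row A = dim_row B \<Longrightarrow> dim_col A = dim_col B \<Longrightarrow> (A + B)\<^sup>T = A\<^sup>T + B\<^sup>T"
    and "dim_row A = dim_row B \<Longrightarrow> dim_col A = dim_col B \<Longrightarrow> (A - B)\<^sup>T = A\<^sup>T - B\<^sup>T"
    and "(c \<cdot>\<^sub>m A)\<^sup>T = c \<cdot>\<^sub>m A\<^sup>T"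
    and "(- A)\<^sup>T = - A\<^sup>T"
  by (auto intro!: eq_matI scalar_prod_commute)

lemmas mat_algebra = mat_assoc mat_distrib mat_scale mat_one mat_zero mat_transpose

lemma mat_vec_assoc:
  fixes A B :: "'a :: comm_ring_1 mat"
  shows "dim_col A = dim_row B \<Longrightarrow> dim_col B = dim_vec x \<Longrightarrow> (A * B) *\<^sub>v x = A *\<^sub>v (B *\<^sub>v x)"
  by (rule assoc_mult_mat_vec[of _ "dim_row A" "dim_row B" _ "dim_vec x"]) auto

lemma mat_vec_distrib:
  fixes A B :: "'a :: comm_ring_1 mat"
  assumes "dim_col A = dim_vec x"
  shows "dim_row A = dim_row B \<Longrightarrow> dim_col A = dim_col B \<Longrightarrow> (A + B) *\<^sub>v x = A *\<^sub>v x + B *\<^sub>v x"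
    and "dim_row A = dim_row B \<Longrightarrow> dim_col A = dim_col B \<Longrightarrow> (A - B) *\<^sub>v x = A *\<^sub>v x - B *\<^sub>v x"
    and "dim_vec x = dim_vec y \<Longrightarrow> A *\<^sub>v (x + y) = A *\<^sub>v x + A *\<^sub>v y"
    and "dim_vec x = dim_vec y \<Longrightarrow> A *\<^sub>v (x - y) = A *\<^sub>v x - A *\<^sub>v y"
    and "A *\<^sub>v (c \<cdot>\<^sub>v x) = c \<cdot>\<^sub>v (A *\<^sub>v x)"
    and "(c \<cdot>\<^sub>m A) *\<^sub>v x = c \<cdot>\<^sub>v (A *\<^sub>v x)"
    and "(- A) *\<^sub>v x = - (A *\<^sub>v x)"
    and "A *\<^sub>v (- x) = - (A *\<^sub>v x)"
  using assms
  by (auto intro!: eq_vecI simp: scalar_prod_def sum.distrib sum_subtractf sum_negf sum_distrib_left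
      algebra_simps)

lemma scalar_prod_linear:
  fixes x y z :: "'a :: comm_ring_1 vec"
  assumes "dim_vec x = dim_vec y"
  shows "dim_vec y = dim_vec z \<Longrightarrow> x \<bullet> (y + z) = x \<bullet> y + x \<bullet> z"
    and "dim_vec y = dim_vec z \<Longrightarrow> x \<bullet> (y - z) = x \<bullet> y - x \<bullet> z"
    and "dim_vec y = dim_vec z \<Longrightarrow> (x + y) \<bullet> z = x \<bullet> z + y \<bullet> z"
    and "dim_vec y = dim_vec z \<Longrightarrow> (x - y) \<bullet> z = x \<bullet> z - y \<bullet> z"
    and "(c \<cdot>\<^sub>v x) \<bullet> y = c * (x \<bullet> y)" "x \<bullet> (c \<cdot>\<^sub>v y) = c * (x \<bullet> y)"
    and "(- x) \<bullet> y = - (x \<bullet> y)" "x \<bullet> (- y) = - (x \<bullet> y)"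
  using assms
  by (auto simp: scalar_prod_def sum.distrib sum_subtractf sum_negf sum_distrib_left algebra_simps)

lemmas vec_algebra = mat_vec_assoc mat_vec_distrib scalar_prod_linear

lemma scalar_prod_transpose:
  fixes A :: "'a :: comm_ring_1 mat"
  assumes "dim_col A = dim_vec y" "dim_row A = dim_vec x"
  shows "x \<bullet> (A *\<^sub>v y) = (A\<^sup>T *\<^sub>v x) \<bullet> y"
  by (rule transpose_vec_mult_scalar[of A "dim_row A" "dim_col A" y x, symmetric])
    (use assms in \<open>auto intro: carrier_vecI\<close>)

lemma scalar_prod_symmetric:
  fixes P :: "'a :: comm_ring_1 mat"
  assumes "P \<in> carrier_mat k k" "P\<^sup>T = P" "x \<in> carrier_vec k" "y \<in> carrier_vec k"
  shows "x \<bullet> (P *\<^sub>v y) = y \<bullet> (P *\<^sub>v x)"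
  using assms scalar_prod_transpose[of P y x] scalar_prod_commute[of "P *\<^sub>v x" y] by auto

lemma unit_vec_scalar_prod_mat:
  fixes A :: "'a :: comm_ring_1 mat"
  assumes "A \<in> carrier_mat r c" "i < r" "j < c"
  shows "unit_vec r i \<bullet> (A *\<^sub>v unit_vec c j) = A $$ (i, j)"
  using assms by (simp add: scalar_prod_left_unit)

lemma polarization:
  fixes N :: "real mat"
  assumes "N \<in> carrier_mat k k" "N\<^sup>T = N" "x \<in> carrier_vec k" "y \<in> carrier_vec k"
  shows "2 * (x \<bullet> (N *\<^sub>v y)) = (x + y) \<bullet> (N *\<^sub>v (x + y)) - x \<bullet> (N *\<^sub>v x) - y \<bullet> (N *\<^sub>v y)"
proof -
  have "y \<bullet> (N *\<^sub>v x) = x \<bullet> (N *\<^sub>v y)" using assms by (intro scalar_prod_symmetric)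
  then show ?thesis using assms(1,3,4) by (simp add: vec_algebra)
qed

lemma mat_eq_iff:
  "A = B \<longleftrightarrow> dim_row A = dim_row B \<and> dim_col A = dim_col B \<and>
    (\<forall>i < dim_row B. \<forall>j < dim_col B. A $$ (i, j) = B $$ (i, j))"
  by (auto intro: eq_matI)

lemma symmetric_mat_eqI:
  fixes P Q :: "real mat"
  assumes P: "P \<in> carrier_mat k k" "P\<^sup>T = P" and Q: "Q \<in> carrier_mat k k" "Q\<^sup>T = Q"
    and eq: "\<And>x. x \<in> carrier_vec k \<Longrightarrow> x \<bullet> (P *\<^sub>v x) = x \<bullet> (Q *\<^sub>v x)"
  shows "P = Q"
proof (rule eq_matI)
  fix i j assume ij: "i < dim_row Q" "j < dim_col Q"
  let ?e = "unit_vec k :: nat \<Rightarrow> real vec"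
  have "2 * (?e i \<bullet> (P *\<^sub>v ?e j)) = 2 * (?e i \<bullet> (Q *\<^sub>v ?e j))"
    by (simp only: polarization[OF P] polarization[OF Q] eq unit_vec_carrier add_carrier_vec)
  then show "P $$ (i, j) = Q $$ (i, j)"
    using unit_vec_scalar_prod_mat[OF P(1), of i j] unit_vec_scalar_prod_mat[OF Q(1), of i j] ij Q(1)
    by (metis carrier_matD mult_cancel_left zero_neq_numeral)
qed (use P Q in auto)

text \<open>On the line \<open>x + t e\<^sub>i\<close> the form is \<open>2 t b + t\<^sup>2 c\<close>, where \<open>b\<close> is the \<open>i\<close>-th entry of \<open>P x\<close>; such
  a polynomial changes sign at \<open>t = 0\<close> unless \<open>b = 0\<close>.\<close>

lemma psd_kernel:
  assumes P: "pos_semidef k P" and x: "x \<in> carrier_vec k" and 0: "x \<bullet> (P *\<^sub>v x) = 0"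
  shows "P *\<^sub>v x = 0\<^sub>v k"
proof (rule eq_vecI)
  fix i assume "i < dim_vec (0\<^sub>v k :: real vec)"
  then have i: "i < k" by simp
  let ?e = "unit_vec k i :: real vec"
  have Pc: "P \<in> carrier_mat k k" "P\<^sup>T = P" using P by (auto simp: pos_semidef_def)
  define b where "b = ?e \<bullet> (P *\<^sub>v x)"
  define c where "c = ?e \<bullet> (P *\<^sub>v ?e)"
  have "0 \<le> (x + t \<cdot>\<^sub>v ?e) \<bullet> (P *\<^sub>v (x + t \<cdot>\<^sub>v ?e))" for t
    using P x by (auto simp: pos_semidef_def)
  also have "(x + t \<cdot>\<^sub>v ?e) \<bullet> (P *\<^sub>v (x + t \<cdot>\<^sub>v ?e)) = 2 * t * b + t\<^sup>2 * c" for t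
  proof -
    have "x \<bullet> (P *\<^sub>v ?e) = b" using scalar_prod_symmetric[OF Pc x, of ?e] by (simp add: b_def del: scalar_prod_left_unit)
    moreover have "(x + t \<cdot>\<^sub>v y) \<bullet> (P *\<^sub>v (x + t \<cdot>\<^sub>v y)) =
        t * (x \<bullet> (P *\<^sub>v y)) + t * (y \<bullet> (P *\<^sub>v x)) + t\<^sup>2 * (y \<bullet> (P *\<^sub>v y))"
      if "y \<in> carrier_vec k" for y
      using Pc(1) x 0 that by (simp add: vec_algebra power2_eq_square algebra_simps)
    ultimately show ?thesis by (simp add: b_def c_def del: scalar_prod_left_unit)
  qed
  finally have *: "0 \<le> 2 * t * b + t\<^sup>2 * c" for t .
  have "b = 0"
  proof (rule ccontr)
    assume b: "b \<noteq> 0"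
    have c0: "0 \<le> c" using P unfolding c_def pos_semidef_def by auto
    \<comment> \<open>At \<open>t = - b / (c + 1)\<close> the linear term outweighs the quadratic one.\<close>
    define s where "s = 1 / (c + 1)"
    have "0 \<le> 2 * (- b * s) * b + (- b * s)\<^sup>2 * c" by (rule *)
    also have "\<dots> = - (b\<^sup>2 * s * (2 - s * c))" by (simp add: power2_eq_square algebra_simps)
    finally have "b\<^sup>2 * s * (2 - s * c) \<le> 0" by simp
    moreover have "0 < s" "s * c < 2" using c0 by (auto simp: s_def field_simps)
    ultimately have "0 < b\<^sup>2 * s * (2 - s * c)" using b by simp
    with \<open>b\<^sup>2 * s * (2 - s * c) \<le> 0\<close> show False by linarith
  qed
  then show "(P *\<^sub>v x) $ i = 0\<^sub>v k $ i" using i Pc x by (simp add: b_def scalar_prod_left_unit)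
qed (use P in \<open>auto simp: pos_semidef_def\<close>)

lemma pos_def_imp_psd: "pos_def k P \<Longrightarrow> pos_semidef k P"
  unfolding pos_def_def pos_semidef_def
proof (intro conjI ballI; elim conjE)
  fix x :: "real vec"
  assume "P \<in> carrier_mat k k" "x \<in> carrier_vec k"
    and "\<forall>x \<in> carrier_vec k. x \<noteq> 0\<^sub>v k \<longrightarrow> 0 < x \<bullet> (P *\<^sub>v x)"
  then show "0 \<le> x \<bullet> (P *\<^sub>v x)" by (cases "x = 0\<^sub>v k") (auto simp: less_imp_le)
qed

lemma inverse_exists:
  fixes A :: "'a :: field mat"
  assumes A: "A \<in> carrier_mat k k" and inj: "\<And>x. x \<in> carrier_vec k \<Longrightarrow> A *\<^sub>v x = 0\<^sub>v k \<Longrightarrow> x = 0\<^sub>v k"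
  shows "\<exists>B \<in> carrier_mat k k. A * B = 1\<^sub>m k \<and> B * A = 1\<^sub>m k \<and> mat_inverse A = Some B"
proof -
  have "det A \<noteq> 0" using det_0_iff_vec_prod_zero_field[OF A] inj by blast
  then have "mat_inverse A \<noteq> None"
    using mat_inverse(1)[OF A, of "()"] det_non_zero_imp_unit[OF A, of "()"] by blast
  then show ?thesis using mat_inverse(2)[OF A] by blast
qed

lemma pos_def_inverse:
  assumes R: "pos_def k R"
  shows "mat_inv R \<in> carrier_mat k k" "R * mat_inv R = 1\<^sub>m k" "mat_inv R * R = 1\<^sub>m k"
    "(mat_inv R)\<^sup>T = mat_inv R"
proof -
  have Rc: "R \<in> carrier_mat k k" "R\<^sup>T = R" using R by (auto simp: pos_def_def)
  have "x = 0\<^sub>v k" if "x \<in> carrier_vec k" "R *\<^sub>v x = 0\<^sub>v k" for x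
  proof (rule ccontr)
    assume "x \<noteq> 0\<^sub>v k"
    then have "0 < x \<bullet> (R *\<^sub>v x)" using R that(1) by (auto simp: pos_def_def)
    then show False using that by simp
  qed
  from inverse_exists[OF Rc(1) this] obtain B where B: "B \<in> carrier_mat k k" "R * B = 1\<^sub>m k"
    "B * R = 1\<^sub>m k" "mat_inv R = B" by (auto simp: mat_inv_def)
  then show "mat_inv R \<in> carrier_mat k k" "R * mat_inv R = 1\<^sub>m k" "mat_inv R * R = 1\<^sub>m k" by auto
  have dims: "dim_row B = k" "dim_col B = k" "dim_row R = k" "dim_col R = k" using B Rc by auto
  have "B\<^sup>T = B\<^sup>T * (R * B)" by (simp add: B(2) mat_one dims)
  also have "\<dots> = (R * B)\<^sup>T * B" using mat_transpose(1)[of R B] by (simp add: mat_assoc Rc dims)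
  also have "\<dots> = B" by (simp add: B(2) mat_one dims)
  finally show "(mat_inv R)\<^sup>T = mat_inv R" using B by simp
qed

section \<open>Limits of matrix sequences\<close>

definition mat_tendsto :: "(nat \<Rightarrow> real mat) \<Rightarrow> real mat \<Rightarrow> bool" where
  "mat_tendsto S X \<longleftrightarrow> (\<forall>k. dim_row (S k) = dim_row X \<and> dim_col (S k) = dim_col X) \<and>
     (\<forall>i < dim_row X. \<forall>j < dim_col X. (\<lambda>k. S k $$ (i, j)) \<longlonglongrightarrow> X $$ (i, j))"

lemma mat_tendsto_const: "mat_tendsto (\<lambda>_. X) X"
  by (auto simp: mat_tendsto_def)

lemma mat_tendsto_add:
  "mat_tendsto S X \<Longrightarrow> mat_tendsto T Z \<Longrightarrow> dim_row X = dim_row Z \<Longrightarrow> dim_col X = dim_col Z \<Longrightarrow>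
    mat_tendsto (\<lambda>k. S k + T k) (X + Z)"
  by (auto simp: mat_tendsto_def intro: tendsto_add)

lemma mat_tendsto_transpose: "mat_tendsto S X \<Longrightarrow> mat_tendsto (\<lambda>k. (S k)\<^sup>T) X\<^sup>T"
  by (auto simp: mat_tendsto_def)

lemma mat_tendsto_uminus: "mat_tendsto S X \<Longrightarrow> mat_tendsto (\<lambda>k. - S k) (- X)"
  by (auto simp: mat_tendsto_def intro: tendsto_minus)

lemma mat_tendsto_mult:
  assumes S: "mat_tendsto S X" and T: "mat_tendsto T Z" and dim: "dim_col X = dim_row Z"
  shows "mat_tendsto (\<lambda>k. S k * T k) (X * Z)"
  unfolding mat_tendsto_def
proof (intro conjI allI impI)
  have dims: "dim_row (S k) = dim_row X" "dim_col (S k) = dim_col X"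
    "dim_row (T k) = dim_row Z" "dim_col (T k) = dim_col Z" for k
    using S T by (auto simp: mat_tendsto_def)
  show "dim_row (S k * T k) = dim_row (X * Z)" "dim_col (S k * T k) = dim_col (X * Z)" for k
    using dims by auto
  fix i j assume ij: "i < dim_row (X * Z)" "j < dim_col (X * Z)"
  have "(\<lambda>k. \<Sum>l = 0..<dim_row Z. S k $$ (i, l) * T k $$ (l, j)) \<longlonglongrightarrow>
      (\<Sum>l = 0..<dim_row Z. X $$ (i, l) * Z $$ (l, j))"
    using S T dim ij by (intro tendsto_sum tendsto_mult) (auto simp: mat_tendsto_def)
  then show "(\<lambda>k. (S k * T k) $$ (i, j)) \<longlonglongrightarrow> (X * Z) $$ (i, j)"
    using ij dims dim by (simp add: scalar_prod_def)
qed

lemma mat_tendsto_unique: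
  assumes "mat_tendsto S X" "mat_tendsto S Z"
  shows "X = Z"
proof (rule eq_matI)
  have "dim_row X = dim_row Z" "dim_col X = dim_col Z"
    using assms unfolding mat_tendsto_def by metis+
  then show "X $$ (i, j) = Z $$ (i, j)" if "i < dim_row Z" "j < dim_col Z" for i j
    using that assms LIMSEQ_unique[of "\<lambda>k. S k $$ (i, j)"] unfolding mat_tendsto_def by metis
qed (use assms in \<open>auto simp: mat_tendsto_def\<close>)

lemma mat_tendsto_Suc: "mat_tendsto S X \<Longrightarrow> mat_tendsto (\<lambda>k. S (Suc k)) X"
  unfolding mat_tendsto_def using LIMSEQ_Suc by blast

lemma mat_tendsto_quadratic:
  assumes S: "mat_tendsto S X" and X: "X \<in> carrier_mat r c" "x \<in> carrier_vec r" "y \<in> carrier_vec c"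
  shows "(\<lambda>k. x \<bullet> (S k *\<^sub>v y)) \<longlonglongrightarrow> x \<bullet> (X *\<^sub>v y)"
proof -
  have dims: "dim_row (S k) = r" "dim_col (S k) = c" for k
    using S X by (auto simp: mat_tendsto_def)
  have "(\<lambda>k. \<Sum>i = 0..<r. x $ i * (\<Sum>j = 0..<c. S k $$ (i, j) * y $ j)) \<longlonglongrightarrow>
      (\<Sum>i = 0..<r. x $ i * (\<Sum>j = 0..<c. X $$ (i, j) * y $ j))"
    using S X by (intro tendsto_sum tendsto_mult tendsto_const) (auto simp: mat_tendsto_def)
  then show ?thesis using X dims by (simp add: scalar_prod_def)
qed

section \<open>Hurwitz matrices and Lyapunov equations\<close>

lemma cmat_dims [simp]: "dim_row (cmat A) = dim_row A" "dim_col (cmat A) = dim_col A"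
  by auto

lemma hurwitzI:
  assumes F: "F \<in> carrier_mat k k"
    and "\<And>\<mu> v. v \<in> carrier_vec k \<Longrightarrow> cmat F *\<^sub>v v = \<mu> \<cdot>\<^sub>v v \<Longrightarrow> 0 \<le> Re \<mu> \<Longrightarrow> v = 0\<^sub>v k"
  shows "hurwitz F"
  using assms unfolding hurwitz_def eigenvalue_def eigenvector_def
  by (metis carrier_matD(1) cmat_dims(1) not_less)

lemma hurwitzD:
  assumes "hurwitz F" "F \<in> carrier_mat k k" "v \<in> carrier_vec k" "cmat F *\<^sub>v v = \<mu> \<cdot>\<^sub>v v" "0 \<le> Re \<mu>"
  shows "v = 0\<^sub>v k"
  using assms unfolding hurwitz_def eigenvalue_def eigenvector_def
  by (metis carrier_matD(1) cmat_dims(1) not_less)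

lemma cmat_eigenvalue_transpose:
  assumes F: "F \<in> carrier_mat k k" and ev: "eigenvalue (cmat F\<^sup>T) \<mu>"
  shows "eigenvalue (cmat F) \<mu>"
proof -
  have "char_poly (cmat F\<^sup>T) = char_poly (cmat F)"
    using char_poly_transpose_mat[of "cmat F" k] F by (simp add: map_mat_transpose)
  then show ?thesis
    using ev F eigenvalue_root_char_poly[of "cmat F" k] eigenvalue_root_char_poly[of "cmat F\<^sup>T" k] by auto
qed

lemma hurwitz_transpose: "F \<in> carrier_mat k k \<Longrightarrow> hurwitz F \<Longrightarrow> hurwitz F\<^sup>T"
  using cmat_eigenvalue_transpose unfolding hurwitz_def by blast

text \<open>The finitely many eigenvalues keep a positive distance from the imaginary axis.\<close>

lemma hurwitz_shift:
  assumes F: "F \<in> carrier_mat k k" and h: "hurwitz F"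
  shows "\<exists>\<epsilon> > 0. hurwitz (F + \<epsilon> \<cdot>\<^sub>m 1\<^sub>m k)"
proof -
  let ?S = "spectrum (cmat F)"
  have fin: "finite ?S" using card_finite_spectrum(1)[of "cmat F" k] F by auto
  have neg: "Re \<mu> < 0" if "\<mu> \<in> ?S" for \<mu> using h that by (auto simp: hurwitz_def spectrum_def)
  \<comment> \<open>The value -1 stands in for the empty spectrum of a matrix of size zero.\<close>
  define a where "a = Max (insert (-1) (Re ` ?S))"
  have a: "a < 0" "\<And>\<mu>. \<mu> \<in> ?S \<Longrightarrow> Re \<mu> \<le> a"
    unfolding a_def using fin neg by (auto simp: Max_ge)
  let ?e = "- a / 2"
  have "hurwitz (F + ?e \<cdot>\<^sub>m 1\<^sub>m k)"
  proof (rule hurwitzI[of _ k])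
    fix \<mu> v assume v: "v \<in> carrier_vec k" "cmat (F + ?e \<cdot>\<^sub>m 1\<^sub>m k) *\<^sub>v v = \<mu> \<cdot>\<^sub>v v" "0 \<le> Re \<mu>"
    have "cmat (F + ?e \<cdot>\<^sub>m 1\<^sub>m k) = cmat F + of_real ?e \<cdot>\<^sub>m 1\<^sub>m k"
      using F by (intro eq_matI) auto
    then have eq: "cmat F *\<^sub>v v + of_real ?e \<cdot>\<^sub>v v = \<mu> \<cdot>\<^sub>v v"
      using v F by (simp add: mat_vec_distrib)
    have "(cmat F *\<^sub>v v) $ i = (\<mu> - of_real ?e) * v $ i" if "i < k" for i
      using arg_cong[OF eq, of "\<lambda>w. w $ i"] that v F
      by (simp del: index_mult_mat_vec add: algebra_simps)
    then have ev: "cmat F *\<^sub>v v = (\<mu> - of_real ?e) \<cdot>\<^sub>v v" using v F by (intro eq_vecI) auto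
    show "v = 0\<^sub>v k"
    proof (rule ccontr)
      assume "v \<noteq> 0\<^sub>v k"
      then have "\<mu> - of_real ?e \<in> ?S" using ev v F by (auto simp: spectrum_def eigenvalue_def eigenvector_def)
      from a(2)[OF this] show False using v(3) a(1) by auto
    qed
  qed (use F in auto)
  then show ?thesis using a(1) by (intro exI[of _ ?e]) auto
qed

lemma smult_pow_mat:
  fixes A :: "'a :: comm_ring_1 mat"
  assumes A: "A \<in> carrier_mat k k"
  shows "(c \<cdot>\<^sub>m A) ^\<^sub>m l = c ^ l \<cdot>\<^sub>m (A ^\<^sub>m l)"
proof (induction l)
  case (Suc l)
  then show ?case using A by (simp add: mat_scale mat_scale smult_smult_mat mult.commute)
qed (use A in auto)

lemma pow_mat_Suc_left:
  fixes A :: "'a :: comm_ring_1 mat"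
  assumes A: "A \<in> carrier_mat k k"
  shows "A ^\<^sub>m (Suc l) = A * A ^\<^sub>m l"
proof (induction l)
  case (Suc l)
  then have "A ^\<^sub>m (Suc (Suc l)) = A * A ^\<^sub>m l * A" by simp
  also have "\<dots> = A * A ^\<^sub>m (Suc l)" using A by (simp add: mat_assoc)
  finally show ?case .
qed (use A in simp)

text \<open>Division by a number \<open>\<theta>\<close> between the spectral radius and 1 leaves a matrix of spectral radius
  below 1, whose powers are bounded.\<close>

lemma pow_decay:
  assumes A: "(A :: complex mat) \<in> carrier_mat k k" and ev: "\<And>\<mu>. eigenvalue A \<mu> \<Longrightarrow> cmod \<mu> < 1"
  shows "\<exists>c \<theta>. 0 < \<theta> \<and> \<theta> < 1 \<and> (\<forall>l. \<forall>i<k. \<forall>j<k. cmod ((A ^\<^sub>m l) $$ (i, j)) \<le> c * \<theta> ^ l)"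
proof (cases "k = 0")
  case False
  then have k: "k > 0" by simp
  define r where "r = spectral_radius A"
  have r: "\<And>\<mu>. eigenvalue A \<mu> \<Longrightarrow> cmod \<mu> \<le> r" "r < 1" "0 \<le> r"
    using spectral_radius_mem_max[OF A k] ev unfolding r_def spectrum_def by auto
  define \<theta> where "\<theta> = (1 + r) / 2"
  have \<theta>: "0 < \<theta>" "\<theta> < 1" "r < \<theta>" using r by (auto simp: \<theta>_def)
  define B where "B = of_real (1 / \<theta>) \<cdot>\<^sub>m A"
  have B: "B \<in> carrier_mat k k" using A by (simp add: B_def)
  have "spectral_radius B < 1"
  proof -
    obtain \<mu> where \<mu>: "eigenvalue B \<mu>" "spectral_radius B = cmod \<mu>"
      using spectral_radius_mem_max(1)[OF B k] by (auto simp: spectrum_def)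
    then obtain v where v: "v \<in> carrier_vec k" "v \<noteq> 0\<^sub>v k" "B *\<^sub>v v = \<mu> \<cdot>\<^sub>v v"
      using B by (auto simp: eigenvalue_def eigenvector_def)
    have AB: "A = of_real \<theta> \<cdot>\<^sub>m B" unfolding B_def using \<theta> by (intro eq_matI) auto
    have "A *\<^sub>v v = (of_real \<theta> * \<mu>) \<cdot>\<^sub>v v"
      by (subst AB) (use v B in \<open>simp add: mat_vec_distrib smult_smult_assoc\<close>)
    then have "eigenvalue A (of_real \<theta> * \<mu>)" using v A by (auto simp: eigenvalue_def eigenvector_def)
    from r(1)[OF this] have "\<theta> * cmod \<mu> \<le> r" using \<theta> by (simp add: norm_mult)
    with \<theta> have "\<theta> * cmod \<mu> < \<theta> * 1" by linarith
    then show ?thesis using \<theta> \<mu> by simp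
  qed
  from spectral_radius_jnf_norm_bound_less_1_upper_triangular[OF B this]
  obtain c where c: "\<And>l. norm_bound (B ^\<^sub>m l) c" by auto
  have "cmod ((A ^\<^sub>m l) $$ (i, j)) \<le> c * \<theta> ^ l" if "i < k" "j < k" for l i j
  proof -
    have "cmod ((B ^\<^sub>m l) $$ (i, j)) \<le> c" using c[of l] that B by (auto simp: norm_bound_def)
    moreover have "(B ^\<^sub>m l) $$ (i, j) = of_real (1 / \<theta>) ^ l * (A ^\<^sub>m l) $$ (i, j)"
      unfolding B_def smult_pow_mat[OF A] using that A by simp
    ultimately show ?thesis using \<theta> by (simp add: norm_mult norm_power norm_divide field_simps)
  qed
  then show ?thesis using \<theta> by blast
qed (auto intro: exI[of _ "1/2"])

text \<open>The Cayley transform \<open>\<Phi> = (I + F) (I - F)\<^sup>-\<^sup>1\<close> maps the open left half plane to the open unit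
  disc; it turns continuous Lyapunov equations into discrete ones, whose solutions are geometric
  series. \<open>M\<close> is the inverse of \<open>I - F\<close>.\<close>

lemma cayley_decay:
  assumes F: "F \<in> carrier_mat k k" and h: "hurwitz F"
  shows "\<exists>M \<Phi> c \<theta>. M \<in> carrier_mat k k \<and> \<Phi> \<in> carrier_mat k k \<and> \<Phi> * (1\<^sub>m k - F) = 1\<^sub>m k + F \<and>
     M * (1\<^sub>m k - F) = 1\<^sub>m k \<and> (1\<^sub>m k - F) * M = 1\<^sub>m k \<and>
     0 < \<theta> \<and> \<theta> < 1 \<and> (\<forall>l. \<forall>i<k. \<forall>j<k. \<bar>(\<Phi> ^\<^sub>m l) $$ (i, j)\<bar> \<le> c * \<theta> ^ l)"
proof -
  note dF = carrier_matD[OF F]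
  have IF: "1\<^sub>m k - F \<in> carrier_mat k k" using F by (rule minus_carrier_mat)
  have "x = 0\<^sub>v k" if x: "x \<in> carrier_vec k" "(1\<^sub>m k - F) *\<^sub>v x = 0\<^sub>v k" for x
  proof -
    have eq: "x - F *\<^sub>v x = 0\<^sub>v k" using x F by (simp add: mat_vec_distrib)
    have "(F *\<^sub>v x) $ i = x $ i" if "i < k" for i
      using arg_cong[OF eq, of "\<lambda>w. w $ i"] that x F by (simp del: index_mult_mat_vec)
    then have "F *\<^sub>v x = x" using x F by (intro eq_vecI) auto
    then have "cmat F *\<^sub>v map_vec of_real x = 1 \<cdot>\<^sub>v map_vec of_real x"
      using of_real_hom.mult_mat_vec_hom[OF F x(1), where ?'a = complex] by simp
    from hurwitzD[OF h F _ this] x have "map_vec complex_of_real x = 0\<^sub>v k" by simp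
    then have "complex_of_real (x $ i) = 0" if "i < k" for i
      using that x by (metis carrier_vecD index_map_vec(1) index_zero_vec(1))
    then show ?thesis using x by (intro eq_vecI) auto
  qed
  from inverse_exists[OF IF this] obtain M where M: "M \<in> carrier_mat k k" "(1\<^sub>m k - F) * M = 1\<^sub>m k"
    "M * (1\<^sub>m k - F) = 1\<^sub>m k" by auto
  note dM = carrier_matD[OF M(1)]
  define \<Phi> where "\<Phi> = (1\<^sub>m k + F) * M"
  have \<Phi>: "\<Phi> \<in> carrier_mat k k" unfolding \<Phi>_def using F M by auto
  have \<Phi>F: "\<Phi> * (1\<^sub>m k - F) = 1\<^sub>m k + F"
    unfolding \<Phi>_def using M F by (simp add: mat_assoc mat_one)
  have IFM: "\<Phi> = M * (1\<^sub>m k + F)"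
  proof -
    have "(1\<^sub>m k + F) * (1\<^sub>m k - F) = (1\<^sub>m k - F) * (1\<^sub>m k + F)"
      using F by (simp add: mat_algebra) (auto intro!: eq_matI simp del: index_mult_mat(1))
    then have "M * ((1\<^sub>m k + F) * (1\<^sub>m k - F)) * M = M * ((1\<^sub>m k - F) * (1\<^sub>m k + F)) * M" by simp
    also have "\<dots> = (M * (1\<^sub>m k - F)) * ((1\<^sub>m k + F) * M)" using dF dM by (simp add: mat_assoc)
    also have "\<dots> = \<Phi>" using dF dM by (simp add: M \<Phi>_def mat_one)
    also have "M * ((1\<^sub>m k + F) * (1\<^sub>m k - F)) * M = M * (1\<^sub>m k + F) * ((1\<^sub>m k - F) * M)"
      using dF dM by (simp add: mat_assoc)
    finally show ?thesis using dF dM by (simp add: M mat_one)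
  qed
  have "cmod \<mu> < 1" if "eigenvalue (cmat \<Phi>) \<mu>" for \<mu>
  proof (rule ccontr)
    assume "\<not> cmod \<mu> < 1"
    then have \<mu>1: "1 \<le> cmod \<mu>" by simp
    from that obtain w where w: "w \<in> carrier_vec k" "w \<noteq> 0\<^sub>v k" "cmat \<Phi> *\<^sub>v w = \<mu> \<cdot>\<^sub>v w"
      using \<Phi> by (auto simp: eigenvalue_def eigenvector_def)
    have c1: "cmat (1\<^sub>m k + F) = 1\<^sub>m k + cmat F" "cmat (1\<^sub>m k - F) = 1\<^sub>m k - cmat F"
      using F by (auto intro!: eq_matI)
    have "(1\<^sub>m k - F) * \<Phi> = 1\<^sub>m k + F"
      unfolding IFM using dF dM M by (simp add: mat_assoc[symmetric] mat_one)
    then have "cmat ((1\<^sub>m k - F) * \<Phi>) *\<^sub>v w = (1\<^sub>m k + cmat F) *\<^sub>v w" by (simp add: c1)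
    then have "(1\<^sub>m k - cmat F) *\<^sub>v (\<mu> \<cdot>\<^sub>v w) = (1\<^sub>m k + cmat F) *\<^sub>v w"
      unfolding of_real_hom.mat_hom_mult[OF IF \<Phi>] c1
      using w F \<Phi> by (simp add: mat_vec_assoc)
    then have eq0: "\<mu> \<cdot>\<^sub>v w - cmat F *\<^sub>v (\<mu> \<cdot>\<^sub>v w) = w + cmat F *\<^sub>v w"
      using w F by (simp only: mat_vec_distrib index_smult_vec cmat_dims carrier_matD carrier_vecD
          index_one_mat one_mult_mat_vec smult_carrier_vec)
    have eq: "(\<mu> + 1) * (cmat F *\<^sub>v w) $ i = (\<mu> - 1) * w $ i" if "i < k" for i
      using arg_cong[OF eq0, of "\<lambda>v. v $ i"] that w F
      by (simp del: index_mult_mat_vec add: mat_vec_distrib algebra_simps)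
    have \<mu>: "\<mu> + 1 \<noteq> 0"
    proof
      assume "\<mu> + 1 = 0"
      then have "\<mu> = -1" by (simp add: eq_neg_iff_add_eq_0)
      then have "w $ i = 0" if "i < k" for i using eq[OF that] by simp
      then show False using w(1,2) by (auto intro!: eq_vecI)
    qed
    have "cmat F *\<^sub>v w = ((\<mu> - 1) / (\<mu> + 1)) \<cdot>\<^sub>v w"
      using eq \<mu> w F by (intro eq_vecI) (auto simp del: index_mult_mat_vec simp: field_simps)
    moreover have "0 \<le> Re ((\<mu> - 1) / (\<mu> + 1))"
    proof -
      have "1\<^sup>2 \<le> (cmod \<mu>)\<^sup>2" using \<mu>1 by (intro power_mono) auto
      then have "0 \<le> (Re \<mu> - 1) * (Re \<mu> + 1) + Im \<mu> * Im \<mu>"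
        unfolding cmod_power2 by (simp add: power2_eq_square algebra_simps)
      then show ?thesis by (simp add: Re_divide)
    qed
    ultimately show False using hurwitzD[OF h F w(1)] w(2) by blast
  qed
  from pow_decay[of "cmat \<Phi>" k, OF map_carrier_mat[THEN iffD2, OF \<Phi>] this] obtain c \<theta> where \<theta>: "0 < \<theta>" "\<theta> < 1"
    and c: "\<And>l i j. i < k \<Longrightarrow> j < k \<Longrightarrow> cmod ((cmat \<Phi> ^\<^sub>m l) $$ (i, j)) \<le> c * \<theta> ^ l" by metis
  have "\<bar>(\<Phi> ^\<^sub>m l) $$ (i, j)\<bar> \<le> c * \<theta> ^ l" if "i < k" "j < k" for l i j
    using c[OF that, of l] that \<Phi> unfolding of_real_hom.mat_hom_pow[OF \<Phi>, symmetric]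
    by simp
  with \<theta> M \<Phi> \<Phi>F show ?thesis by blast
qed

text \<open>After the Cayley transform of both coefficients the equation reads
  \<open>X = N' + \<Phi>1\<^sup>T X \<Phi>2\<close>, and its solution is the geometric series with terms
  \<open>(\<Phi>1\<^sup>T)\<^sup>l N' \<Phi>2\<^sup>l\<close>.\<close>

lemma sylvester_solvable:
  assumes F1: "F1 \<in> carrier_mat k1 k1" "hurwitz F1" and F2: "F2 \<in> carrier_mat k2 k2" "hurwitz F2"
    and N: "N \<in> carrier_mat k1 k2"
  shows "\<exists>X \<in> carrier_mat k1 k2. F1\<^sup>T * X + X * F2 = - N"
proof -
  from cayley_decay[OF F1] obtain M1 \<Phi>1 c1 \<theta>1 where M1: "M1 \<in> carrier_mat k1 k1" "\<Phi>1 \<in> carrier_mat k1 k1"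
    "\<Phi>1 * (1\<^sub>m k1 - F1) = 1\<^sub>m k1 + F1" "M1 * (1\<^sub>m k1 - F1) = 1\<^sub>m k1" and \<theta>1: "0 < \<theta>1" "\<theta>1 < 1"
    and b1: "\<And>l i j. i < k1 \<Longrightarrow> j < k1 \<Longrightarrow> \<bar>(\<Phi>1 ^\<^sub>m l) $$ (i, j)\<bar> \<le> c1 * \<theta>1 ^ l" by metis
  from cayley_decay[OF F2] obtain M2 \<Phi>2 c2 \<theta>2 where M2: "M2 \<in> carrier_mat k2 k2" "\<Phi>2 \<in> carrier_mat k2 k2"
    "\<Phi>2 * (1\<^sub>m k2 - F2) = 1\<^sub>m k2 + F2" "M2 * (1\<^sub>m k2 - F2) = 1\<^sub>m k2" and \<theta>2: "0 < \<theta>2" "\<theta>2 < 1"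
    and b2: "\<And>l i j. i < k2 \<Longrightarrow> j < k2 \<Longrightarrow> \<bar>(\<Phi>2 ^\<^sub>m l) $$ (i, j)\<bar> \<le> c2 * \<theta>2 ^ l" by metis
  \<comment> \<open>Chosen so that multiplying the discrete equation by \<open>(I - F1)\<^sup>T\<close> and \<open>I - F2\<close> turns \<open>N'\<close> into \<open>2 N\<close>.\<close>
  define N' where "N' = 2 \<cdot>\<^sub>m (M1\<^sup>T * N * M2)"
  have N': "N' \<in> carrier_mat k1 k2" using M1 M2 N by (auto simp: N'_def)
  note d = carrier_matD[OF F1(1)] carrier_matD[OF F2(1)] carrier_matD[OF N] carrier_matD[OF N']
    carrier_matD[OF M1(1)] carrier_matD[OF M1(2)] carrier_matD[OF M2(1)] carrier_matD[OF M2(2)]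
  define T where "T l = (\<Phi>1 ^\<^sub>m l)\<^sup>T * N' * \<Phi>2 ^\<^sub>m l" for l
  define S where "S = rec_nat (0\<^sub>m k1 k2) (\<lambda>_ X. N' + \<Phi>1\<^sup>T * X * \<Phi>2)"
  have S_simps: "S 0 = 0\<^sub>m k1 k2" "\<And>l. S (Suc l) = N' + \<Phi>1\<^sup>T * S l * \<Phi>2" by (auto simp: S_def)
  have Sd: "S l \<in> carrier_mat k1 k2" for l by (cases l) (auto simp: S_simps d)
  have Td: "T l \<in> carrier_mat k1 k2" for l by (auto simp: T_def d)
  have T_Suc: "T (Suc l) = \<Phi>1\<^sup>T * T l * \<Phi>2" for l
    by (simp add: T_def d mat_assoc mat_transpose)
  have S_Suc: "S (Suc l) = S l + T l" for l
  proof (induction l)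
    case 0
    show ?case using N' M1 M2 by (simp add: S_simps T_def mat_one mat_zero d)
  next
    case (Suc l)
    have "S (Suc (Suc l)) = N' + \<Phi>1\<^sup>T * (S l + T l) * \<Phi>2" by (simp only: S_simps(2)[of "Suc l"] Suc)
    also have "\<dots> = (N' + \<Phi>1\<^sup>T * S l * \<Phi>2) + \<Phi>1\<^sup>T * T l * \<Phi>2"
      using Sd[of l] Td[of l] by (auto simp: mat_distrib d intro!: eq_matI simp del: index_mult_mat(1))
    finally show ?case by (simp only: S_simps(2)[of l] T_Suc)
  qed
  have S_sum: "S l $$ (i, j) = (\<Sum>m<l. T m $$ (i, j))" if "i < k1" "j < k2" for l i j
  proof (induction l)
    case (Suc l)
    show ?case unfolding S_Suc using Suc that Sd[of l] Td[of l] by simp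
  qed (use that in \<open>simp add: S_simps\<close>)
  have summable: "summable (\<lambda>l. T l $$ (i, j))" if ij: "i < k1" "j < k2" for i j
  proof -
    have "T l $$ (i, j) = (\<Sum>b<k2. \<Sum>a<k1. (\<Phi>1 ^\<^sub>m l) $$ (a, i) * N' $$ (a, b) * (\<Phi>2 ^\<^sub>m l) $$ (b, j))" for l
      using ij by (simp add: T_def scalar_prod_def d sum_distrib_right lessThan_atLeast0)
    moreover have "summable (\<lambda>l. (\<Phi>1 ^\<^sub>m l) $$ (a, i) * N' $$ (a, b) * (\<Phi>2 ^\<^sub>m l) $$ (b, j))"
      if ab: "a < k1" "b < k2" for a b
    proof (rule summable_comparison_test')
      show "summable (\<lambda>l. (c1 * \<bar>N' $$ (a, b)\<bar> * c2) * (\<theta>1 * \<theta>2) ^ l)"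
      proof (rule summable_mult, rule summable_geometric)
        have "\<theta>1 * \<theta>2 < 1 * 1" using \<theta>1 \<theta>2 by (intro mult_strict_mono) auto
        then show "norm (\<theta>1 * \<theta>2) < 1" using \<theta>1 \<theta>2 by simp
      qed
      fix l
      have "\<bar>(\<Phi>1 ^\<^sub>m l) $$ (a, i)\<bar> * \<bar>N' $$ (a, b)\<bar> * \<bar>(\<Phi>2 ^\<^sub>m l) $$ (b, j)\<bar> \<le>
          (c1 * \<theta>1 ^ l) * \<bar>N' $$ (a, b)\<bar> * (c2 * \<theta>2 ^ l)"
        using b1[of a i l] b2[of b j l] ij ab
        by (intro mult_mono) (auto intro: order_trans[OF abs_ge_zero] mult_nonneg_nonneg order_trans[OF mult_nonneg_nonneg])
      then show "norm ((\<Phi>1 ^\<^sub>m l) $$ (a, i) * N' $$ (a, b) * (\<Phi>2 ^\<^sub>m l) $$ (b, j))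
          \<le> (c1 * \<bar>N' $$ (a, b)\<bar> * c2) * (\<theta>1 * \<theta>2) ^ l"
        by (simp add: abs_mult power_mult_distrib algebra_simps)
    qed
    ultimately show ?thesis by (auto intro!: summable_sum)
  qed
  define X where "X = mat k1 k2 (\<lambda>(i, j). \<Sum>l. T l $$ (i, j))"
  have X: "X \<in> carrier_mat k1 k2" by (simp add: X_def)
  have lim: "mat_tendsto S X"
    unfolding mat_tendsto_def using Sd X
    by (auto simp: S_sum X_def intro!: summable_LIMSEQ summable)
  have "mat_tendsto (\<lambda>l. S (Suc l)) (N' + \<Phi>1\<^sup>T * X * \<Phi>2)"
    unfolding S_simps using X d
    by (intro mat_tendsto_add mat_tendsto_mult mat_tendsto_const lim) auto
  from mat_tendsto_unique[OF mat_tendsto_Suc[OF lim] this] have eq: "X = N' + \<Phi>1\<^sup>T * X * \<Phi>2" .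
  let ?I1 = "1\<^sub>m k1 - F1" and ?I2 = "1\<^sub>m k2 - F2"
  have "?I1\<^sup>T * X * ?I2 = ?I1\<^sup>T * (N' + \<Phi>1\<^sup>T * X * \<Phi>2) * ?I2" using eq by simp
  also have "\<dots> = 2 \<cdot>\<^sub>m ((M1 * ?I1)\<^sup>T * N * (M2 * ?I2)) + (\<Phi>1 * ?I1)\<^sup>T * X * (\<Phi>2 * ?I2)"
    unfolding N'_def mat_transpose(1)[of M1 ?I1, simplified d index_minus_mat(2,3), OF refl]
      mat_transpose(1)[of \<Phi>1 ?I1, simplified d index_minus_mat(2,3), OF refl]
    using X by (simp add: mat_distrib(1)[of "2 \<cdot>\<^sub>m _"] mat_distrib(3)[of "2 \<cdot>\<^sub>m _"] mat_assoc mat_scale d)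
  also have "\<dots> = 2 \<cdot>\<^sub>m N + (1\<^sub>m k1 + F1)\<^sup>T * X * (1\<^sub>m k2 + F2)"
    by (simp add: M1 M2 mat_one d)
  finally have "?I1\<^sup>T * X * ?I2 = 2 \<cdot>\<^sub>m N + (1\<^sub>m k1 + F1)\<^sup>T * X * (1\<^sub>m k2 + F2)" .
  then have eq2: "X - F1\<^sup>T * X - (X * F2 - F1\<^sup>T * (X * F2)) = 2 \<cdot>\<^sub>m N + (X + F1\<^sup>T * X + (X * F2 + F1\<^sup>T * (X * F2)))"
    using X by (simp add: mat_algebra d)
  \<comment> \<open>The terms \<open>X\<close> and \<open>F1\<^sup>T X F2\<close> cancel; what is left is twice the Sylvester equation.\<close>
  have "F1\<^sup>T * X + X * F2 = - N"
  proof (rule eq_matI)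
    fix i j assume "i < dim_row (- N)" "j < dim_col (- N)"
    then show "(F1\<^sup>T * X + X * F2) $$ (i, j) = (- N) $$ (i, j)"
      using arg_cong[OF eq2, of "\<lambda>Z. Z $$ (i, j)"] X d by (simp del: index_mult_mat(1))
  qed (use X d in auto)
  with X show ?thesis by blast
qed

text \<open>With \<open>D\<close> as Lyapunov function: along the discrete flow of the Cayley transform the form \<open>D\<close>
  never increases and tends to zero, so it is nonnegative at the start.\<close>

lemma lyapunov_nonneg:
  assumes F: "F \<in> carrier_mat k k" "hurwitz F" and D: "D \<in> carrier_mat k k"
    and dec: "\<And>x. x \<in> carrier_vec k \<Longrightarrow> x \<bullet> ((F\<^sup>T * D + D * F) *\<^sub>v x) \<le> 0"
    and x: "x \<in> carrier_vec k"
  shows "0 \<le> x \<bullet> (D *\<^sub>v x)"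
proof -
  from cayley_decay[OF F] obtain M \<Phi> c \<theta> where M: "M \<in> carrier_mat k k" "\<Phi> \<in> carrier_mat k k"
    "\<Phi> * (1\<^sub>m k - F) = 1\<^sub>m k + F" "(1\<^sub>m k - F) * M = 1\<^sub>m k" and \<theta>: "0 < \<theta>" "\<theta> < 1"
    and b: "\<And>l i j. i < k \<Longrightarrow> j < k \<Longrightarrow> \<bar>(\<Phi> ^\<^sub>m l) $$ (i, j)\<bar> \<le> c * \<theta> ^ l" by metis
  note d = carrier_matD[OF F(1)] carrier_matD[OF D] carrier_matD[OF M(1)] carrier_matD[OF M(2)]
  \<comment> \<open>For \<open>y = (I - F) z\<close> and \<open>\<Phi> y = (I + F) z\<close> the form changes by \<open>2 z \<bullet> (F\<^sup>T D + D F) z\<close>.\<close>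
  have step: "(\<Phi> *\<^sub>v y) \<bullet> (D *\<^sub>v (\<Phi> *\<^sub>v y)) \<le> y \<bullet> (D *\<^sub>v y)" if y: "y \<in> carrier_vec k" for y
  proof -
    define z where "z = M *\<^sub>v y"
    have z: "z \<in> carrier_vec k" using M y by (simp add: z_def)
    have "y = (1\<^sub>m k - F) *\<^sub>v z" unfolding z_def using M y d by (simp add: mat_vec_assoc[symmetric])
    then have y': "y = z - F *\<^sub>v z" using z d by (simp add: mat_vec_distrib)
    have "\<Phi> *\<^sub>v y = (\<Phi> * (1\<^sub>m k - F)) *\<^sub>v z" using z d
      by (subst mat_vec_assoc) (auto simp: \<open>y = (1\<^sub>m k - F) *\<^sub>v z\<close>)
    then have \<Phi>y: "\<Phi> *\<^sub>v y = z + F *\<^sub>v z" unfolding M using z d by (simp add: mat_vec_distrib)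
    have "z \<bullet> ((F\<^sup>T * D + D * F) *\<^sub>v z) = (F *\<^sub>v z) \<bullet> (D *\<^sub>v z) + z \<bullet> (D *\<^sub>v (F *\<^sub>v z))"
      using z d by (simp add: vec_algebra scalar_prod_transpose[of "F\<^sup>T"])
    with dec[OF z] have "(F *\<^sub>v z) \<bullet> (D *\<^sub>v z) + z \<bullet> (D *\<^sub>v (F *\<^sub>v z)) \<le> 0" by simp
    moreover have "(\<Phi> *\<^sub>v y) \<bullet> (D *\<^sub>v (\<Phi> *\<^sub>v y)) =
        y \<bullet> (D *\<^sub>v y) + 2 * ((F *\<^sub>v z) \<bullet> (D *\<^sub>v z)) + 2 * (z \<bullet> (D *\<^sub>v (F *\<^sub>v z)))"
      unfolding \<Phi>y unfolding y' using z d by (simp add: vec_algebra)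
    ultimately show ?thesis by linarith
  qed
  have le: "(\<Phi> ^\<^sub>m l *\<^sub>v x) \<bullet> (D *\<^sub>v (\<Phi> ^\<^sub>m l *\<^sub>v x)) \<le> x \<bullet> (D *\<^sub>v x)" for l
  proof (induction l)
    case (Suc l)
    have "\<Phi> ^\<^sub>m (Suc l) = \<Phi> * \<Phi> ^\<^sub>m l"
      by (rule pow_mat_Suc_left[OF M(2)])
    then have "\<Phi> ^\<^sub>m (Suc l) *\<^sub>v x = \<Phi> *\<^sub>v (\<Phi> ^\<^sub>m l *\<^sub>v x)"
      using x M d by (simp add: mat_vec_assoc)
    then show ?case
      using order_trans[OF step[OF mult_mat_vec_carrier[OF pow_carrier_mat[OF M(2)] x]] Suc] by simp
  qed (use x d in simp)
  have pow0: "(\<lambda>l. (\<Phi> ^\<^sub>m l) $$ (i, j)) \<longlonglongrightarrow> 0" if "i < k" "j < k" for i j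
  proof (rule Lim_null_comparison)
    show "\<forall>\<^sub>F l in sequentially. norm ((\<Phi> ^\<^sub>m l) $$ (i, j)) \<le> c * \<theta> ^ l" using b[OF that] by simp
    show "(\<lambda>l. c * \<theta> ^ l) \<longlonglongrightarrow> 0"
      using tendsto_mult[OF tendsto_const LIMSEQ_power_zero[of \<theta>], of c] \<theta> by simp
  qed
  have "mat_tendsto (\<lambda>l. \<Phi> ^\<^sub>m l) (0\<^sub>m k k)"
    unfolding mat_tendsto_def using pow0 d by auto
  then have "mat_tendsto (\<lambda>l. (\<Phi> ^\<^sub>m l)\<^sup>T * (D * \<Phi> ^\<^sub>m l)) ((0\<^sub>m k k)\<^sup>T * (D * 0\<^sub>m k k))"
    using d by (intro mat_tendsto_mult mat_tendsto_transpose mat_tendsto_const) auto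
  moreover have "(0\<^sub>m k k)\<^sup>T * (D * 0\<^sub>m k k) = 0\<^sub>m k k" using d by (simp add: mat_zero)
  ultimately have "mat_tendsto (\<lambda>l. (\<Phi> ^\<^sub>m l)\<^sup>T * (D * \<Phi> ^\<^sub>m l)) (0\<^sub>m k k)" by simp
  from mat_tendsto_quadratic[OF this zero_carrier_mat x x]
  have "(\<lambda>l. x \<bullet> ((\<Phi> ^\<^sub>m l)\<^sup>T * (D * \<Phi> ^\<^sub>m l) *\<^sub>v x)) \<longlonglongrightarrow> x \<bullet> (0\<^sub>m k k *\<^sub>v x)" .
  moreover have "0\<^sub>m k k *\<^sub>v x = 0\<^sub>v k" using x by (auto intro!: eq_vecI)
  then have "x \<bullet> (0\<^sub>m k k *\<^sub>v x) = 0" using x by simp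
  ultimately have "(\<lambda>l. x \<bullet> ((\<Phi> ^\<^sub>m l)\<^sup>T * (D * \<Phi> ^\<^sub>m l) *\<^sub>v x)) \<longlonglongrightarrow> 0" by simp
  moreover have "x \<bullet> ((\<Phi> ^\<^sub>m l)\<^sup>T * (D * \<Phi> ^\<^sub>m l) *\<^sub>v x) \<le> x \<bullet> (D *\<^sub>v x)" for l
  proof -
    have "x \<bullet> ((\<Phi> ^\<^sub>m l)\<^sup>T * (D * \<Phi> ^\<^sub>m l) *\<^sub>v x) = (\<Phi> ^\<^sub>m l *\<^sub>v x) \<bullet> (D *\<^sub>v (\<Phi> ^\<^sub>m l *\<^sub>v x))"
      using x d by (simp add: mat_vec_assoc scalar_prod_transpose[of "(\<Phi> ^\<^sub>m l)\<^sup>T"])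
    then show ?thesis using le[of l] by linarith
  qed
  ultimately show ?thesis by (intro LIMSEQ_le_const2) auto
qed

text \<open>The transpose of a solution is a solution too, so the symmetric part of one is again a solution.\<close>

lemma lyapunov_solvable:
  assumes F: "F \<in> carrier_mat k k" "hurwitz F" and N: "pos_semidef k N"
  shows "\<exists>X. pos_semidef k X \<and> F\<^sup>T * X + X * F = - N"
proof -
  have Nc: "N \<in> carrier_mat k k" "N\<^sup>T = N" using N by (auto simp: pos_semidef_def)
  from sylvester_solvable[OF F F Nc(1)] obtain X where X: "X \<in> carrier_mat k k" "F\<^sup>T * X + X * F = - N" by auto
  note d = carrier_matD[OF F(1)] carrier_matD[OF X(1)] carrier_matD[OF Nc(1)]
  define Z where "Z = (1/2) \<cdot>\<^sub>m (X + X\<^sup>T)"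
  have Z: "Z \<in> carrier_mat k k" "Z\<^sup>T = Z" unfolding Z_def using d
    by (auto intro!: eq_matI simp: mat_transpose)
  have XT: "X\<^sup>T * F + F\<^sup>T * X\<^sup>T = - N"
    using arg_cong[OF X(2), of transpose_mat] d Nc by (simp add: mat_transpose)
  have "F\<^sup>T * Z + Z * F = (1/2) \<cdot>\<^sub>m ((F\<^sup>T * X + X * F) + (X\<^sup>T * F + F\<^sup>T * X\<^sup>T))"
    unfolding Z_def using d
    by (simp add: mat_scale mat_distrib) (auto intro!: eq_matI simp del: index_mult_mat(1) simp: field_simps)
  also have "\<dots> = - N" unfolding X XT using d by (auto intro!: eq_matI)
  finally have eq: "F\<^sup>T * Z + Z * F = - N" .
  have "0 \<le> x \<bullet> (Z *\<^sub>v x)" if x: "x \<in> carrier_vec k" for x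
    by (rule lyapunov_nonneg[OF F Z(1) _ x])
      (use N in \<open>auto simp: eq d mat_vec_distrib scalar_prod_linear pos_semidef_def\<close>)
  with Z eq show ?thesis by (auto simp: pos_semidef_def)
qed

section \<open>Existence for the Riccati equation\<close>

text \<open>Splitting eigenvectors into real and imaginary parts makes the real quadratic forms applicable to
  complex eigenvalues.\<close>

lemma cmat_eigen_iff_real:
  assumes F: "F \<in> carrier_mat k k" and v: "v \<in> carrier_vec k"
  shows "cmat F *\<^sub>v v = \<mu> \<cdot>\<^sub>v v \<longleftrightarrow>
    F *\<^sub>v map_vec Re v = Re \<mu> \<cdot>\<^sub>v map_vec Re v - Im \<mu> \<cdot>\<^sub>v map_vec Im v \<and>
    F *\<^sub>v map_vec Im v = Im \<mu> \<cdot>\<^sub>v map_vec Re v + Re \<mu> \<cdot>\<^sub>v map_vec Im v"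
proof -
  have re: "Re ((cmat F *\<^sub>v v) $ i) = (F *\<^sub>v map_vec Re v) $ i" if "i < k" for i
    using that F v by (simp add: scalar_prod_def)
  have im: "Im ((cmat F *\<^sub>v v) $ i) = (F *\<^sub>v map_vec Im v) $ i" if "i < k" for i
    using that F v by (simp add: scalar_prod_def)
  have dims: "dim_vec (cmat F *\<^sub>v v) = k" "dim_vec (F *\<^sub>v map_vec Re v) = k"
    "dim_vec (F *\<^sub>v map_vec Im v) = k" using F by auto
  show ?thesis
    using v unfolding vec_eq_iff complex_eq_iff
    by (auto simp: re im dims simp del: index_mult_mat_vec)
qed

lemma add_uminus_mat:
  fixes A B :: "'a :: comm_ring_1 mat"
  shows "dim_row A = dim_row B \<Longrightarrow> dim_col A = dim_col B \<Longrightarrow> A + - B = A - B"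
  by (auto simp: mat_eq_iff)

lemma lyapunov_quadratic:
  assumes A: "A \<in> carrier_mat k k" and P: "P \<in> carrier_mat k k" "P\<^sup>T = P" and x: "x \<in> carrier_vec k"
  shows "x \<bullet> ((A\<^sup>T * P + P * A) *\<^sub>v x) = 2 * ((A *\<^sub>v x) \<bullet> (P *\<^sub>v (x :: real vec)))"
proof -
  have "x \<bullet> ((A\<^sup>T * P + P * A) *\<^sub>v x) = (A *\<^sub>v x) \<bullet> (P *\<^sub>v x) + x \<bullet> (P *\<^sub>v (A *\<^sub>v x))"
    using x A P(1) by (simp add: vec_algebra scalar_prod_transpose[of "A\<^sup>T"])
  also have "x \<bullet> (P *\<^sub>v (A *\<^sub>v x)) = (A *\<^sub>v x) \<bullet> (P *\<^sub>v x)"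
    by (rule scalar_prod_symmetric[OF P x mult_mat_vec_carrier[OF A x]])
  finally show ?thesis by simp
qed

text \<open>For \<open>v = a + \<i> b\<close> this is \<open>v\<^sup>* N v = 2 Re \<mu> v\<^sup>* P v\<close>, written with real vectors.\<close>

lemma eigen_quadratic_sum:
  assumes F: "F \<in> carrier_mat k k" and P: "P \<in> carrier_mat k k" "P\<^sup>T = P" and v: "v \<in> carrier_vec k"
    and eig: "cmat F *\<^sub>v v = \<mu> \<cdot>\<^sub>v v"
  defines "N \<equiv> F\<^sup>T * P + P * F" and "a \<equiv> map_vec Re v" and "b \<equiv> map_vec Im v"
  shows "a \<bullet> (N *\<^sub>v a) + b \<bullet> (N *\<^sub>v b) = 2 * Re \<mu> * (a \<bullet> (P *\<^sub>v a) + b \<bullet> (P *\<^sub>v b))"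
proof -
  have ab: "a \<in> carrier_vec k" "b \<in> carrier_vec k" using v by (auto simp: a_def b_def)
  have e: "F *\<^sub>v a = Re \<mu> \<cdot>\<^sub>v a - Im \<mu> \<cdot>\<^sub>v b" "F *\<^sub>v b = Im \<mu> \<cdot>\<^sub>v a + Re \<mu> \<cdot>\<^sub>v b"
    using eig cmat_eigen_iff_real[OF F v] by (auto simp: a_def b_def)
  have sym: "b \<bullet> (P *\<^sub>v a) = a \<bullet> (P *\<^sub>v b)" by (rule scalar_prod_symmetric[OF P ab(2,1)])
  show ?thesis
    unfolding N_def lyapunov_quadratic[OF F P ab(1)] lyapunov_quadratic[OF F P ab(2)] e using ab P sym
    by (simp add: scalar_prod_linear algebra_simps)
qed

lemma lyapunov_diff:
  fixes A P Q :: "real mat"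
  assumes "A \<in> carrier_mat k k" "P \<in> carrier_mat k k" "Q \<in> carrier_mat k k"
  shows "A\<^sup>T * (P - Q) + (P - Q) * A = (A\<^sup>T * P + P * A) - (A\<^sup>T * Q + Q * A)"
  using assms by (auto simp: mat_distrib mat_eq_iff simp del: index_mult_mat(1))

lemma quadratic_congruence:
  fixes R K :: "real mat"
  assumes "R \<in> carrier_mat m m" "K \<in> carrier_mat m k" "x \<in> carrier_vec k"
  shows "x \<bullet> (K\<^sup>T * R * K *\<^sub>v x) = (K *\<^sub>v x) \<bullet> (R *\<^sub>v (K *\<^sub>v x))"
  using assms by (simp add: mat_vec_assoc scalar_prod_transpose[of "K\<^sup>T"])

lemma quadratic_congruence_nonneg:
  assumes R: "pos_semidef m R" and K: "K \<in> carrier_mat m k" and x: "x \<in> carrier_vec k"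
  shows "0 \<le> x \<bullet> (K\<^sup>T * R * K *\<^sub>v x)"
  using R K x quadratic_congruence[of R m K k x] by (auto simp: pos_semidef_def)

lemma psd_congruence:
  assumes R: "pos_semidef m R" and K: "K \<in> carrier_mat m k"
  shows "pos_semidef k (K\<^sup>T * R * K)"
  unfolding pos_semidef_def
proof (intro conjI ballI quadratic_congruence_nonneg[OF R K])
  show "K\<^sup>T * R * K \<in> carrier_mat k k" "(K\<^sup>T * R * K)\<^sup>T = K\<^sup>T * R * K"
    using R K by (auto simp: pos_semidef_def mat_transpose mat_assoc)
qed

lemma psd_add:
  assumes "pos_semidef k P" "pos_semidef k Q"
  shows "pos_semidef k (P + Q)"
  using assms
  by (auto simp: pos_semidef_def mat_transpose mat_vec_distrib scalar_prod_linear intro!: add_nonneg_nonneg)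

text \<open>The regulator problem for \<open>x' = Y x + J u\<close> with running cost \<open>x \<bullet> Q x + u \<bullet> R u\<close>.\<close>

locale lq =
  fixes k m :: nat and Y J Q R :: "real mat"
  assumes Y: "Y \<in> carrier_mat k k" and J: "J \<in> carrier_mat k m" and Q: "pos_semidef k Q" and R: "pos_def m R"
begin

lemma Q_carrier: "Q \<in> carrier_mat k k" "Q\<^sup>T = Q" using Q by (auto simp: pos_semidef_def)
lemma R_carrier: "R \<in> carrier_mat m m" "R\<^sup>T = R" using R by (auto simp: pos_def_def)

lemmas dims = carrier_matD[OF Y] carrier_matD[OF J] carrier_matD[OF Q_carrier(1)]
  carrier_matD[OF R_carrier(1)] carrier_matD[OF pos_def_inverse(1)[OF R]]

definition gain :: "real mat \<Rightarrow> real mat" where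
  "gain P = - (mat_inv R * J\<^sup>T * P)"

lemma gain_carrier: "P \<in> carrier_mat k k \<Longrightarrow> gain P \<in> carrier_mat m k"
  by (auto simp: gain_def dims)

lemma R_gain:
  assumes P: "P \<in> carrier_mat k k"
  shows "R * gain P = - (J\<^sup>T * P)"
proof -
  have "R * gain P = - ((R * mat_inv R) * (J\<^sup>T * P))"
    using P by (simp add: gain_def mat_scale mat_assoc dims)
  then show ?thesis using P by (simp add: pos_def_inverse[OF R] mat_one dims)
qed

lemma J_gain:
  assumes P: "P \<in> carrier_mat k k" "P\<^sup>T = P"
  shows "P * J = - ((gain P)\<^sup>T * R)"
proof -
  have "P * J = (J\<^sup>T * P)\<^sup>T" using P by (simp add: mat_transpose dims)
  also have "J\<^sup>T * P = - (R * gain P)" using P R_gain[OF P(1)] by simp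
  finally show ?thesis using gain_carrier[OF P(1)] R_carrier by (simp add: mat_transpose dims)
qed

lemma gain_quadratic:
  assumes P: "P \<in> carrier_mat k k" "P\<^sup>T = P"
  shows "P * J * mat_inv R * J\<^sup>T * P = (gain P)\<^sup>T * (R * gain P)"
proof -
  have "P * J * mat_inv R * J\<^sup>T * P = - (P * J * gain P)"
    using P by (simp add: gain_def mat_scale mat_assoc dims)
  also have "\<dots> = (gain P)\<^sup>T * (R * gain P)"
    unfolding J_gain[OF P] using gain_carrier[OF P(1)] R_carrier by (simp add: mat_scale mat_assoc dims)
  finally show ?thesis .
qed

text \<open>The Riccati equation says that \<open>P\<close> is the cost matrix of the feedback that \<open>P\<close> itself induces.
  The passage between the two forms uses \<open>P J = - K\<^sup>T R\<close>.\<close>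

lemma riccati_iff_lyapunov:
  assumes P: "P \<in> carrier_mat k k" "P\<^sup>T = P"
  defines "K \<equiv> gain P"
  shows "riccati Y J Q R P \<longleftrightarrow> (Y + J * K)\<^sup>T * P + P * (Y + J * K) = - (Q + K\<^sup>T * (R * K))"
proof -
  have K: "K \<in> carrier_mat m k" using gain_carrier P by (simp add: K_def)
  note d = dims carrier_matD[OF P(1)] carrier_matD[OF K]
  have "(Y + J * K)\<^sup>T * P + P * (Y + J * K) = (Y\<^sup>T * P + K\<^sup>T * (J\<^sup>T * P)) + (P * Y + (P * J) * K)"
    by (simp add: mat_transpose mat_distrib mat_assoc d)
  also have "J\<^sup>T * P = - (R * K)" using P R_gain[OF P(1)] by (simp add: K_def)
  also have "P * J = - (K\<^sup>T * R)" unfolding K_def by (rule J_gain[OF P])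
  finally have 1: "(Y + J * K)\<^sup>T * P + P * (Y + J * K) =
      (Y\<^sup>T * P - K\<^sup>T * (R * K)) + (P * Y - K\<^sup>T * (R * K))"
    by (simp add: mat_scale mat_assoc d add_uminus_mat)
  show ?thesis
    unfolding riccati_def gain_quadratic[OF P] 1 K_def[symmetric]
    using d by (auto simp: mat_eq_iff algebra_simps simp del: index_mult_mat(1))
qed

text \<open>The improvement step of policy iteration: \<open>P\<close> is the cost matrix of \<open>K\<close>, and \<open>K'\<close> is the gain that
  \<open>P\<close> induces. The additional square \<open>(K - K')\<^sup>T R (K - K')\<close> is what makes the iteration monotone.\<close>

lemma kleinman_identity:
  assumes K: "K \<in> carrier_mat m k" and P: "P \<in> carrier_mat k k" "P\<^sup>T = P"
    and lyap: "(Y + J * K)\<^sup>T * P + P * (Y + J * K) = - (Q + K\<^sup>T * R * K)"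
  defines "K' \<equiv> gain P"
  shows "(Y + J * K')\<^sup>T * P + P * (Y + J * K') = - (Q + K'\<^sup>T * R * K' + (K - K')\<^sup>T * R * (K - K'))"
proof -
  have K': "K' \<in> carrier_mat m k" using gain_carrier P by (simp add: K'_def)
  note d = dims carrier_matD[OF P(1)] carrier_matD[OF K'] carrier_matD[OF K]
  have expand: "(Y + J * Z)\<^sup>T * P + P * (Y + J * Z) = (Y\<^sup>T * P - Z\<^sup>T * (R * K')) + (P * Y - K'\<^sup>T * (R * Z))"
    if Z: "Z \<in> carrier_mat m k" for Z
  proof -
    have "(Y + J * Z)\<^sup>T * P + P * (Y + J * Z) = (Y\<^sup>T * P + Z\<^sup>T * (J\<^sup>T * P)) + (P * Y + (P * J) * Z)"
      using Z by (simp add: mat_transpose mat_distrib mat_assoc d)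
    also have "J\<^sup>T * P = - (R * K')" using P R_gain[OF P(1)] by (simp add: K'_def)
    also have "P * J = - (K'\<^sup>T * R)" unfolding K'_def by (rule J_gain[OF P])
    finally show ?thesis using Z by (simp add: mat_scale mat_assoc d add_uminus_mat)
  qed
  show ?thesis
    using lyap unfolding expand[OF K] expand[OF K'] using d
    by (auto simp: mat_eq_iff mat_transpose mat_distrib mat_assoc algebra_simps simp del: index_mult_mat(1))
qed

text \<open>On an eigenvector with \<open>Re \<mu> \<ge> 0\<close> the nonpositive form of the previous identity has to vanish. Its
  square then shows that \<open>K\<close> and the new gain agree there, so the vector is also an eigenvector of
  the Hurwitz matrix \<open>Y + J K\<close>.\<close>

lemma kleinman_hurwitz:
  assumes K: "K \<in> carrier_mat m k" and P: "pos_semidef k P" and h: "hurwitz (Y + J * K)"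
    and lyap: "(Y + J * K)\<^sup>T * P + P * (Y + J * K) = - (Q + K\<^sup>T * R * K)"
  shows "hurwitz (Y + J * gain P)"
proof (rule hurwitzI)
  define K' where "K' = gain P"
  have Pc: "P \<in> carrier_mat k k" "P\<^sup>T = P" using P by (auto simp: pos_semidef_def)
  have K': "K' \<in> carrier_mat m k" using gain_carrier Pc by (simp add: K'_def)
  note d = dims carrier_matD[OF Pc(1)] carrier_matD[OF K'] carrier_matD[OF K]
  let ?A = "Y + J * K" and ?A' = "Y + J * gain P"
  show A': "?A' \<in> carrier_mat k k" using Y J K' by (auto simp: K'_def)
  have A: "?A \<in> carrier_mat k k" using Y J K by auto
  fix \<mu> v assume v: "v \<in> carrier_vec k" "cmat ?A' *\<^sub>v v = \<mu> \<cdot>\<^sub>v v" "0 \<le> Re \<mu>"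
  define a b where "a = map_vec Re v" and "b = map_vec Im v"
  have ab: "a \<in> carrier_vec k" "b \<in> carrier_vec k" using v by (auto simp: a_def b_def)
  have eig: "?A' *\<^sub>v a = Re \<mu> \<cdot>\<^sub>v a - Im \<mu> \<cdot>\<^sub>v b" "?A' *\<^sub>v b = Im \<mu> \<cdot>\<^sub>v a + Re \<mu> \<cdot>\<^sub>v b"
    using v cmat_eigen_iff_real[OF A' v(1)] by (auto simp: a_def b_def)
  define N where "N = ?A'\<^sup>T * P + P * ?A'"
  have "a \<bullet> (N *\<^sub>v a) + b \<bullet> (N *\<^sub>v b) = 2 * Re \<mu> * (a \<bullet> (P *\<^sub>v a) + b \<bullet> (P *\<^sub>v b))"
    unfolding N_def a_def b_def by (rule eigen_quadratic_sum[OF A' Pc v(1,2)])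
  moreover have "0 \<le> a \<bullet> (P *\<^sub>v a) + b \<bullet> (P *\<^sub>v b)" using P ab by (auto simp: pos_semidef_def)
  ultimately have nonneg: "0 \<le> a \<bullet> (N *\<^sub>v a) + b \<bullet> (N *\<^sub>v b)" using v(3) by simp
  have N: "N = - (Q + K'\<^sup>T * R * K' + (K - K')\<^sup>T * R * (K - K'))"
    unfolding N_def K'_def by (rule kleinman_identity[OF K Pc lyap])
  have Rp: "pos_semidef m R" by (rule pos_def_imp_psd[OF R])
  have KK: "K - K' \<in> carrier_mat m k" by (rule minus_carrier_mat[OF K'])
  have split: "x \<bullet> (N *\<^sub>v x) = - (x \<bullet> (Q *\<^sub>v x)) - x \<bullet> (K'\<^sup>T * R * K' *\<^sub>v x)
      - ((K - K') *\<^sub>v x) \<bullet> (R *\<^sub>v ((K - K') *\<^sub>v x))" if x: "x \<in> carrier_vec k" for x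
  proof -
    have "x \<bullet> ((K - K')\<^sup>T * R * (K - K') *\<^sub>v x) = ((K - K') *\<^sub>v x) \<bullet> (R *\<^sub>v ((K - K') *\<^sub>v x))"
      by (rule quadratic_congruence[OF R_carrier(1) KK x])
    moreover have "x \<bullet> (N *\<^sub>v x) = - (x \<bullet> (Q *\<^sub>v x)) - x \<bullet> (K'\<^sup>T * R * K' *\<^sub>v x)
      - x \<bullet> ((K - K')\<^sup>T * R * (K - K') *\<^sub>v x)"
      unfolding N using x d by (simp add: mat_vec_distrib(1,7) scalar_prod_linear(1,8))
    ultimately show ?thesis by simp
  qed
  have neg: "x \<bullet> (N *\<^sub>v x) \<le> - (((K - K') *\<^sub>v x) \<bullet> (R *\<^sub>v ((K - K') *\<^sub>v x)))" if x: "x \<in> carrier_vec k" for x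
    using split[OF x] Q x quadratic_congruence_nonneg[OF Rp K' x] by (auto simp: pos_semidef_def)
  have Rnn: "0 \<le> ((K - K') *\<^sub>v x) \<bullet> (R *\<^sub>v ((K - K') *\<^sub>v x))" if x: "x \<in> carrier_vec k" for x
    using Rp x KK by (auto simp: pos_semidef_def)
  have same: "?A' *\<^sub>v x = ?A *\<^sub>v x" if x: "x \<in> carrier_vec k" and 0: "((K - K') *\<^sub>v x) \<bullet> (R *\<^sub>v ((K - K') *\<^sub>v x)) = 0" for x
  proof -
    have "(K - K') *\<^sub>v x = 0\<^sub>v m"
      using R 0 mult_mat_vec_carrier[OF KK x] unfolding pos_def_def by (metis less_irrefl)
    then have *: "K *\<^sub>v x - K' *\<^sub>v x = 0\<^sub>v m" using x d by (simp add: mat_vec_distrib)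
    have "(K *\<^sub>v x) $ i = (K' *\<^sub>v x) $ i" if "i < m" for i
      using arg_cong[OF *, of "\<lambda>w. w $ i"] that d by (simp del: index_mult_mat_vec)
    then have "K *\<^sub>v x = K' *\<^sub>v x" using d by (intro eq_vecI) auto
    then show ?thesis using x d by (simp add: K'_def[symmetric] mat_vec_distrib mat_vec_assoc)
  qed
  have "((K - K') *\<^sub>v a) \<bullet> (R *\<^sub>v ((K - K') *\<^sub>v a)) = 0" "((K - K') *\<^sub>v b) \<bullet> (R *\<^sub>v ((K - K') *\<^sub>v b)) = 0"
    using neg[OF ab(1)] neg[OF ab(2)] Rnn[OF ab(1)] Rnn[OF ab(2)] nonneg by linarith+
  then have "cmat ?A *\<^sub>v v = \<mu> \<cdot>\<^sub>v v"
    using eig same ab cmat_eigen_iff_real[OF A v(1)] by (auto simp: a_def b_def)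
  then show "v = 0\<^sub>v k" by (rule hurwitzD[OF h A v(1) _ v(3)])
qed

text \<open>Kleinman's policy iteration: each gain is stabilizing, and its cost matrix does not exceed the
  previous one. The cost matrices are bounded below by zero, so they converge, and in the limit
  the gain is that of its own cost matrix, which is the Riccati equation.\<close>

lemma riccati_solvable:
  assumes K0: "K0 \<in> carrier_mat m k" and h0: "hurwitz (Y + J * K0)"
  shows "\<exists>P. pos_semidef k P \<and> riccati Y J Q R P"
proof -
  define good where "good K P \<longleftrightarrow> K \<in> carrier_mat m k \<and> hurwitz (Y + J * K) \<and> pos_semidef k P \<and>
     (Y + J * K)\<^sup>T * P + P * (Y + J * K) = - (Q + K\<^sup>T * R * K)" for K P
  have ex: "\<exists>P. good K P" if "K \<in> carrier_mat m k" "hurwitz (Y + J * K)" for K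
    using lyapunov_solvable[OF _ that(2) psd_add[OF Q psd_congruence[OF pos_def_imp_psd[OF R] that(1)]]]
      that Y J unfolding good_def by auto
  have "\<exists>f. \<forall>l. good (fst (f l)) (snd (f l)) \<and> fst (f (Suc l)) = gain (snd (f l))"
  proof (rule dependent_nat_choice)
    show "\<exists>x. good (fst x) (snd x)" using ex[OF K0 h0] by auto
  next
    fix x l assume "good (fst x) (snd x)"
    then have "gain (snd x) \<in> carrier_mat m k" "hurwitz (Y + J * gain (snd x))"
      using kleinman_hurwitz gain_carrier unfolding good_def pos_semidef_def by blast+
    from ex[OF this] show "\<exists>y. good (fst y) (snd y) \<and> fst y = gain (snd x)" by auto
  qed
  then obtain f where f: "\<And>l. good (fst (f l)) (snd (f l))" "\<And>l. fst (f (Suc l)) = gain (snd (f l))" by auto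
  define K P where "K l = fst (f l)" and "P l = snd (f l)" for l
  have good: "K l \<in> carrier_mat m k" "hurwitz (Y + J * K l)" "pos_semidef k (P l)"
     "(Y + J * K l)\<^sup>T * P l + P l * (Y + J * K l) = - (Q + (K l)\<^sup>T * R * K l)" for l
    using f(1)[of l] by (auto simp: good_def K_def P_def)
  have K_Suc: "K (Suc l) = gain (P l)" for l using f(2) by (simp add: K_def P_def)
  have P: "P l \<in> carrier_mat k k" "(P l)\<^sup>T = P l" for l using good(3) by (auto simp: pos_semidef_def)
  have dec: "x \<bullet> (P (Suc l) *\<^sub>v x) \<le> x \<bullet> (P l *\<^sub>v x)" if x: "x \<in> carrier_vec k" for x l
  proof -
    let ?A = "Y + J * K (Suc l)" and ?E = "(K l - K (Suc l))\<^sup>T * R * (K l - K (Suc l))"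
    have A: "?A \<in> carrier_mat k k" using Y J good(1) by auto
    have D: "P l - P (Suc l) \<in> carrier_mat k k" by (rule minus_carrier_mat[OF P(1)])
    have KK: "K l - K (Suc l) \<in> carrier_mat m k" by (intro minus_carrier_mat good(1))
    have E: "?E \<in> carrier_mat k k" using KK R_carrier by auto
    note d = carrier_matD[OF P(1)] carrier_matD[OF A] carrier_matD[OF E] dims carrier_matD[OF good(1)]
    have 1: "?A\<^sup>T * P l + P l * ?A = - (Q + (K (Suc l))\<^sup>T * R * K (Suc l) + ?E)"
      unfolding K_Suc by (rule kleinman_identity[OF good(1) P good(4)])
    have "?A\<^sup>T * (P l - P (Suc l)) + (P l - P (Suc l)) * ?A = - ?E"
    proof -
      have "?A\<^sup>T * (P l - P (Suc l)) + (P l - P (Suc l)) * ?A =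
          (?A\<^sup>T * P l + P l * ?A) - (?A\<^sup>T * P (Suc l) + P (Suc l) * ?A)"
        by (rule lyapunov_diff[OF A P(1) P(1)])
      also have "\<dots> = - ?E"
        unfolding 1 good(4) using d by (auto simp: mat_eq_iff simp del: index_mult_mat(1))
      finally show ?thesis .
    qed
    then have "0 \<le> x \<bullet> ((P l - P (Suc l)) *\<^sub>v x)"
      by (intro lyapunov_nonneg[OF A good(2) D _ x])
        (use E quadratic_congruence_nonneg[OF pos_def_imp_psd[OF R] KK] in
          \<open>auto simp: mat_vec_distrib(7) scalar_prod_linear(8)\<close>)
    then show ?thesis using x P by (simp add: mat_vec_distrib(2) scalar_prod_linear(2) d)
  qed
  have conv: "convergent (\<lambda>l. x \<bullet> (P l *\<^sub>v x))" if x: "x \<in> carrier_vec k" for x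
  proof -
    have "decseq (\<lambda>l. x \<bullet> (P l *\<^sub>v x))" using dec[OF x] by (intro decseq_SucI)
    moreover have "0 \<le> x \<bullet> (P l *\<^sub>v x)" for l using good(3)[of l] x by (auto simp: pos_semidef_def)
    ultimately show ?thesis using decseq_convergent[of _ 0] unfolding convergent_def by metis
  qed
  define X where "X = mat k k (\<lambda>(i, j). lim (\<lambda>l. P l $$ (i, j)))"
  have X: "X \<in> carrier_mat k k" by (simp add: X_def)
  have lim: "mat_tendsto P X"
    unfolding mat_tendsto_def
  proof (intro conjI allI impI)
    fix i j assume ij: "i < dim_row X" "j < dim_col X"
    let ?e = "unit_vec k :: nat \<Rightarrow> real vec"
    have "P l $$ (i, j) = (1/2) * ((?e i + ?e j) \<bullet> (P l *\<^sub>v (?e i + ?e j)) - ?e i \<bullet> (P l *\<^sub>v ?e i) - ?e j \<bullet> (P l *\<^sub>v ?e j))" for l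
      using polarization[OF P, of "?e i" "?e j" l] unit_vec_scalar_prod_mat[OF P(1), of i j l] ij X by simp
    then have "convergent (\<lambda>l. P l $$ (i, j))"
      by (simp only:) (intro convergent_mult convergent_const convergent_diff conv; simp)
    then show "(\<lambda>l. P l $$ (i, j)) \<longlonglongrightarrow> X $$ (i, j)"
      using ij by (simp add: X_def convergent_LIMSEQ_iff)
  qed (use P X in auto)
  have XT: "X\<^sup>T = X"
    using mat_tendsto_unique[OF mat_tendsto_transpose[OF lim]] lim by (simp add: P)
  have "0 \<le> x \<bullet> (X *\<^sub>v x)" if x: "x \<in> carrier_vec k" for x
    using good(3) x by (intro LIMSEQ_le_const[OF mat_tendsto_quadratic[OF lim X x x]])
      (auto simp: pos_semidef_def)
  then have psd: "pos_semidef k X" using X XT by (auto simp: pos_semidef_def)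
  have limK: "mat_tendsto (\<lambda>l. K (Suc l)) (gain X)"
    unfolding K_Suc gain_def using X
    by (intro mat_tendsto_uminus mat_tendsto_mult mat_tendsto_const lim) (auto simp: dims)
  note dX = dims carrier_matD[OF X] carrier_matD[OF gain_carrier[OF X]]
  have lim1: "mat_tendsto (\<lambda>l. (Y + J * K (Suc l))\<^sup>T * P (Suc l) + P (Suc l) * (Y + J * K (Suc l)))
      ((Y + J * gain X)\<^sup>T * X + X * (Y + J * gain X))"
    by (intro mat_tendsto_add mat_tendsto_mult mat_tendsto_transpose mat_tendsto_const mat_tendsto_Suc[OF lim] limK)
      (auto simp: dX)
  have lim2: "mat_tendsto (\<lambda>l. - (Q + (K (Suc l))\<^sup>T * R * K (Suc l))) (- (Q + (gain X)\<^sup>T * R * gain X))"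
    by (intro mat_tendsto_uminus mat_tendsto_add mat_tendsto_mult mat_tendsto_transpose mat_tendsto_const limK)
      (auto simp: dX)
  have "(Y + J * gain X)\<^sup>T * X + X * (Y + J * gain X) = - (Q + (gain X)\<^sup>T * (R * gain X))"
    using mat_tendsto_unique[OF lim1] lim2 by (simp add: good(4) mat_assoc dX)
  then have "riccati Y J Q R X" using riccati_iff_lyapunov[OF X XT] by simp
  with psd show ?thesis by blast
qed

end

section \<open>Stabilizing the augmented plant\<close>

text \<open>Value of the polynomial \<open>f\<close> at the matrix \<open>G\<close>, applied to \<open>x\<close>. Any bound \<open>N\<close> above the
  degree gives the same vector, which makes it visibly linear in \<open>f\<close>.\<close>

definition poly_vec :: "nat \<Rightarrow> complex poly \<Rightarrow> complex mat \<Rightarrow> complex vec \<Rightarrow> complex vec" where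
  "poly_vec N f G x = vec (dim_row G) (\<lambda>i. \<Sum>j<N. coeff f j * (G ^\<^sub>m j *\<^sub>v x) $ i)"

lemma poly_vec_carrier: "G \<in> carrier_mat k k \<Longrightarrow> poly_vec N f G x \<in> carrier_vec k"
  by (simp add: poly_vec_def)

lemma mult_poly_vec:
  assumes Z: "Z \<in> carrier_mat r k" and G: "G \<in> carrier_mat k k" and x: "x \<in> carrier_vec k" and i: "i < r"
  shows "(Z *\<^sub>v poly_vec N f G x) $ i = (\<Sum>j<N. coeff f j * (Z *\<^sub>v (G ^\<^sub>m j *\<^sub>v x)) $ i)"
proof -
  have "(Z *\<^sub>v poly_vec N f G x) $ i = (\<Sum>l<k. Z $$ (i, l) * (\<Sum>j<N. coeff f j * (G ^\<^sub>m j *\<^sub>v x) $ l))"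
    using Z G i by (simp add: poly_vec_def scalar_prod_def lessThan_atLeast0 del: index_mult_mat_vec)
      (simp add: scalar_prod_def poly_vec_def)
  also have "\<dots> = (\<Sum>j<N. coeff f j * (\<Sum>l<k. Z $$ (i, l) * (G ^\<^sub>m j *\<^sub>v x) $ l))"
    unfolding sum_distrib_left by (subst sum.swap) (simp add: mult.left_commute)
  also have "\<dots> = (\<Sum>j<N. coeff f j * (Z *\<^sub>v (G ^\<^sub>m j *\<^sub>v x)) $ i)"
    using Z G i by (simp add: scalar_prod_def lessThan_atLeast0)
  finally show ?thesis .
qed

lemma poly_vec_linear_factor:
  assumes G: "G \<in> carrier_mat k k" and x: "x \<in> carrier_vec k" and deg: "degree g < N"
  shows "poly_vec (Suc N) ([:- \<mu>, 1:] * g) G x = G *\<^sub>v poly_vec N g G x - \<mu> \<cdot>\<^sub>v poly_vec N g G x"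
proof (rule eq_vecI)
  fix i assume "i < dim_vec (G *\<^sub>v poly_vec N g G x - \<mu> \<cdot>\<^sub>v poly_vec N g G x)"
  then have i: "i < k" using G by (simp add: poly_vec_def)
  let ?p = "\<lambda>j. (G ^\<^sub>m j *\<^sub>v x) $ i"
  have c: "coeff ([:- \<mu>, 1:] * g) j = coeff (pCons 0 g) j - \<mu> * coeff g j" for j by simp
  have "poly_vec (Suc N) ([:- \<mu>, 1:] * g) G x $ i =
      (\<Sum>j<Suc N. coeff (pCons 0 g) j * ?p j) - \<mu> * (\<Sum>j<Suc N. coeff g j * ?p j)"
    using i G unfolding poly_vec_def c by (simp add: sum_subtractf sum_distrib_left algebra_simps del: sum.lessThan_Suc)
  also have "(\<Sum>j<Suc N. coeff (pCons 0 g) j * ?p j) = (\<Sum>j<N. coeff g j * ?p (Suc j))"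
    by (subst sum.lessThan_Suc_shift) simp
  also have "\<dots> = (\<Sum>j<N. coeff g j * (G *\<^sub>v (G ^\<^sub>m j *\<^sub>v x)) $ i)"
    using G x by (simp add: pow_mat_Suc_left[OF G] mat_vec_assoc del: pow_mat.simps)
  also have "\<dots> = (G *\<^sub>v poly_vec N g G x) $ i"
    by (rule mult_poly_vec[OF G G x i, symmetric])
  also have "(\<Sum>j<Suc N. coeff g j * ?p j) = poly_vec N g G x $ i"
    using i G deg by (simp add: poly_vec_def coeff_eq_0)
  finally show "poly_vec (Suc N) ([:- \<mu>, 1:] * g) G x $ i =
      (G *\<^sub>v poly_vec N g G x - \<mu> \<cdot>\<^sub>v poly_vec N g G x) $ i"
    using i G by (simp add: poly_vec_def)
qed (use G in \<open>simp add: poly_vec_def\<close>)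

lemma poly_vec_bound:
  assumes "degree f < N" "N \<le> N'"
  shows "poly_vec N' f G x = poly_vec N f G x"
proof -
  have "(\<Sum>j<N'. coeff f j * (G ^\<^sub>m j *\<^sub>v x) $ i) = (\<Sum>j<N. coeff f j * (G ^\<^sub>m j *\<^sub>v x) $ i)" for i
    using assms by (intro sum.mono_neutral_right) (auto simp: coeff_eq_0)
  then show ?thesis by (simp add: poly_vec_def)
qed

text \<open>The \<open>k + 1\<close> vectors \<open>x, G x, \<dots>, G\<^sup>k x\<close> in dimension \<open>k\<close> are linearly dependent; a zero row
  below them makes the matrix of these vectors square and singular.\<close>

lemma annihilating_poly_exists:
  fixes G :: "complex mat"
  assumes G: "G \<in> carrier_mat k k" and x: "x \<in> carrier_vec k"
  shows "\<exists>f. f \<noteq> 0 \<and> degree f < Suc k \<and> poly_vec (Suc k) f G x = 0\<^sub>v k"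
proof -
  define M where "M = mat (Suc k) (Suc k) (\<lambda>(i, j). if i < k then (G ^\<^sub>m j *\<^sub>v x) $ i else 0)"
  have M: "M \<in> carrier_mat (Suc k) (Suc k)" by (simp add: M_def)
  have "M\<^sup>T *\<^sub>v unit_vec (Suc k) k = 0\<^sub>v (Suc k)"
    by (auto intro!: eq_vecI simp: M_def)
  moreover have "unit_vec (Suc k) k \<noteq> (0\<^sub>v (Suc k) :: complex vec)" by simp
  ultimately have "det M\<^sup>T = 0"
    using det_0_iff_vec_prod_zero_field[of "M\<^sup>T" "Suc k"] M transpose_carrier_mat unit_vec_carrier by blast
  then obtain v where v: "v \<in> carrier_vec (Suc k)" "v \<noteq> 0\<^sub>v (Suc k)" "M *\<^sub>v v = 0\<^sub>v (Suc k)"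
    using det_transpose[OF M] det_0_iff_vec_prod_zero_field[OF M] by auto
  define f where "f = Poly (list_of_vec v)"
  have cf: "coeff f j = (if j < Suc k then v $ j else 0)" for j
    using v by (auto simp: f_def nth_default_def)
  obtain j where j: "j < Suc k" "v $ j \<noteq> 0" using v by (metis carrier_vecD eq_vecI index_zero_vec(1,2))
  have "f \<noteq> 0" using cf[of j] j by auto
  moreover have "degree f \<le> k" by (rule degree_le) (auto simp: cf)
  moreover have "poly_vec (Suc k) f G x = 0\<^sub>v k"
  proof (rule eq_vecI)
    fix i assume "i < dim_vec (0\<^sub>v k :: complex vec)"
    then have i: "i < k" by simp
    have "(\<Sum>j<Suc k. (G ^\<^sub>m j *\<^sub>v x) $ i * v $ j) = (M *\<^sub>v v) $ i"
      using i v(1) by (simp add: M_def scalar_prod_def lessThan_atLeast0 del: sum.lessThan_Suc sum.op_ivl_Suc)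
    also have "\<dots> = 0" using v i by simp
    finally show "poly_vec (Suc k) f G x $ i = 0\<^sub>v k $ i"
      using i G by (simp add: poly_vec_def cf mult.commute del: sum.lessThan_Suc)
  qed (use G in \<open>simp add: poly_vec_def\<close>)
  ultimately show ?thesis by (intro exI[of _ f]) auto
qed

text \<open>A nonzero vector that the observations never see generates a cyclic subspace with an
  eigenvector that they do not see either: strip one linear factor off an annihilating polynomial
  of least degree.\<close>

lemma popov_belevitch_hautus:
  fixes G H :: "complex mat"
  assumes G: "G \<in> carrier_mat k k" and H: "H \<in> carrier_mat r k" and x: "x \<in> carrier_vec k"
    and unseen: "\<And>j. H *\<^sub>v (G ^\<^sub>m j *\<^sub>v x) = 0\<^sub>v r"
    and hautus: "\<And>\<mu> w. w \<in> carrier_vec k \<Longrightarrow> G *\<^sub>v w = \<mu> \<cdot>\<^sub>v w \<Longrightarrow> H *\<^sub>v w = 0\<^sub>v r \<Longrightarrow> w = 0\<^sub>v k"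
  shows "x = 0\<^sub>v k"
proof (rule ccontr)
  assume x0: "x \<noteq> 0\<^sub>v k"
  define ann where "ann f \<longleftrightarrow> f \<noteq> 0 \<and> degree f < Suc k \<and> poly_vec (Suc k) f G x = 0\<^sub>v k" for f
  obtain f where f: "ann f" and least: "\<And>g. ann g \<Longrightarrow> degree f \<le> degree g"
    using annihilating_poly_exists[OF G x] ex_has_least_nat[of ann _ degree] unfolding ann_def by metis
  have "degree f \<noteq> 0"
  proof
    assume "degree f = 0"
    then obtain c where c: "f = [:c:]" "c \<noteq> 0" using f by (auto simp: ann_def elim: degree_eq_zeroE)
    have "poly_vec 1 f G x = poly_vec (Suc k) f G x" using c by (intro poly_vec_bound[symmetric]) auto
    then have "poly_vec 1 f G x = 0\<^sub>v k" using f by (simp add: ann_def)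
    then have "poly_vec 1 f G x $ i = 0" if "i < k" for i using that by simp
    then have "c * x $ i = 0" if "i < k" for i using that G x c by (auto simp: poly_vec_def)
    then show False using x0 x c by (auto intro!: eq_vecI)
  qed
  then obtain \<mu> where "poly f \<mu> = 0" using fundamental_theorem_of_algebra[of f] by (auto simp: constant_degree)
  then obtain g where g: "f = [:- \<mu>, 1:] * g" by (auto simp: poly_eq_0_iff_dvd elim: dvdE)
  have g0: "g \<noteq> 0" using f g by (auto simp: ann_def)
  have deg: "degree f = Suc (degree g)" unfolding g by (subst degree_mult_eq) (use g0 in auto)
  define w where "w = poly_vec k g G x"
  have dg: "degree g < k" using f deg by (simp add: ann_def)
  have w: "w \<in> carrier_vec k" using G by (simp add: w_def poly_vec_carrier)
  have "w \<noteq> 0\<^sub>v k"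
  proof
    assume "w = 0\<^sub>v k"
    then have "ann g" unfolding ann_def w_def using g0 dg poly_vec_bound[OF dg, of "Suc k" G x] by simp
    with least deg show False by fastforce
  qed
  have "G *\<^sub>v w - \<mu> \<cdot>\<^sub>v w = 0\<^sub>v k"
    using f poly_vec_linear_factor[OF G x dg, of \<mu>] unfolding ann_def g w_def by simp
  note * = this
  have "(G *\<^sub>v w) $ i = \<mu> * w $ i" if "i < k" for i
    using arg_cong[OF *, of "\<lambda>v. v $ i"] that G w by (simp del: index_mult_mat_vec)
  then have "G *\<^sub>v w = \<mu> \<cdot>\<^sub>v w" using G w by (intro eq_vecI) auto
  moreover have "H *\<^sub>v w = 0\<^sub>v r"
    unfolding w_def by (intro eq_vecI) (use H in \<open>auto simp: mult_poly_vec[OF H G x] unseen simp del: index_mult_mat_vec\<close>)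
  ultimately show False using hautus[OF w] \<open>w \<noteq> 0\<^sub>v k\<close> by blast
qed

lemma map_vec_of_real_eq_0: "map_vec complex_of_real x = 0\<^sub>v k \<Longrightarrow> x = 0\<^sub>v k"
proof (rule eq_vecI)
  assume h: "map_vec complex_of_real x = 0\<^sub>v k"
  show dim: "dim_vec x = dim_vec (0\<^sub>v k)" using arg_cong[OF h, of dim_vec] by simp
  show "x $ i = 0\<^sub>v k $ i" if "i < dim_vec (0\<^sub>v k :: real vec)" for i
    using arg_cong[OF h, of "\<lambda>v. v $ i"] that dim by simp
qed

lemma scalar_prod_self_eq_0:
  assumes "(x :: real vec) \<bullet> x = 0"
  shows "x = 0\<^sub>v (dim_vec x)"
  using assms by (intro eq_vecI) (auto simp: scalar_prod_def sum_nonneg_eq_0_iff)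

lemma hurwitz_negate_shift:
  assumes G: "G \<in> carrier_mat k k" and ev: "\<And>\<mu>. eigenvalue (cmat G) \<mu> \<Longrightarrow> 0 \<le> Re \<mu>" and e: "0 < \<epsilon>"
  shows "hurwitz (- (G + \<epsilon> \<cdot>\<^sub>m 1\<^sub>m k))"
proof (rule hurwitzI[of _ k])
  fix \<mu> v assume v: "v \<in> carrier_vec k" "cmat (- (G + \<epsilon> \<cdot>\<^sub>m 1\<^sub>m k)) *\<^sub>v v = \<mu> \<cdot>\<^sub>v v" "0 \<le> Re \<mu>"
  have "cmat (- (G + \<epsilon> \<cdot>\<^sub>m 1\<^sub>m k)) = - cmat G - of_real \<epsilon> \<cdot>\<^sub>m 1\<^sub>m k"
    using G by (intro eq_matI) auto
  then have eq: "- (cmat G *\<^sub>v v) - of_real \<epsilon> \<cdot>\<^sub>v v = \<mu> \<cdot>\<^sub>v v"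
    using v G by (simp add: mat_vec_distrib)
  have "(cmat G *\<^sub>v v) $ i = (- \<mu> - of_real \<epsilon>) * v $ i" if "i < k" for i
  proof -
    have "- ((cmat G *\<^sub>v v) $ i) - of_real \<epsilon> * v $ i = \<mu> * v $ i"
      using arg_cong[OF eq, of "\<lambda>w. w $ i"] that v G by (simp del: index_mult_mat_vec)
    moreover have "a = (- \<mu> - e) * z" if "- a - e * z = \<mu> * z" for a e z :: complex
    proof -
      have "a = - (- a - e * z) - e * z" by simp
      also have "\<dots> = (- \<mu> - e) * z" unfolding that by (simp add: algebra_simps)
      finally show ?thesis .
    qed
    ultimately show ?thesis by blast
  qed
  then have "cmat G *\<^sub>v v = (- \<mu> - of_real \<epsilon>) \<cdot>\<^sub>v v" using v G by (intro eq_vecI) auto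
  then show "v = 0\<^sub>v k"
    using ev[of "- \<mu> - of_real \<epsilon>"] v G e by (auto simp: eigenvalue_def eigenvector_def)
qed (use G in auto)

text \<open>Bass's construction. Let \<open>(G + I) Z + Z (G + I)\<^sup>T = \<Gamma> \<Gamma>\<^sup>T\<close>, which is a Lyapunov equation for a
  Hurwitz matrix. The Hautus test makes \<open>Z\<close> invertible, and for \<open>K = - \<onehalf> \<Gamma>\<^sup>T Z\<^sup>-\<^sup>1\<close> the equation
  turns into \<open>(G + \<Gamma> K) Z + Z (G + \<Gamma> K)\<^sup>T = - 2 Z\<close>, so that \<open>Z\<close> is a Lyapunov matrix for the closed
  loop.\<close>

lemma bass_stabilization:
  assumes G: "G \<in> carrier_mat k k" and \<Gamma>: "\<Gamma> \<in> carrier_mat k m"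
    and ev: "\<And>\<mu>. eigenvalue (cmat G) \<mu> \<Longrightarrow> 0 \<le> Re \<mu>"
    and hautus: "\<And>\<mu> w. w \<in> carrier_vec k \<Longrightarrow> cmat G\<^sup>T *\<^sub>v w = \<mu> \<cdot>\<^sub>v w \<Longrightarrow> cmat \<Gamma>\<^sup>T *\<^sub>v w = 0\<^sub>v m \<Longrightarrow> w = 0\<^sub>v k"
  shows "\<exists>K \<in> carrier_mat m k. hurwitz (G + \<Gamma> * K)"
proof -
  define F where "F = (- (G + 1 \<cdot>\<^sub>m 1\<^sub>m k))\<^sup>T"
  have F: "F \<in> carrier_mat k k" "hurwitz F"
    using hurwitz_transpose[of _ k, OF _ hurwitz_negate_shift[OF G ev, of 1]] G by (auto simp: F_def)
  define N where "N = \<Gamma> * \<Gamma>\<^sup>T"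
  have N: "N \<in> carrier_mat k k" "N\<^sup>T = N" using \<Gamma> by (auto simp: N_def mat_transpose)
  have xNx: "x \<bullet> (N *\<^sub>v x) = (\<Gamma>\<^sup>T *\<^sub>v x) \<bullet> (\<Gamma>\<^sup>T *\<^sub>v x)" if "x \<in> carrier_vec k" for x
    using that \<Gamma> by (simp add: N_def mat_vec_assoc scalar_prod_transpose[of \<Gamma>])
  have "pos_semidef k N" using N xNx by (auto simp: pos_semidef_def scalar_prod_def intro!: sum_nonneg)
  from lyapunov_solvable[OF F this] obtain Z where Z: "pos_semidef k Z" and eq: "F\<^sup>T * Z + Z * F = - N" by auto
  have Zc: "Z \<in> carrier_mat k k" "Z\<^sup>T = Z" using Z by (auto simp: pos_semidef_def)
  note d = carrier_matD[OF G] carrier_matD[OF \<Gamma>] carrier_matD[OF Zc(1)] carrier_matD[OF N(1)] carrier_matD[OF F(1)]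
  \<comment> \<open>The kernel of \<open>Z\<close> is invariant under \<open>G\<^sup>T\<close> and contained in that of \<open>\<Gamma>\<^sup>T\<close>.\<close>
  have step: "\<Gamma>\<^sup>T *\<^sub>v x = 0\<^sub>v m \<and> Z *\<^sub>v (G\<^sup>T *\<^sub>v x) = 0\<^sub>v k" if x: "x \<in> carrier_vec k" "Z *\<^sub>v x = 0\<^sub>v k" for x
  proof -
    have "x \<bullet> ((- N) *\<^sub>v x) = 0"
      using lyapunov_quadratic[OF F(1) Zc x(1)] x F unfolding eq by simp
    then have "(\<Gamma>\<^sup>T *\<^sub>v x) \<bullet> (\<Gamma>\<^sup>T *\<^sub>v x) = 0"
      using x d xNx by (simp add: mat_vec_distrib scalar_prod_linear)
    then have G0: "\<Gamma>\<^sup>T *\<^sub>v x = 0\<^sub>v m"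
      using scalar_prod_self_eq_0[of "\<Gamma>\<^sup>T *\<^sub>v x"] d by simp
    have "(F\<^sup>T * Z + Z * F) *\<^sub>v x = (- N) *\<^sub>v x" unfolding eq by simp
    then have "F\<^sup>T *\<^sub>v (Z *\<^sub>v x) + Z *\<^sub>v (F *\<^sub>v x) = - (\<Gamma> *\<^sub>v (\<Gamma>\<^sup>T *\<^sub>v x))"
      using x d by (simp add: mat_vec_distrib mat_vec_assoc N_def)
    then have "F\<^sup>T *\<^sub>v 0\<^sub>v k + Z *\<^sub>v (F *\<^sub>v x) = - (\<Gamma> *\<^sub>v 0\<^sub>v m)" unfolding x(2) G0 .
    moreover have "F\<^sup>T *\<^sub>v 0\<^sub>v k = 0\<^sub>v k" "\<Gamma> *\<^sub>v 0\<^sub>v m = 0\<^sub>v k" using d by (auto intro!: eq_vecI simp: scalar_prod_def)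
    ultimately have ZF: "Z *\<^sub>v (F *\<^sub>v x) = 0\<^sub>v k" using d by (simp add: carrier_vecI)
    have "F *\<^sub>v x = - (G\<^sup>T *\<^sub>v x) - x"
      using x d by (simp add: F_def mat_transpose mat_vec_distrib) (auto intro!: eq_vecI)
    then have *: "- (Z *\<^sub>v (G\<^sup>T *\<^sub>v x)) - Z *\<^sub>v x = 0\<^sub>v k" using ZF x d by (simp add: mat_vec_distrib)
    have "(Z *\<^sub>v (G\<^sup>T *\<^sub>v x)) $ i = 0" if "i < k" for i
      using arg_cong[OF *, of "\<lambda>w. w $ i"] that d by (simp add: x(2) del: index_mult_mat_vec)
    then show ?thesis using G0 d by (auto intro!: eq_vecI simp del: index_mult_mat_vec)
  qed
  have Zinj: "x = 0\<^sub>v k" if x: "x \<in> carrier_vec k" "Z *\<^sub>v x = 0\<^sub>v k" for x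
  proof -
    have GT: "G\<^sup>T \<in> carrier_mat k k" using G by simp
    have orbit: "Z *\<^sub>v (G\<^sup>T ^\<^sub>m j *\<^sub>v x) = 0\<^sub>v k" for j
    proof (induction j)
      case (Suc j)
      have "G\<^sup>T ^\<^sub>m Suc j *\<^sub>v x = G\<^sup>T *\<^sub>v (G\<^sup>T ^\<^sub>m j *\<^sub>v x)"
        unfolding pow_mat_Suc_left[OF GT] using x d by (simp add: mat_vec_assoc)
      then show ?case using step[OF mult_mat_vec_carrier[OF pow_carrier_mat[OF GT] x(1)] Suc] by simp
    qed (use x d in auto)
    have "map_vec complex_of_real x = 0\<^sub>v k"
    proof (rule popov_belevitch_hautus[of "cmat G\<^sup>T" k "cmat \<Gamma>\<^sup>T" m])
      fix j
      have "cmat \<Gamma>\<^sup>T *\<^sub>v (cmat G\<^sup>T ^\<^sub>m j *\<^sub>v map_vec of_real x) = map_vec of_real (\<Gamma>\<^sup>T *\<^sub>v (G\<^sup>T ^\<^sub>m j *\<^sub>v x))"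
        using of_real_hom.mult_mat_vec_hom[where ?'a = complex, of "\<Gamma>\<^sup>T" m k "G\<^sup>T ^\<^sub>m j *\<^sub>v x"]
          of_real_hom.mult_mat_vec_hom[where ?'a = complex, of "G\<^sup>T ^\<^sub>m j" k k x]
          of_real_hom.mat_hom_pow[where ?'a = complex, OF GT, of j] \<Gamma> GT x pow_carrier_mat[OF GT, of j]
        by simp
      also have "\<Gamma>\<^sup>T *\<^sub>v (G\<^sup>T ^\<^sub>m j *\<^sub>v x) = 0\<^sub>v m"
        using step[OF mult_mat_vec_carrier[OF pow_carrier_mat[OF GT] x(1)] orbit] by blast
      finally show "cmat \<Gamma>\<^sup>T *\<^sub>v (cmat G\<^sup>T ^\<^sub>m j *\<^sub>v map_vec of_real x) = 0\<^sub>v m" by (auto intro!: eq_vecI)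
    qed (use G \<Gamma> x hautus in auto)
    then show ?thesis by (rule map_vec_of_real_eq_0)
  qed
  from inverse_exists[OF Zc(1) Zinj] obtain V where V: "V \<in> carrier_mat k k" "Z * V = 1\<^sub>m k" "V * Z = 1\<^sub>m k" by auto
  define K where "K = (- (1/2)) \<cdot>\<^sub>m (\<Gamma>\<^sup>T * V)"
  have K: "K \<in> carrier_mat m k" using \<Gamma> V by (auto simp: K_def)
  note d' = d carrier_matD[OF K] carrier_matD[OF V(1)]
  let ?A = "G + \<Gamma> * K"
  have A: "?A \<in> carrier_mat k k" "?A\<^sup>T \<in> carrier_mat k k" using G \<Gamma> K by auto
  have KZ: "K * Z = (- (1/2)) \<cdot>\<^sub>m \<Gamma>\<^sup>T" using d' V by (simp add: K_def mat_scale mat_assoc mat_one)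
  have ZK: "Z * K\<^sup>T = (- (1/2)) \<cdot>\<^sub>m \<Gamma>"
    using arg_cong[OF KZ, of transpose_mat] d' Zc by (simp add: mat_transpose)
  have "?A\<^sup>T\<^sup>T * Z + Z * ?A\<^sup>T = (G * Z + \<Gamma> * (K * Z)) + (Z * G\<^sup>T + (Z * K\<^sup>T) * \<Gamma>\<^sup>T)"
    using d' by (simp add: mat_transpose mat_distrib mat_assoc)
  also have "\<dots> = G * Z + Z * G\<^sup>T - N"
    unfolding KZ ZK N_def using d' by (auto simp: mat_scale mat_eq_iff simp del: index_mult_mat(1))
  also have "\<dots> = - (2 \<cdot>\<^sub>m Z)"
  proof -
    have "- (G * Z + 1 \<cdot>\<^sub>m Z) + - (Z * G\<^sup>T + 1 \<cdot>\<^sub>m Z) = - N"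
      using eq d by (simp add: F_def mat_transpose mat_scale mat_distrib mat_one)
    then show ?thesis using d by (auto simp: mat_eq_iff algebra_simps simp del: index_mult_mat(1))
  qed
  finally have lyap: "?A\<^sup>T\<^sup>T * Z + Z * ?A\<^sup>T = - (2 \<cdot>\<^sub>m Z)" .
  have "hurwitz ?A\<^sup>T"
  proof (rule hurwitzI[OF A(2)])
    fix \<mu> v assume v: "v \<in> carrier_vec k" "cmat ?A\<^sup>T *\<^sub>v v = \<mu> \<cdot>\<^sub>v v" "0 \<le> Re \<mu>"
    define a b where "a = map_vec Re v" and "b = map_vec Im v"
    have ab: "a \<in> carrier_vec k" "b \<in> carrier_vec k" using v by (auto simp: a_def b_def)
    have nn: "0 \<le> a \<bullet> (Z *\<^sub>v a)" "0 \<le> b \<bullet> (Z *\<^sub>v b)" using Z ab by (auto simp: pos_semidef_def)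
    have "a \<bullet> ((- (2 \<cdot>\<^sub>m Z)) *\<^sub>v a) + b \<bullet> ((- (2 \<cdot>\<^sub>m Z)) *\<^sub>v b) = 2 * Re \<mu> * (a \<bullet> (Z *\<^sub>v a) + b \<bullet> (Z *\<^sub>v b))"
      using eigen_quadratic_sum[OF A(2) Zc v(1,2)] unfolding lyap a_def b_def .
    then have "(1 + Re \<mu>) * (a \<bullet> (Z *\<^sub>v a) + b \<bullet> (Z *\<^sub>v b)) = 0"
      using ab d by (simp add: mat_vec_distrib scalar_prod_linear algebra_simps)
    then have "a \<bullet> (Z *\<^sub>v a) + b \<bullet> (Z *\<^sub>v b) = 0" using v(3) by auto
    then have "a \<bullet> (Z *\<^sub>v a) = 0" "b \<bullet> (Z *\<^sub>v b) = 0" using nn by linarith+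
    then have "a = 0\<^sub>v k" "b = 0\<^sub>v k" using psd_kernel[OF Z] Zinj ab by blast+
    then have "Re (v $ i) = 0 \<and> Im (v $ i) = 0" if "i < k" for i
      using that v unfolding a_def b_def by (metis carrier_vecD index_map_vec(1) index_zero_vec(1))
    then show "v = 0\<^sub>v k" using v by (auto intro!: eq_vecI simp: complex_eq_iff)
  qed
  from hurwitz_transpose[OF A(2) this] show ?thesis using K by auto
qed

lemma cmat_mult: "A \<in> carrier_mat r k \<Longrightarrow> B \<in> carrier_mat k c \<Longrightarrow> cmat (A * B) = cmat A * cmat B"
  by (rule of_real_hom.mat_hom_mult)

lemma hurwitz_similar:
  assumes U: "U \<in> carrier_mat k k" and V: "V \<in> carrier_mat k k" "V * U = 1\<^sub>m k"
    and F: "F \<in> carrier_mat k k" and L: "L \<in> carrier_mat k k" "hurwitz L" and sim: "U * F = L * U"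
  shows "hurwitz F"
proof (rule hurwitzI[OF F])
  fix \<mu> v assume v: "v \<in> carrier_vec k" "cmat F *\<^sub>v v = \<mu> \<cdot>\<^sub>v v" "0 \<le> Re \<mu>"
  note d = carrier_matD[OF U] carrier_matD[OF V(1)] carrier_matD[OF F] carrier_matD[OF L(1)]
  let ?w = "cmat U *\<^sub>v v"
  have w: "?w \<in> carrier_vec k" using U v by auto
  have "cmat L *\<^sub>v ?w = (cmat L * cmat U) *\<^sub>v v" using v d by (simp add: mat_vec_assoc)
  also have "cmat L * cmat U = cmat U * cmat F"
    unfolding cmat_mult[OF L(1) U, symmetric] cmat_mult[OF U F, symmetric] sim ..
  also have "(cmat U * cmat F) *\<^sub>v v = cmat U *\<^sub>v (\<mu> \<cdot>\<^sub>v v)" using v d by (simp add: mat_vec_assoc)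
  also have "\<dots> = \<mu> \<cdot>\<^sub>v ?w" using v d by (simp add: mat_vec_distrib)
  finally have w0: "?w = 0\<^sub>v k" by (rule hurwitzD[OF L(2,1) w _ v(3)])
  have "v = cmat (V * U) *\<^sub>v v" using v by (simp add: V of_real_hom.mat_hom_one)
  also have "\<dots> = cmat V *\<^sub>v ?w" unfolding cmat_mult[OF V(1) U] using v d by (simp add: mat_vec_assoc)
  also have "\<dots> = 0\<^sub>v k" unfolding w0 using d by (auto intro!: eq_vecI simp: scalar_prod_def)
  finally show "v = 0\<^sub>v k" .
qed

lemma mat_add_zero:
  fixes A :: "'a :: comm_ring_1 mat"
  assumes "dim_row A = r" "dim_col A = c"
  shows "0\<^sub>m r c + A = A" "A + 0\<^sub>m r c = A" "A - A = 0\<^sub>m r c" "A - 0\<^sub>m r c = A"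
  using assms by (auto simp: mat_eq_iff)

lemma block_mult:
  fixes A1 :: "'a :: comm_ring_1 mat"
  assumes "dim_row B1 = dim_row A1" "dim_row D1 = dim_row C1" "dim_col C1 = dim_col A1" "dim_col D1 = dim_col B1"
    "dim_row A2 = dim_col A1" "dim_row B2 = dim_col A1" "dim_row C2 = dim_col B1" "dim_row D2 = dim_col B1"
    "dim_col C2 = dim_col A2" "dim_col D2 = dim_col B2"
  shows "four_block_mat A1 B1 C1 D1 * four_block_mat A2 B2 C2 D2 =
    four_block_mat (A1 * A2 + B1 * C2) (A1 * B2 + B1 * D2) (C1 * A2 + D1 * C2) (C1 * B2 + D1 * D2)"
  by (rule mult_four_block_mat[of _ "dim_row A1" "dim_col A1" _ "dim_col B1" _ "dim_row C1" _ _ "dim_col A2" _ "dim_col B2"])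
    (use assms in \<open>auto intro: carrier_matI\<close>)

lemma block_add:
  fixes A1 :: "'a :: comm_ring_1 mat"
  assumes "dim_row B1 = dim_row A1" "dim_row D1 = dim_row C1" "dim_col C1 = dim_col A1" "dim_col D1 = dim_col B1"
    "dim_row A2 = dim_row A1" "dim_row B2 = dim_row A1" "dim_row C2 = dim_row C1" "dim_row D2 = dim_row C1"
    "dim_col A2 = dim_col A1" "dim_col B2 = dim_col B1" "dim_col C2 = dim_col A1" "dim_col D2 = dim_col B1"
  shows "four_block_mat A1 B1 C1 D1 + four_block_mat A2 B2 C2 D2 =
    four_block_mat (A1 + A2) (B1 + B2) (C1 + C2) (D1 + D2)"
  by (rule add_four_block_mat[of _ "dim_row A1" "dim_col A1" _ "dim_col B1" _ "dim_row C1"])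
    (use assms in \<open>auto intro: carrier_matI\<close>)

lemma cmat_four_block:
  assumes "A \<in> carrier_mat r1 c1" "B \<in> carrier_mat r1 c2" "C \<in> carrier_mat r2 c1" "D \<in> carrier_mat r2 c2"
  shows "cmat (four_block_mat A B C D) = four_block_mat (cmat A) (cmat B) (cmat C) (cmat D)"
  using assms by (auto simp: mat_eq_iff)

lemma hurwitz_block_upper:
  assumes A: "A \<in> carrier_mat k k" "hurwitz A" and D: "D \<in> carrier_mat l l" "hurwitz D" and B: "B \<in> carrier_mat k l"
  shows "hurwitz (four_block_mat A B (0\<^sub>m l k) D)"
proof (rule hurwitzI)
  show "four_block_mat A B (0\<^sub>m l k) D \<in> carrier_mat (k + l) (k + l)" using A D by auto
  fix \<mu> v assume v: "v \<in> carrier_vec (k + l)" "cmat (four_block_mat A B (0\<^sub>m l k) D) *\<^sub>v v = \<mu> \<cdot>\<^sub>v v" "0 \<le> Re \<mu>"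
  define x y where "x = vec_first v k" and "y = vec_last v l"
  have xy: "x \<in> carrier_vec k" "y \<in> carrier_vec l" "v = x @\<^sub>v y"
    using v by (auto simp: x_def y_def vec_first_last_append)
  have "cmat (four_block_mat A B (0\<^sub>m l k) D) *\<^sub>v v =
      (cmat A *\<^sub>v x + cmat B *\<^sub>v y) @\<^sub>v (cmat (0\<^sub>m l k) *\<^sub>v x + cmat D *\<^sub>v y)"
    unfolding xy(3) cmat_four_block[OF A(1) B zero_carrier_mat D(1)]
    by (rule four_block_mat_mult_vec[of _ k k _ l _ l]) (use A B D xy in auto)
  also have "cmat (0\<^sub>m l k) *\<^sub>v x + cmat D *\<^sub>v y = cmat D *\<^sub>v y"
    using xy D by (intro eq_vecI) (auto simp: scalar_prod_def)
  finally have lhs: "cmat (four_block_mat A B (0\<^sub>m l k) D) *\<^sub>v v = (cmat A *\<^sub>v x + cmat B *\<^sub>v y) @\<^sub>v (cmat D *\<^sub>v y)" .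
  have rhs: "\<mu> \<cdot>\<^sub>v v = (\<mu> \<cdot>\<^sub>v x) @\<^sub>v (\<mu> \<cdot>\<^sub>v y)" unfolding xy(3) by (auto intro!: eq_vecI)
  have eq: "(cmat A *\<^sub>v x + cmat B *\<^sub>v y) @\<^sub>v (cmat D *\<^sub>v y) = (\<mu> \<cdot>\<^sub>v x) @\<^sub>v (\<mu> \<cdot>\<^sub>v y)"
    using v(2) unfolding lhs rhs .
  have eqs: "cmat A *\<^sub>v x + cmat B *\<^sub>v y = \<mu> \<cdot>\<^sub>v x" "cmat D *\<^sub>v y = \<mu> \<cdot>\<^sub>v y"
    using append_vec_eq[of "cmat A *\<^sub>v x + cmat B *\<^sub>v y" k "\<mu> \<cdot>\<^sub>v x"] eq A B xy by auto
  have y: "y = 0\<^sub>v l" by (rule hurwitzD[OF D(2,1) xy(2) eqs(2) v(3)])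
  have "cmat B *\<^sub>v y = 0\<^sub>v k" unfolding y using B by (auto intro!: eq_vecI simp: scalar_prod_def)
  then have "cmat A *\<^sub>v x = \<mu> \<cdot>\<^sub>v x" using eqs(1) A xy by simp
  then have x: "x = 0\<^sub>v k" by (rule hurwitzD[OF A(2,1) xy(1) _ v(3)])
  show "v = 0\<^sub>v (k + l)" unfolding xy(3) x y by (auto intro!: eq_vecI)
qed

text \<open>A solution of \<open>T A0 - G1 T = G2 C\<close>, where \<open>A0\<close> is the prestabilized plant, decouples the internal
  model \<open>z' = G1 z + G2 C x\<close>: the variable \<open>z - T x\<close> evolves by \<open>G1\<close> with input matrix \<open>- T B\<close>, and
  Bass's gain stabilizes it. In the original coordinates the Hautus test for \<open>(G1, - T B)\<close>
  becomes the one for the cascade, at the eigenvalues of \<open>G1\<close>.\<close>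

lemma cascade_stabilizable:
  assumes A: "A \<in> carrier_mat n n" and B: "B \<in> carrier_mat n m" and C: "C \<in> carrier_mat p n"
    and G1: "G1 \<in> carrier_mat l l" and G2: "G2 \<in> carrier_mat l p"
    and K0: "K0 \<in> carrier_mat m n" "hurwitz (A + B * K0)"
    and ev: "\<And>\<mu>. eigenvalue (cmat G1) \<mu> \<Longrightarrow> 0 \<le> Re \<mu>"
    and hautus: "\<And>\<mu> w1 w2. w1 \<in> carrier_vec n \<Longrightarrow> w2 \<in> carrier_vec l \<Longrightarrow>
      cmat A\<^sup>T *\<^sub>v w1 + cmat (G2 * C)\<^sup>T *\<^sub>v w2 = \<mu> \<cdot>\<^sub>v w1 \<Longrightarrow> cmat G1\<^sup>T *\<^sub>v w2 = \<mu> \<cdot>\<^sub>v w2 \<Longrightarrow>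
      cmat B\<^sup>T *\<^sub>v w1 = 0\<^sub>v m \<Longrightarrow> w2 = 0\<^sub>v l"
  shows "\<exists>K \<in> carrier_mat m (n + l).
    hurwitz (four_block_mat A (0\<^sub>m n l) (G2 * C) G1 + (B @\<^sub>r 0\<^sub>m l m) * K)"
proof -
  define A0 where "A0 = A + B * K0"
  have A0: "A0 \<in> carrier_mat n n" "hurwitz A0" using A B K0 by (auto simp: A0_def)
  have GC: "G2 * C \<in> carrier_mat l n" using G2 C by auto
  note d = carrier_matD[OF A] carrier_matD[OF B] carrier_matD[OF C] carrier_matD[OF G1] carrier_matD[OF G2]
    carrier_matD[OF K0(1)] carrier_matD[OF A0(1)]
  \<comment> \<open>The eigenvalues of \<open>G1\<close> may lie on the imaginary axis. Shifting by \<open>\<epsilon>\<close> makes both coefficients of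
    the Sylvester equation Hurwitz, and the two shifts cancel in it.\<close>
  obtain \<epsilon> where e: "\<epsilon> > 0" "hurwitz (A0 + \<epsilon> \<cdot>\<^sub>m 1\<^sub>m n)" using hurwitz_shift[OF A0] by auto
  let ?F1 = "(- (G1 + \<epsilon> \<cdot>\<^sub>m 1\<^sub>m l))\<^sup>T"
  have "hurwitz ?F1" using hurwitz_transpose[of _ l, OF _ hurwitz_negate_shift[OF G1 ev e(1)]] G1 by auto
  from sylvester_solvable[OF _ this _ e(2), of l n "- (G2 * C)"]
  obtain T where T: "T \<in> carrier_mat l n" and "?F1\<^sup>T * T + T * (A0 + \<epsilon> \<cdot>\<^sub>m 1\<^sub>m n) = - (- (G2 * C))"
    using G1 A0 GC by auto
  then have "- (G1 * T + \<epsilon> \<cdot>\<^sub>m T) + (T * A0 + \<epsilon> \<cdot>\<^sub>m T) = G2 * C"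
    using d by (simp add: mat_algebra)
  then have TA: "T * A0 = G2 * C + G1 * T"
    using T d by (auto simp: mat_eq_iff algebra_simps simp del: index_mult_mat(1))
  note d = d carrier_matD[OF T]
  define \<Gamma> where "\<Gamma> = - (T * B)"
  have \<Gamma>: "\<Gamma> \<in> carrier_mat l m" using T B by (auto simp: \<Gamma>_def)
  have "\<exists>K \<in> carrier_mat m l. hurwitz (G1 + \<Gamma> * K)"
  proof (rule bass_stabilization[OF G1 \<Gamma> ev])
    fix \<mu> w assume w: "w \<in> carrier_vec l" "cmat G1\<^sup>T *\<^sub>v w = \<mu> \<cdot>\<^sub>v w" "cmat \<Gamma>\<^sup>T *\<^sub>v w = 0\<^sub>v m"
    define w1 where "w1 = cmat T\<^sup>T *\<^sub>v w"
    have w1: "w1 \<in> carrier_vec n" using T w by (auto simp: w1_def)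
    have "cmat \<Gamma>\<^sup>T = - (cmat B\<^sup>T * cmat T\<^sup>T)"
      unfolding cmat_mult[OF transpose_carrier_mat[THEN iffD2, OF B] transpose_carrier_mat[THEN iffD2, OF T], symmetric]
      using d by (simp add: \<Gamma>_def mat_transpose) (auto simp: mat_eq_iff)
    then have "- (cmat B\<^sup>T *\<^sub>v w1) = 0\<^sub>v m" using w d by (simp add: w1_def mat_vec_distrib mat_vec_assoc)
    then have "cmat B\<^sup>T *\<^sub>v w1 = - 0\<^sub>v m" by (metis uminus_uminus_vec)
    then have Bw: "cmat B\<^sup>T *\<^sub>v w1 = 0\<^sub>v m" by simp
    have tr: "A0\<^sup>T * T\<^sup>T = (G2 * C)\<^sup>T + T\<^sup>T * G1\<^sup>T" "A0\<^sup>T = A\<^sup>T + K0\<^sup>T * B\<^sup>T"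
      using arg_cong[OF TA, of transpose_mat] d GC by (simp_all add: mat_transpose A0_def)
    have "cmat A0\<^sup>T *\<^sub>v w1 = (cmat A0\<^sup>T * cmat T\<^sup>T) *\<^sub>v w" using w d by (simp add: w1_def mat_vec_assoc)
    also have "cmat A0\<^sup>T * cmat T\<^sup>T = cmat (A0\<^sup>T * T\<^sup>T)"
      by (rule cmat_mult[symmetric, of _ n n _ l]) (use A0 T in auto)
    also have "\<dots> = cmat (G2 * C)\<^sup>T + cmat (T\<^sup>T * G1\<^sup>T)"
      unfolding tr(1) using d by (auto simp: mat_eq_iff simp del: index_mult_mat(1))
    also have "cmat (T\<^sup>T * G1\<^sup>T) = cmat T\<^sup>T * cmat G1\<^sup>T"
      by (rule cmat_mult[of _ n l _ l]) (use T G1 in auto)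
    also have "(cmat (G2 * C)\<^sup>T + cmat T\<^sup>T * cmat G1\<^sup>T) *\<^sub>v w = cmat (G2 * C)\<^sup>T *\<^sub>v w + cmat T\<^sup>T *\<^sub>v (\<mu> \<cdot>\<^sub>v w)"
      using w d by (simp add: mat_vec_distrib(1) mat_vec_assoc)
    also have "cmat T\<^sup>T *\<^sub>v (\<mu> \<cdot>\<^sub>v w) = \<mu> \<cdot>\<^sub>v w1" using w d by (simp add: mat_vec_distrib w1_def)
    finally have e1: "cmat A0\<^sup>T *\<^sub>v w1 = cmat (G2 * C)\<^sup>T *\<^sub>v w + \<mu> \<cdot>\<^sub>v w1" .
    have "cmat A0\<^sup>T = cmat A\<^sup>T + cmat (K0\<^sup>T * B\<^sup>T)"
      unfolding tr(2) using d by (auto simp: mat_eq_iff simp del: index_mult_mat(1))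
    also have "cmat (K0\<^sup>T * B\<^sup>T) = cmat K0\<^sup>T * cmat B\<^sup>T"
      by (rule cmat_mult[of _ n m _ n]) (use K0 B in auto)
    finally have "cmat A0\<^sup>T *\<^sub>v w1 = cmat A\<^sup>T *\<^sub>v w1 + cmat K0\<^sup>T *\<^sub>v 0\<^sub>v m"
      using w1 d by (simp add: mat_vec_distrib(1) mat_vec_assoc Bw)
    also have "cmat K0\<^sup>T *\<^sub>v 0\<^sub>v m = 0\<^sub>v n" using d by (auto intro!: eq_vecI simp: scalar_prod_def)
    finally have e2: "cmat A\<^sup>T *\<^sub>v w1 = cmat (G2 * C)\<^sup>T *\<^sub>v w + \<mu> \<cdot>\<^sub>v w1" using e1 d by (simp add: carrier_vecI)
    \<comment> \<open>The vector \<open>(w1, - w)\<close> is an eigenvector of the transposed cascade that the input misses.\<close>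
    have "- w = 0\<^sub>v l"
    proof (rule hautus[OF w1 _ _ _ Bw])
      show "cmat A\<^sup>T *\<^sub>v w1 + cmat (G2 * C)\<^sup>T *\<^sub>v (- w) = \<mu> \<cdot>\<^sub>v w1"
        unfolding e2 using w w1 d by (auto simp: mat_vec_distrib intro!: eq_vecI simp del: index_mult_mat_vec)
      show "cmat G1\<^sup>T *\<^sub>v (- w) = \<mu> \<cdot>\<^sub>v (- w)"
        using w d by (simp add: mat_vec_distrib) (auto intro!: eq_vecI)
    qed (use w in auto)
    then show "w = 0\<^sub>v l" by (metis uminus_uminus_vec uminus_zero_vec)
  qed
  then obtain Kz where Kz: "Kz \<in> carrier_mat m l" "hurwitz (G1 + \<Gamma> * Kz)" by auto
  define K1 where "K1 = K0 - Kz * T"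
  have K1: "K1 \<in> carrier_mat m n" unfolding K1_def by (rule minus_carrier_mat) (use Kz T in auto)
  define K where "K = four_block_mat K1 Kz (0\<^sub>m 0 n) (0\<^sub>m 0 l)"
  have K: "K \<in> carrier_mat m (n + l)" unfolding K_def using four_block_carrier_mat[OF K1, of "0\<^sub>m 0 l" 0 l] by simp
  note d = d carrier_matD[OF Kz(1)] carrier_matD[OF K1]
  have "(B @\<^sub>r 0\<^sub>m l m) * K = four_block_mat (B * K1) (B * Kz) (0\<^sub>m l n) (0\<^sub>m l l)"
    unfolding append_rows_def K_def d by (simp add: block_mult d mat_zero mat_add_zero)
  then have closed: "four_block_mat A (0\<^sub>m n l) (G2 * C) G1 + (B @\<^sub>r 0\<^sub>m l m) * K =
      four_block_mat (A + B * K1) (B * Kz) (G2 * C) G1"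
    by (simp add: block_add d mat_add_zero)
  define A1 where "A1 = A + B * K1"
  define Gz where "Gz = G1 + \<Gamma> * Kz"
  define BK where "BK = B * Kz"
  have c: "A1 \<in> carrier_mat n n" "Gz \<in> carrier_mat l l" "BK \<in> carrier_mat n l"
    using A B K1 G1 \<Gamma> Kz by (auto simp: A1_def Gz_def BK_def)
  note d' = d carrier_matD[OF c(1)] carrier_matD[OF c(2)] carrier_matD[OF c(3)]
  have A1: "A1 = A0 - BK * T"
    unfolding A0_def A1_def K1_def BK_def using d
    by (simp add: mat_distrib mat_assoc) (auto simp: mat_eq_iff simp del: index_mult_mat(1))
  have Gz: "Gz = G1 - T * BK"
    unfolding Gz_def \<Gamma>_def BK_def using d by (simp add: mat_scale mat_assoc add_uminus_mat)
  let ?U = "four_block_mat (1\<^sub>m n) (0\<^sub>m n l) (- T) (1\<^sub>m l)"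
  let ?V = "four_block_mat (1\<^sub>m n) (0\<^sub>m n l) T (1\<^sub>m l)"
  have "hurwitz (four_block_mat A1 BK (G2 * C) G1)"
  proof (rule hurwitz_similar[of ?U "n + l" ?V])
    show "hurwitz (four_block_mat A0 BK (0\<^sub>m l n) Gz)"
      using A0 Kz c by (intro hurwitz_block_upper) (auto simp: Gz_def)
    show "?V * ?U = 1\<^sub>m (n + l)"
      by (simp add: block_mult d mat_one mat_zero mat_add_zero add_uminus_mat)
    have "G2 * C - T * A1 = - (Gz * T)"
      unfolding A1 Gz using d' by (simp add: mat_distrib TA mat_assoc) (auto simp: mat_eq_iff simp del: index_mult_mat(1))
    then have 1: "- (T * A1) + G2 * C = - (Gz * T)"
      using d' by (auto simp: mat_eq_iff simp del: index_mult_mat(1))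
    have 2: "- (T * BK) + G1 = Gz" "A0 + - (BK * T) = A1"
      unfolding A1 Gz using d' by (auto simp: mat_eq_iff simp del: index_mult_mat(1))
    show "?U * four_block_mat A1 BK (G2 * C) G1 = four_block_mat A0 BK (0\<^sub>m l n) Gz * ?U"
      using d' by (simp add: block_mult mat_one mat_zero mat_scale mat_add_zero 1 2)
  qed (use d' in auto)
  then have "hurwitz (four_block_mat (A + B * K1) (B * Kz) (G2 * C) G1)" by (simp add: A1_def BK_def)
  then show ?thesis using K unfolding closed[symmetric] by blast
qed

section \<open>Rank conditions\<close>

text \<open>The vectors orthogonal to \<open>w\<close> form a subspace that contains all columns. The columns span the whole
  space, so \<open>w\<close> is orthogonal to every unit vector.\<close>

lemma full_row_rank_left_kernel:
  fixes M :: "'a :: field mat"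
  assumes M: "M \<in> carrier_mat r c" and rank: "mat_rank M = r" and w: "w \<in> carrier_vec r" "M\<^sup>T *\<^sub>v w = 0\<^sub>v c"
  shows "w = 0\<^sub>v r"
proof -
  interpret vec_space "TYPE('a)" r .
  have rk: "rank M = r" using rank M by (simp add: mat_rank_def)
  have cols: "set (cols M) \<subseteq> carrier_vec r" using M cols_dim by blast
  have "\<exists>A. finite A \<and> maximal A (\<lambda>T. T \<subseteq> set (cols M) \<and> lin_indpt T) \<and> {} \<subseteq> A"
    by (rule maximal_exists_superset[of "set (cols M)"]) (auto simp: lin_dep_def)
  then obtain B where "maximal B (\<lambda>T. T \<subseteq> set (cols M) \<and> lin_indpt T)" by auto
  then have B: "B \<subseteq> set (cols M)" "lin_indpt B" "card B = r"
    using rank_card_indpt[OF M] rk by (auto simp: maximal_def)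
  have "basis B"
    using B cols dim_is_n by (intro dim_li_is_basis) (auto intro: finite_subset[OF B(1)])
  then have span: "span B = carrier_vec r" by (simp add: basis_def)
  let ?N = "{v \<in> carrier_vec r. w \<bullet> v = 0}"
  have "submodule class_ring ?N V"
    by unfold_locales (use w in \<open>auto simp: module_vec_simps class_ring_simps scalar_prod_add_distrib[of _ r]\<close>)
  moreover have "w \<bullet> col M j = 0" if "j < c" for j
  proof -
    have "(M\<^sup>T *\<^sub>v w) $ j = 0" using w that by simp
    then show ?thesis using that M w(1) scalar_prod_commute[of w "col M j"] by simp
  qed
  then have "set (cols M) \<subseteq> ?N" using M cols by (auto simp: cols_def)
  ultimately have "span B \<subseteq> ?N" using B by (intro span_is_subset) auto
  then have "w \<bullet> unit_vec r i = 0" for i using span unit_vec_carrier by blast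
  then have "w $ i = 0" if "i < r" for i using that w(1) by (metis scalar_prod_right_unit)
  then show ?thesis using w(1) by (intro eq_vecI) auto
qed

text \<open>If the rank is the number of columns, then no column occurs twice and the columns are linearly
  independent.\<close>

lemma full_column_rank_kernel:
  fixes M :: "'a :: field mat"
  assumes M: "M \<in> carrier_mat r c" and rank: "mat_rank M = c" and v: "v \<in> carrier_vec c" "M *\<^sub>v v = 0\<^sub>v r"
  shows "v = 0\<^sub>v c"
proof -
  interpret vec_space "TYPE('a)" r .
  have rk: "rank M = c" using rank M by (simp add: mat_rank_def)
  have "distinct (cols M)"
  proof (rule ccontr)
    assume "\<not> distinct (cols M)"
    then have "card (set (cols M)) < c" using M card_length[of "cols M"] card_distinct[of "cols M"]
      by (metis carrier_matD(2) cols_length le_neq_implies_less)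
    moreover have "\<exists>A. finite A \<and> maximal A (\<lambda>T. T \<subseteq> set (cols M) \<and> lin_indpt T) \<and> {} \<subseteq> A"
      by (rule maximal_exists_superset[of "set (cols M)"]) (auto simp: lin_dep_def)
    then obtain B where B: "maximal B (\<lambda>T. T \<subseteq> set (cols M) \<and> lin_indpt T)" by auto
    moreover have "card B \<le> card (set (cols M))" using B by (auto simp: maximal_def intro: card_mono)
    ultimately show False using rank_card_indpt[OF M B] rk by simp
  qed
  then show ?thesis using lin_depI[OF M v(1) _ v(2)] full_rank_lin_indpt[OF M rk] by blast
qed

lemma observable_kernel:
  assumes A: "A \<in> carrier_mat n n" and C: "C \<in> carrier_mat p n" and obs: "observable A C"
    and a: "a \<in> carrier_vec n" and 0: "\<And>j. C *\<^sub>v (A ^\<^sub>m j *\<^sub>v a) = 0\<^sub>v p"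
  shows "a = 0\<^sub>v n"
proof (rule full_column_rank_kernel)
  let ?O = "observability_mat A C"
  show O: "?O \<in> carrier_mat (n * p) n" using A C by (simp add: observability_mat_def Let_def)
  show "mat_rank ?O = n" using obs A by (simp add: observable_def)
  show "?O *\<^sub>v a = 0\<^sub>v (n * p)"
  proof (rule eq_vecI)
    fix i assume "i < dim_vec (0\<^sub>v (n * p) :: real vec)"
    then have i: "i < n * p" by simp
    then have p: "i mod p < p" by (cases p) auto
    have "(?O *\<^sub>v a) $ i = ((C * A ^\<^sub>m (i div p)) *\<^sub>v a) $ (i mod p)"
      using i p A C a by (simp add: observability_mat_def Let_def scalar_prod_def del: index_mult_mat(1))
    also have "(C * A ^\<^sub>m (i div p)) *\<^sub>v a = 0\<^sub>v p"
      using 0[of "i div p"] A C a by (simp add: mat_vec_assoc)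
    finally show "(?O *\<^sub>v a) $ i = 0\<^sub>v (n * p) $ i" using i p by simp
  qed (use O in auto)
qed fact

text \<open>A left eigenvector of \<open>\<beta>\<close> that the input misses annihilates the whole Kalman matrix. The rank of that
  matrix is a statement over the reals, so real and imaginary parts are treated separately.\<close>

lemma controllable_hautus:
  assumes \<beta>: "\<beta> \<in> carrier_mat d d" and \<sigma>: "\<sigma> \<in> carrier_mat d m" and ctr: "controllable \<beta> \<sigma>"
    and w: "w \<in> carrier_vec d" "cmat \<beta>\<^sup>T *\<^sub>v w = \<mu> \<cdot>\<^sub>v w" "cmat \<sigma>\<^sup>T *\<^sub>v w = 0\<^sub>v m"
  shows "w = 0\<^sub>v d"
proof -
  let ?K = "controllability_mat \<beta> \<sigma>"
  have K: "?K \<in> carrier_mat d (d * m)" using \<beta> \<sigma> by (simp add: controllability_mat_def Let_def)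
  have rank: "mat_rank ?K = d" using ctr \<beta> by (simp add: controllable_def)
  have pow: "cmat (\<beta> ^\<^sub>m k * \<sigma>)\<^sup>T *\<^sub>v w = 0\<^sub>v m" for k
  proof (induction k)
    case (Suc k)
    have "\<beta> ^\<^sub>m Suc k * \<sigma> = \<beta> * (\<beta> ^\<^sub>m k * \<sigma>)"
      unfolding pow_mat_Suc_left[OF \<beta>] using \<beta> \<sigma> by (simp add: mat_assoc)
    then have "(\<beta> ^\<^sub>m Suc k * \<sigma>)\<^sup>T = (\<beta> ^\<^sub>m k * \<sigma>)\<^sup>T * \<beta>\<^sup>T" using \<beta> \<sigma> by (simp add: mat_transpose)
    then have "cmat (\<beta> ^\<^sub>m Suc k * \<sigma>)\<^sup>T = cmat (\<beta> ^\<^sub>m k * \<sigma>)\<^sup>T * cmat \<beta>\<^sup>T"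
      using cmat_mult[of "(\<beta> ^\<^sub>m k * \<sigma>)\<^sup>T" m d "\<beta>\<^sup>T" d] \<beta> mult_carrier_mat[OF pow_carrier_mat[OF \<beta>] \<sigma>, of k]
      by (simp del: pow_mat.simps)
    then have "cmat (\<beta> ^\<^sub>m Suc k * \<sigma>)\<^sup>T *\<^sub>v w = cmat (\<beta> ^\<^sub>m k * \<sigma>)\<^sup>T *\<^sub>v (\<mu> \<cdot>\<^sub>v w)"
      using w \<beta> \<sigma> by (simp add: mat_vec_assoc)
    also have "\<dots> = \<mu> \<cdot>\<^sub>v (cmat (\<beta> ^\<^sub>m k * \<sigma>)\<^sup>T *\<^sub>v w)" using w \<beta> \<sigma> by (simp add: mat_vec_distrib)
    finally show ?case unfolding Suc by (auto intro!: eq_vecI)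
  qed (use w \<beta> \<sigma> in \<open>simp add: mat_one\<close>)
  have Kw: "(\<Sum>r<d. complex_of_real (?K $$ (r, j)) * w $ r) = 0" if j: "j < d * m" for j
  proof -
    have m: "j mod m < m" using j by (cases m) auto
    have "(\<Sum>r<d. complex_of_real (?K $$ (r, j)) * w $ r) = (cmat (\<beta> ^\<^sub>m (j div m) * \<sigma>)\<^sup>T *\<^sub>v w) $ (j mod m)"
      using j m w \<beta> \<sigma> by (simp add: controllability_mat_def Let_def scalar_prod_def lessThan_atLeast0)
    then show ?thesis using pow m by simp
  qed
  have part: "map_vec g w = 0\<^sub>v d" if g: "\<And>j. j < d * m \<Longrightarrow> (\<Sum>r<d. ?K $$ (r, j) * g (w $ r)) = 0" for g
  proof (rule full_row_rank_left_kernel[OF K rank])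
    show "?K\<^sup>T *\<^sub>v map_vec g w = 0\<^sub>v (d * m)"
      using g K w by (auto intro!: eq_vecI simp: scalar_prod_def lessThan_atLeast0)
  qed (use w in auto)
  have "map_vec Re w = 0\<^sub>v d"
  proof (rule part)
    show "(\<Sum>r<d. ?K $$ (r, j) * Re (w $ r)) = 0" if "j < d * m" for j
      using arg_cong[OF Kw[OF that], of Re] by simp
  qed
  moreover have "map_vec Im w = 0\<^sub>v d"
  proof (rule part)
    show "(\<Sum>r<d. ?K $$ (r, j) * Im (w $ r)) = 0" if "j < d * m" for j
      using arg_cong[OF Kw[OF that], of Im] by simp
  qed
  ultimately have "Re (w $ i) = 0 \<and> Im (w $ i) = 0" if "i < d" for i
    using that w by (metis carrier_vecD index_map_vec(1) index_zero_vec(1))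
  then show ?thesis using w by (auto intro!: eq_vecI simp: complex_eq_iff)
qed

section \<open>Block diagonal matrices with equal blocks\<close>

text \<open>The Kronecker product \<open>I\<^sub>p \<otimes> A\<close> for any type of entries, so that it commutes with complexification.\<close>

definition rep_diag :: "nat \<Rightarrow> 'a :: zero mat \<Rightarrow> 'a mat" where
  "rep_diag p A = mat (p * dim_row A) (p * dim_col A)
     (\<lambda>(i, j). if i div dim_row A = j div dim_col A then A $$ (i mod dim_row A, j mod dim_col A) else 0)"

definition vec_block :: "nat \<Rightarrow> 'a vec \<Rightarrow> nat \<Rightarrow> 'a vec" where
  "vec_block c x i = vec c (\<lambda>b. x $ (i * c + b))"

lemma block_index: "i < p \<Longrightarrow> b < c \<Longrightarrow> i * c + b < p * (c :: nat)"
  by (metis (no_types, lifting) add.commute add_less_mono1 less_le_trans mult_Suc mult_le_mono1 Suc_leI)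

lemma sum_blocks:
  fixes f :: "nat \<Rightarrow> 'a :: comm_monoid_add"
  shows "(\<Sum>j<p * c. f j) = (\<Sum>i<p. \<Sum>b<c. f (i * c + b))"
proof (induction p)
  case (Suc p)
  have split: "(\<Sum>j<N + c. f j) = (\<Sum>j<N. f j) + (\<Sum>b<c. f (N + b))" for N
    by (induction c) (simp_all add: add.assoc)
  have "(\<Sum>j<Suc p * c. f j) = (\<Sum>j<p * c + c. f j)" by (simp add: add.commute)
  also have "\<dots> = (\<Sum>j<p * c. f j) + (\<Sum>b<c. f (p * c + b))"
    by (rule split)
  finally show ?case using Suc by simp
qed simp

lemma rep_diag_dims [simp]:
  "dim_row (rep_diag p A) = p * dim_row A" "dim_col (rep_diag p A) = p * dim_col A"
  by (auto simp: rep_diag_def)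

lemma vec_block_carrier [simp]: "vec_block c x i \<in> carrier_vec c"
  by (simp add: vec_block_def)

lemma rep_diag_mult_vec:
  fixes A :: "'a :: comm_ring_1 mat"
  assumes A: "A \<in> carrier_mat r c" and x: "x \<in> carrier_vec (p * c)" and i: "i < p"
  shows "vec_block r (rep_diag p A *\<^sub>v x) i = A *\<^sub>v vec_block c x i"
proof (rule eq_vecI)
  fix a assume "a < dim_vec (A *\<^sub>v vec_block c x i)"
  then have a: "a < r" using A by simp
  have ia: "i * r + a < p * r" using i a by (rule block_index)
  have "vec_block r (rep_diag p A *\<^sub>v x) i $ a = (\<Sum>j<p * c. rep_diag p A $$ (i * r + a, j) * x $ j)"
    using ia a A x by (simp add: vec_block_def scalar_prod_def lessThan_atLeast0)
  also have "\<dots> = (\<Sum>i'<p. \<Sum>b<c. rep_diag p A $$ (i * r + a, i' * c + b) * x $ (i' * c + b))"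
    by (rule sum_blocks)
  also have "\<dots> = (\<Sum>i'<p. if i' = i then \<Sum>b<c. A $$ (a, b) * x $ (i' * c + b) else 0)"
    using A ia a block_index[of _ p _ c] by (intro sum.cong refl) (auto simp: rep_diag_def)
  also have "\<dots> = (\<Sum>b<c. A $$ (a, b) * x $ (i * c + b))" using i by simp
  also have "\<dots> = (A *\<^sub>v vec_block c x i) $ a"
    using a A by (simp add: vec_block_def scalar_prod_def lessThan_atLeast0)
  finally show "vec_block r (rep_diag p A *\<^sub>v x) i $ a = (A *\<^sub>v vec_block c x i) $ a" .
qed (use A in \<open>simp add: vec_block_def\<close>)

lemma vec_blocks_eqI:
  assumes "x \<in> carrier_vec (p * c)" "y \<in> carrier_vec (p * c)" "\<And>i. i < p \<Longrightarrow> vec_block c x i = vec_block c y i"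
  shows "x = y"
proof (rule eq_vecI)
  fix j assume "j < dim_vec y"
  then have j: "j < p * c" using assms by simp
  then have "c > 0" by (cases c) auto
  then have "j div c < p" "j mod c < c" using j less_mult_imp_div_less by auto
  then have "vec_block c x (j div c) $ (j mod c) = vec_block c y (j div c) $ (j mod c)"
    using assms(3) by simp
  then show "x $ j = y $ j" using \<open>j mod c < c\<close> by (simp add: vec_block_def)
qed (use assms in auto)

lemma vec_block_smult: "i < p \<Longrightarrow> x \<in> carrier_vec (p * c) \<Longrightarrow> vec_block c (\<mu> \<cdot>\<^sub>v x) i = \<mu> \<cdot>\<^sub>v vec_block c x i"
  using block_index[of i p _ c] by (auto simp: vec_block_def intro!: eq_vecI)

lemma vec_block_zero: "i < p \<Longrightarrow> vec_block c (0\<^sub>v (p * c)) i = 0\<^sub>v c"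
  using block_index[of i p _ c] by (auto simp: vec_block_def intro!: eq_vecI)

lemma vec_blocks_eq_0I:
  assumes "x \<in> carrier_vec (p * c)" "\<And>i. i < p \<Longrightarrow> vec_block c x i = 0\<^sub>v c"
  shows "x = 0\<^sub>v (p * c)"
  by (rule vec_blocks_eqI[OF assms(1)]) (simp_all add: assms(2) vec_block_zero)

lemma append_zero_vec: "0\<^sub>v n @\<^sub>v 0\<^sub>v m = 0\<^sub>v (n + m)"
  by (auto intro!: eq_vecI)

lemma kron_one_rep_diag: "kron (1\<^sub>m p) A = rep_diag p A"
  by (auto simp: kron_def rep_diag_def mat_eq_iff less_mult_imp_div_less)

lemma diag_block_replicate:
  assumes A: "A \<in> carrier_mat r c"
  shows "diag_block_mat (replicate p A) = rep_diag p A"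
proof (induction p)
  case (Suc p)
  have "four_block_mat A (0\<^sub>m r (p * c)) (0\<^sub>m (p * r) c) (rep_diag p A) = rep_diag (Suc p) A"
  proof (rule eq_matI)
    fix i j assume "i < dim_row (rep_diag (Suc p) A)" "j < dim_col (rep_diag (Suc p) A)"
    then have ij: "i < r + p * r" "j < c + p * c" using A by auto
    consider "i < r" "j < c" | "i < r" "\<not> j < c" | "\<not> i < r" "j < c" | "\<not> i < r" "\<not> j < c" by blast
    then show "four_block_mat A (0\<^sub>m r (p * c)) (0\<^sub>m (p * r) c) (rep_diag p A) $$ (i, j) = rep_diag (Suc p) A $$ (i, j)"
    proof cases
      case 4
      then have "i div r = Suc ((i - r) div r)" "j div c = Suc ((j - c) div c)"
        "i mod r = (i - r) mod r" "j mod c = (j - c) mod c"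
        using ij by (cases "r = 0"; cases "c = 0"; auto simp: le_div_geq le_mod_geq)+
      then show ?thesis using ij A 4 by (simp add: rep_diag_def less_diff_conv2)
    qed (use ij A in \<open>auto simp: rep_diag_def div_eq_0_iff\<close>)
  qed (use A in auto)
  then show ?case using Suc A by (simp add: Let_def)
qed (auto simp: rep_diag_def mat_eq_iff)

lemma map_rep_diag: "f 0 = 0 \<Longrightarrow> map_mat f (rep_diag p A) = rep_diag p (map_mat f A)"
  by (cases "dim_row A = 0 \<or> dim_col A = 0") (auto simp: rep_diag_def mat_eq_iff)

lemma transpose_rep_diag: "(rep_diag p A)\<^sup>T = rep_diag p A\<^sup>T"
  by (cases "dim_row A = 0 \<or> dim_col A = 0") (auto simp: rep_diag_def mat_eq_iff)

lemma rep_diag_eigen: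
  fixes A :: "'a :: comm_ring_1 mat"
  assumes A: "A \<in> carrier_mat c c" and x: "x \<in> carrier_vec (p * c)" "rep_diag p A *\<^sub>v x = \<mu> \<cdot>\<^sub>v x" and i: "i < p"
  shows "A *\<^sub>v vec_block c x i = \<mu> \<cdot>\<^sub>v vec_block c x i"
  using rep_diag_mult_vec[OF A x(1) i] vec_block_smult[OF i x(1)] x(2) by simp

section \<open>The internal model\<close>

text \<open>Write \<open>f = (X - \<mu>) g\<close>. If \<open>\<mu>\<close> is no eigenvalue, then \<open>S - \<mu>\<close> is injective and \<open>g(S) = 0\<close>. The
  polynomial \<open>g\<close> is complex, but its real and imaginary parts annihilate the real matrix \<open>S\<close> as
  well, and one of them is nonzero of smaller degree than \<open>f\<close>.\<close>

lemma minimal_poly_root_eigenvalue: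
  assumes S: "S \<in> carrier_mat q q" and f: "is_minimal_poly S f" and root: "poly (map_poly complex_of_real f) \<mu> = 0"
  shows "eigenvalue (cmat S) \<mu>"
proof (rule ccontr)
  assume no: "\<not> eigenvalue (cmat S) \<mu>"
  have f0: "f \<noteq> 0" and fS: "poly_mat f S = 0\<^sub>m q q"
    and least: "\<And>g. g \<noteq> 0 \<Longrightarrow> poly_mat g S = 0\<^sub>m q q \<Longrightarrow> degree f \<le> degree g"
    using f S by (auto simp: is_minimal_poly_def)
  let ?f = "map_poly complex_of_real f"
  have cS: "cmat S \<in> carrier_mat q q" using S by simp
  obtain g where g: "?f = [:- \<mu>, 1:] * g" using root by (auto simp: poly_eq_0_iff_dvd elim: dvdE)
  have fc0: "?f \<noteq> 0" using f0 by simp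
  have g0: "g \<noteq> 0" using fc0 g by auto
  have deg: "degree f = Suc (degree g)"
  proof -
    have "degree ?f = Suc (degree g)" unfolding g by (subst degree_mult_eq) (use g0 in auto)
    then show ?thesis by simp
  qed
  let ?N = "Suc (degree g)"
  have ent: "(cmat S ^\<^sub>m k *\<^sub>v unit_vec q j) $ i = of_real ((S ^\<^sub>m k) $$ (i, j))" if "i < q" "j < q" for i j k
    using that S unfolding of_real_hom.mat_hom_pow[OF S, symmetric] by simp
  have zero: "(\<Sum>k<?N. coeff g k * of_real ((S ^\<^sub>m k) $$ (i, j))) = 0" if ij: "i < q" "j < q" for i j
  proof -
    define u where "u = poly_vec ?N g (cmat S) (unit_vec q j)"
    have u: "u \<in> carrier_vec q" unfolding u_def by (rule poly_vec_carrier[OF cS])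
    have "poly_vec (Suc ?N) ?f (cmat S) (unit_vec q j) = 0\<^sub>v q"
    proof (rule eq_vecI)
      fix i assume "i < dim_vec (0\<^sub>v q :: complex vec)"
      then have i: "i < q" by simp
      have "(\<Sum>k<Suc ?N. coeff ?f k * of_real ((S ^\<^sub>m k) $$ (i, j))) = of_real (\<Sum>k\<le>degree f. coeff f k * (S ^\<^sub>m k) $$ (i, j))"
        unfolding lessThan_Suc_atMost deg by (simp add: coeff_map_poly)
      also have "(\<Sum>k\<le>degree f. coeff f k * (S ^\<^sub>m k) $$ (i, j)) = poly_mat f S $$ (i, j)"
        using i ij S by (simp add: poly_mat_def)
      also have "\<dots> = 0" using fS i ij by simp
      finally show "poly_vec (Suc ?N) ?f (cmat S) (unit_vec q j) $ i = 0\<^sub>v q $ i"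
        using i ij S ent by (simp add: poly_vec_def del: sum.lessThan_Suc)
    qed (use S in \<open>simp add: poly_vec_def\<close>)
    then have *: "cmat S *\<^sub>v u - \<mu> \<cdot>\<^sub>v u = 0\<^sub>v q"
      using poly_vec_linear_factor[OF cS, of "unit_vec q j" g ?N \<mu>] unfolding g u_def by simp
    have "(cmat S *\<^sub>v u) $ l = \<mu> * u $ l" if "l < q" for l
      using arg_cong[OF *, of "\<lambda>v. v $ l"] that S u by (simp del: index_mult_mat_vec)
    then have "cmat S *\<^sub>v u = \<mu> \<cdot>\<^sub>v u" using S u by (intro eq_vecI) auto
    then have "u = 0\<^sub>v q" using no u S by (auto simp: eigenvalue_def eigenvector_def)
    then have "u $ i = 0" using ij by simp
    then show ?thesis using ij S ent by (simp add: u_def poly_vec_def del: sum.lessThan_Suc)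
  qed
  have part: "map_poly h g = 0" if h: "h 0 = 0" and 0: "\<And>i j. i < q \<Longrightarrow> j < q \<Longrightarrow> (\<Sum>k<?N. h (coeff g k) * (S ^\<^sub>m k) $$ (i, j)) = 0"
    for h :: "complex \<Rightarrow> real"
  proof (rule ccontr)
    assume n0: "map_poly h g \<noteq> 0"
    have le: "degree (map_poly h g) \<le> degree g" by (rule degree_map_poly_le)
    have "poly_mat (map_poly h g) S = 0\<^sub>m q q"
    proof (rule eq_matI)
      fix i j assume "i < dim_row (0\<^sub>m q q :: real mat)" "j < dim_col (0\<^sub>m q q :: real mat)"
      then have ij: "i < q" "j < q" by auto
      have "poly_mat (map_poly h g) S $$ (i, j) = (\<Sum>k\<le>degree (map_poly h g). coeff (map_poly h g) k * (S ^\<^sub>m k) $$ (i, j))"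
        using ij S by (simp add: poly_mat_def)
      also have "\<dots> = (\<Sum>k<?N. coeff (map_poly h g) k * (S ^\<^sub>m k) $$ (i, j))"
        using le by (intro sum.mono_neutral_left) (auto simp: coeff_eq_0)
      also have "\<dots> = 0" using 0[OF ij] by (simp only: coeff_map_poly[of h, OF h])
      finally show "poly_mat (map_poly h g) S $$ (i, j) = 0\<^sub>m q q $$ (i, j)" using ij by simp
    qed (use S in \<open>auto simp: poly_mat_def\<close>)
    from least[OF n0 this] le deg show False by simp
  qed
  have "map_poly Re g = 0"
  proof (rule part)
    show "(\<Sum>k<?N. Re (coeff g k) * (S ^\<^sub>m k) $$ (i, j)) = 0" if "i < q" "j < q" for i j
      using arg_cong[OF zero[OF that], of Re] by (simp del: sum.lessThan_Suc)
  qed simp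
  moreover have "map_poly Im g = 0"
  proof (rule part)
    show "(\<Sum>k<?N. Im (coeff g k) * (S ^\<^sub>m k) $$ (i, j)) = 0" if "i < q" "j < q" for i j
      using arg_cong[OF zero[OF that], of Im] by (simp del: sum.lessThan_Suc)
  qed simp
  ultimately have "Re (coeff g k) = 0 \<and> Im (coeff g k) = 0" for k
    by (metis coeff_0 coeff_map_poly zero_complex.simps)
  then have "g = 0" by (intro poly_eqI) (simp add: complex_eq_iff)
  with g0 show False ..
qed

text \<open>What the internal model contributes: its spectrum lies in that of \<open>S\<close>, and it passes the Hautus test.
  Both properties are inherited block by block from \<open>(\<beta>, \<sigma>)\<close>.\<close>

lemma internal_model_facts:
  assumes S: "S \<in> carrier_mat q q" and model: "minimal_internal_model p S G1 G2"
  obtains l where "G1 \<in> carrier_mat l l" "G2 \<in> carrier_mat l p"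
    "\<And>\<mu>. eigenvalue (cmat G1) \<mu> \<Longrightarrow> eigenvalue (cmat S) \<mu>"
    "\<And>\<mu> w. w \<in> carrier_vec l \<Longrightarrow> cmat G1\<^sup>T *\<^sub>v w = \<mu> \<cdot>\<^sub>v w \<Longrightarrow> cmat G2\<^sup>T *\<^sub>v w = 0\<^sub>v p \<Longrightarrow> w = 0\<^sub>v l"
proof -
  from model obtain d \<beta> \<sigma> where \<beta>: "\<beta> \<in> carrier_mat d d" and \<sigma>: "\<sigma> \<in> carrier_mat d 1"
    and min: "is_minimal_poly S (char_poly \<beta>)" and ctr: "controllable \<beta> \<sigma>"
    and G: "G1 = diag_block_mat (replicate p \<beta>)" "G2 = diag_block_mat (replicate p \<sigma>)"
    by (auto simp: minimal_internal_model_def)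
  have G1: "G1 = rep_diag p \<beta>" and G2: "G2 = rep_diag p \<sigma>"
    using G diag_block_replicate[OF \<beta>] diag_block_replicate[OF \<sigma>] by auto
  have cG: "cmat G1 = rep_diag p (cmat \<beta>)" "cmat G1\<^sup>T = rep_diag p (cmat \<beta>\<^sup>T)" "cmat G2\<^sup>T = rep_diag p (cmat \<sigma>\<^sup>T)"
    by (simp_all add: G1 G2 map_rep_diag transpose_rep_diag)
  have c1: "G1 \<in> carrier_mat (p * d) (p * d)" "G2 \<in> carrier_mat (p * d) p"
    using \<beta> \<sigma> by (auto simp: G1 G2 intro!: carrier_matI)
  have ev: "eigenvalue (cmat S) \<mu>" if ev: "eigenvalue (cmat G1) \<mu>" for \<mu>
  proof -
    obtain v where v: "v \<in> carrier_vec (p * d)" "v \<noteq> 0\<^sub>v (p * d)" "rep_diag p (cmat \<beta>) *\<^sub>v v = \<mu> \<cdot>\<^sub>v v"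
      using ev c1 by (auto simp: eigenvalue_def eigenvector_def cG(1)[symmetric])
    obtain i where i: "i < p" "vec_block d v i \<noteq> 0\<^sub>v d"
      using vec_blocks_eq_0I[OF v(1)] v(2) by blast
    have "cmat \<beta> *\<^sub>v vec_block d v i = \<mu> \<cdot>\<^sub>v vec_block d v i"
      by (rule rep_diag_eigen[OF _ v(1,3) i(1)]) (use \<beta> in auto)
    then have "eigenvalue (cmat \<beta>) \<mu>"
      using i \<beta> by (auto simp: eigenvalue_def eigenvector_def intro!: exI[of _ "vec_block d v i"])
    then have "poly (char_poly (cmat \<beta>)) \<mu> = 0" using eigenvalue_root_char_poly[of "cmat \<beta>" d] \<beta> by auto
    then show ?thesis
      using minimal_poly_root_eigenvalue[OF S min] by (simp add: of_real_hom.char_poly_hom[OF \<beta>])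
  qed
  have hautus: "w = 0\<^sub>v (p * d)"
    if w: "w \<in> carrier_vec (p * d)" "cmat G1\<^sup>T *\<^sub>v w = \<mu> \<cdot>\<^sub>v w" "cmat G2\<^sup>T *\<^sub>v w = 0\<^sub>v p" for \<mu> w
  proof (rule vec_blocks_eq_0I[OF w(1)])
    fix i assume i: "i < p"
    show "vec_block d w i = 0\<^sub>v d"
    proof (rule controllable_hautus[OF \<beta> \<sigma> ctr])
      show "cmat \<beta>\<^sup>T *\<^sub>v vec_block d w i = \<mu> \<cdot>\<^sub>v vec_block d w i"
        by (rule rep_diag_eigen[OF _ w(1) _ i]) (use \<beta> w cG in auto)
      have "cmat \<sigma>\<^sup>T *\<^sub>v vec_block d w i = vec_block 1 (rep_diag p (cmat \<sigma>\<^sup>T) *\<^sub>v w) i"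
        by (rule rep_diag_mult_vec[OF _ w(1) i, symmetric]) (use \<sigma> in auto)
      also have "\<dots> = vec_block 1 (0\<^sub>v (p * 1)) i" using w(3) cG by simp
      also have "\<dots> = 0\<^sub>v 1" by (rule vec_block_zero[OF i])
      finally show "cmat \<sigma>\<^sup>T *\<^sub>v vec_block d w i = 0\<^sub>v 1" .
    qed simp
  qed
  show thesis by (rule that[OF c1 ev hautus])
qed

text \<open>Let \<open>(w1, w2)\<close> be a left eigenvector of the augmented plant that the input misses, at an eigenvalue
  \<open>\<mu>\<close> of \<open>G1\<close>. Then \<open>(w1, G2\<^sup>T w2)\<close> lies in the left kernel of the matrix of the rank condition,
  so \<open>G2\<^sup>T w2 = 0\<close>, and the Hautus test for the internal model gives \<open>w2 = 0\<close>.\<close>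

lemma augmented_stabilizable:
  assumes A: "A \<in> carrier_mat n n" and B: "B \<in> carrier_mat n m"
    and C: "C \<in> carrier_mat p n" and S: "S \<in> carrier_mat q q"
    and stab: "stabilizable A B"
    and S_spec: "\<And>\<mu>. eigenvalue (cmat S) \<mu> \<Longrightarrow> \<not> Re \<mu> < 0"
    and rank: "\<And>\<mu>. eigenvalue (cmat S) \<mu> \<Longrightarrow>
      mat_rank (four_block_mat (cmat A - \<mu> \<cdot>\<^sub>m 1\<^sub>m n) (cmat B) (cmat C) (0\<^sub>m p m)) = n + p"
    and model: "minimal_internal_model p S G1 G2" and G1: "G1 \<in> carrier_mat l l"
  shows "\<exists>K \<in> carrier_mat m (n + l).
    hurwitz (four_block_mat A (0\<^sub>m n l) (G2 * C) G1 + (B @\<^sub>r 0\<^sub>m l m) * K)"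
proof -
  obtain l' where "G1 \<in> carrier_mat l' l'" "G2 \<in> carrier_mat l' p"
    and ev: "\<And>\<mu>. eigenvalue (cmat G1) \<mu> \<Longrightarrow> eigenvalue (cmat S) \<mu>"
    and hautus': "\<And>\<mu> w. w \<in> carrier_vec l' \<Longrightarrow> cmat G1\<^sup>T *\<^sub>v w = \<mu> \<cdot>\<^sub>v w \<Longrightarrow> cmat G2\<^sup>T *\<^sub>v w = 0\<^sub>v p \<Longrightarrow> w = 0\<^sub>v l'"
    by (rule internal_model_facts[OF S model]) blast
  moreover from this G1 have "l' = l" by auto
  ultimately have G2: "G2 \<in> carrier_mat l p" and hautus: "\<And>\<mu> w. w \<in> carrier_vec l \<Longrightarrow>
      cmat G1\<^sup>T *\<^sub>v w = \<mu> \<cdot>\<^sub>v w \<Longrightarrow> cmat G2\<^sup>T *\<^sub>v w = 0\<^sub>v p \<Longrightarrow> w = 0\<^sub>v l" by auto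
  obtain K0 where K0: "K0 \<in> carrier_mat m n" "hurwitz (A + B * K0)"
    using stab A B by (auto simp: stabilizable_def)
  show ?thesis
  proof (rule cascade_stabilizable[OF A B C G1 G2 K0])
    show "0 \<le> Re \<mu>" if "eigenvalue (cmat G1) \<mu>" for \<mu> using S_spec[OF ev[OF that]] by simp
    fix \<mu> w1 w2
    assume w: "w1 \<in> carrier_vec n" "w2 \<in> carrier_vec l"
      and e1: "cmat A\<^sup>T *\<^sub>v w1 + cmat (G2 * C)\<^sup>T *\<^sub>v w2 = \<mu> \<cdot>\<^sub>v w1"
      and e2: "cmat G1\<^sup>T *\<^sub>v w2 = \<mu> \<cdot>\<^sub>v w2" and e3: "cmat B\<^sup>T *\<^sub>v w1 = 0\<^sub>v m"
    show "w2 = 0\<^sub>v l"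
    proof (rule ccontr)
      assume "w2 \<noteq> 0\<^sub>v l"
      then have "eigenvalue (cmat G1\<^sup>T) \<mu>" using e2 w G1 by (auto simp: eigenvalue_def eigenvector_def)
      then have "eigenvalue (cmat S) \<mu>" using ev cmat_eigenvalue_transpose[OF G1] by blast
      note rk = rank[OF this]
      let ?M = "four_block_mat (cmat A - \<mu> \<cdot>\<^sub>m 1\<^sub>m n) (cmat B) (cmat C) (0\<^sub>m p m)"
      define y where "y = cmat G2\<^sup>T *\<^sub>v w2"
      have y: "y \<in> carrier_vec p" using G2 w by (auto simp: y_def)
      have Am: "cmat A - \<mu> \<cdot>\<^sub>m 1\<^sub>m n \<in> carrier_mat n n" by (rule minus_carrier_mat) auto
      have M: "?M \<in> carrier_mat (n + p) (n + m)" using Am by (intro four_block_carrier_mat) auto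
      have "?M\<^sup>T = four_block_mat (cmat A - \<mu> \<cdot>\<^sub>m 1\<^sub>m n)\<^sup>T (cmat C)\<^sup>T (cmat B)\<^sup>T (0\<^sub>m p m)\<^sup>T"
        by (rule transpose_four_block_mat[OF Am]) (use B C in auto)
      then have "?M\<^sup>T *\<^sub>v (w1 @\<^sub>v y) = ((cmat A - \<mu> \<cdot>\<^sub>m 1\<^sub>m n)\<^sup>T *\<^sub>v w1 + (cmat C)\<^sup>T *\<^sub>v y) @\<^sub>v ((cmat B)\<^sup>T *\<^sub>v w1 + (0\<^sub>m p m)\<^sup>T *\<^sub>v y)"
        using Am B C w y by (simp add: four_block_mat_mult_vec[of _ n n _ p _ m])
      also have "(cmat B)\<^sup>T *\<^sub>v w1 + (0\<^sub>m p m)\<^sup>T *\<^sub>v y = 0\<^sub>v m"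
        using e3 y B by (auto simp: map_mat_transpose intro!: eq_vecI simp del: index_mult_mat_vec) (simp add: scalar_prod_def)
      also have "(cmat A - \<mu> \<cdot>\<^sub>m 1\<^sub>m n)\<^sup>T *\<^sub>v w1 + (cmat C)\<^sup>T *\<^sub>v y = 0\<^sub>v n"
      proof -
        have "cmat (G2 * C)\<^sup>T = (cmat C)\<^sup>T * cmat G2\<^sup>T"
          using cmat_mult[of "C\<^sup>T" n p "G2\<^sup>T" l] G2 C by (simp add: mat_transpose map_mat_transpose)
        then have "(cmat C)\<^sup>T *\<^sub>v y = cmat (G2 * C)\<^sup>T *\<^sub>v w2" using G2 C w by (simp add: y_def mat_vec_assoc)
        moreover have "(cmat A - \<mu> \<cdot>\<^sub>m 1\<^sub>m n)\<^sup>T = cmat A\<^sup>T - \<mu> \<cdot>\<^sub>m 1\<^sub>m n"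
          using A by (auto simp: mat_eq_iff)
        then have "(cmat A - \<mu> \<cdot>\<^sub>m 1\<^sub>m n)\<^sup>T *\<^sub>v w1 = cmat A\<^sup>T *\<^sub>v w1 - \<mu> \<cdot>\<^sub>v w1"
          using A w by (simp add: mat_vec_distrib)
        moreover have "cmat A\<^sup>T *\<^sub>v w1 - (cmat A\<^sup>T *\<^sub>v w1 + cmat (G2 * C)\<^sup>T *\<^sub>v w2) + cmat (G2 * C)\<^sup>T *\<^sub>v w2 = 0\<^sub>v n"
          using A C by (auto intro!: eq_vecI simp del: index_mult_mat_vec)
        ultimately show ?thesis unfolding e1 by simp
      qed
      finally have "?M\<^sup>T *\<^sub>v (w1 @\<^sub>v y) = 0\<^sub>v (n + m)" by (simp only: append_zero_vec)
      from full_row_rank_left_kernel[OF M rk _ this] have "w1 @\<^sub>v y = 0\<^sub>v n @\<^sub>v 0\<^sub>v p"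
        using w y by (simp add: append_zero_vec)
      then have "y = 0\<^sub>v p" using append_vec_eq[OF w(1), of "0\<^sub>v n"] by auto
      then show False using hautus[OF w(2) e2] \<open>w2 \<noteq> 0\<^sub>v l\<close> by (simp add: y_def)
    qed
  qed
qed

section \<open>Positive definiteness\<close>

context lq
begin

text \<open>On a kernel vector the equation reduces to \<open>P Y x + Q x = 0\<close>. The scalar product with \<open>x\<close> removes the
  first term, and a semidefinite form vanishes only on its kernel.\<close>

lemma riccati_kernel:
  assumes P: "pos_semidef k P" and ric: "riccati Y J Q R P" and x: "x \<in> carrier_vec k" "P *\<^sub>v x = 0\<^sub>v k"
  shows "Q *\<^sub>v x = 0\<^sub>v k" "P *\<^sub>v (Y *\<^sub>v x) = 0\<^sub>v k"
proof -
  have Pc: "P \<in> carrier_mat k k" "P\<^sup>T = P" using P by (auto simp: pos_semidef_def)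
  note d = dims carrier_matD[OF Pc(1)]
  define G where "G = P * J * mat_inv R * J\<^sup>T"
  have G: "G \<in> carrier_mat k k" using d by (auto simp: G_def)
  have z: "N *\<^sub>v 0\<^sub>v k = 0\<^sub>v k" if "N \<in> carrier_mat k k" for N :: "real mat"
    using that by (auto intro!: eq_vecI simp: scalar_prod_def)
  have "(Y\<^sup>T * P + P * Y + Q - G * P) *\<^sub>v x = 0\<^sub>m k k *\<^sub>v x"
    using ric by (simp add: riccati_def G_def d)
  also have "(Y\<^sup>T * P + P * Y + Q - G * P) *\<^sub>v x = Y\<^sup>T *\<^sub>v (P *\<^sub>v x) + P *\<^sub>v (Y *\<^sub>v x) + Q *\<^sub>v x - G *\<^sub>v (P *\<^sub>v x)"
    using x d carrier_matD[OF G] by (simp add: mat_vec_distrib(1,2) mat_vec_assoc)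
  also have "\<dots> = P *\<^sub>v (Y *\<^sub>v x) + Q *\<^sub>v x"
  proof -
    have "0\<^sub>v k + a + b - 0\<^sub>v k = a + b" if "a \<in> carrier_vec k" "b \<in> carrier_vec k" for a b :: "real vec"
      using that by (auto intro!: eq_vecI)
    moreover have "P *\<^sub>v (Y *\<^sub>v x) \<in> carrier_vec k" "Q *\<^sub>v x \<in> carrier_vec k" using d by (auto intro: carrier_vecI)
    moreover have "Y\<^sup>T *\<^sub>v 0\<^sub>v k = 0\<^sub>v k" using Y by (intro z) auto
    ultimately show ?thesis unfolding x(2) z[OF G] by simp
  qed
  also have "0\<^sub>m k k *\<^sub>v x = 0\<^sub>v k" using x by (auto intro!: eq_vecI)
  finally have eq: "P *\<^sub>v (Y *\<^sub>v x) + Q *\<^sub>v x = 0\<^sub>v k" .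
  have "x \<bullet> (P *\<^sub>v (Y *\<^sub>v x)) = (Y *\<^sub>v x) \<bullet> (P *\<^sub>v x)"
    by (rule scalar_prod_symmetric[OF Pc]) (use x Y in auto)
  also have "\<dots> = 0" unfolding x(2) using x Y by simp
  finally have xPYx: "x \<bullet> (P *\<^sub>v (Y *\<^sub>v x)) = 0" .
  have "x \<bullet> (P *\<^sub>v (Y *\<^sub>v x) + Q *\<^sub>v x) = 0" unfolding eq using x by simp
  then have "x \<bullet> (Q *\<^sub>v x) = 0" using xPYx x d by (simp add: scalar_prod_linear)
  then show Q0: "Q *\<^sub>v x = 0\<^sub>v k" by (rule psd_kernel[OF Q x(1)])
  show "P *\<^sub>v (Y *\<^sub>v x) = 0\<^sub>v k" using eq d unfolding Q0 by (simp add: carrier_vecI)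
qed

end

text \<open>The kernel of \<open>P\<close> is invariant under \<open>Y\<close> and invisible to \<open>Cbar\<close>. So its vectors have no internal
  model component, and the orbit of the plant component under \<open>A\<close> is invisible to \<open>C\<close>:
  observability leaves only zero.\<close>

lemma augmented_riccati_pos_def:
  assumes A: "A \<in> carrier_mat n n" and C: "C \<in> carrier_mat p n" and obs: "observable A C"
    and G1: "G1 \<in> carrier_mat l l" and G2: "G2 \<in> carrier_mat l p"
    and J: "J \<in> carrier_mat (n + l) m" and R: "pos_def m R" and Qbar: "pos_def (p + l) Qbar"
    and Y_eq: "Y = four_block_mat A (0\<^sub>m n l) (G2 * C) G1"
    and Cbar_eq: "Cbar = four_block_mat C (0\<^sub>m p l) (0\<^sub>m l n) (1\<^sub>m l)"
    and P: "pos_semidef (n + l) P" and ric: "riccati Y J (Cbar\<^sup>T * Qbar * Cbar) R P"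
  shows "pos_def (n + l) P"
proof -
  have Cb: "Cbar \<in> carrier_mat (p + l) (n + l)" unfolding Cbar_eq using C by (intro four_block_carrier_mat) auto
  have Yc: "Y \<in> carrier_mat (n + l) (n + l)" unfolding Y_eq using A G1 by (intro four_block_carrier_mat) auto
  interpret lq "n + l" m Y J "Cbar\<^sup>T * Qbar * Cbar" R
    using Yc J R psd_congruence[OF pos_def_imp_psd[OF Qbar] Cb] by unfold_locales
  have Qb: "Qbar \<in> carrier_mat (p + l) (p + l)" using Qbar by (simp add: pos_def_def)
  have unseen: "Cbar *\<^sub>v x = 0\<^sub>v (p + l)" if x: "x \<in> carrier_vec (n + l)" "P *\<^sub>v x = 0\<^sub>v (n + l)" for x
  proof (rule ccontr)
    assume n0: "Cbar *\<^sub>v x \<noteq> 0\<^sub>v (p + l)"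
    have "x \<bullet> ((Cbar\<^sup>T * Qbar * Cbar) *\<^sub>v x) = 0"
      unfolding riccati_kernel(1)[OF P ric x] using x by simp
    then have "(Cbar *\<^sub>v x) \<bullet> (Qbar *\<^sub>v (Cbar *\<^sub>v x)) = 0" unfolding quadratic_congruence[OF Qb Cb x(1)] .
    then show False using Qbar n0 mult_mat_vec_carrier[OF Cb x(1)] unfolding pos_def_def by (metis less_irrefl)
  qed
  have "x = 0\<^sub>v (n + l)" if x: "x \<in> carrier_vec (n + l)" "P *\<^sub>v x = 0\<^sub>v (n + l)" for x
  proof -
    have split: "\<exists>a \<in> carrier_vec n. y = a @\<^sub>v 0\<^sub>v l \<and> C *\<^sub>v a = 0\<^sub>v p"
      if y: "y \<in> carrier_vec (n + l)" "P *\<^sub>v y = 0\<^sub>v (n + l)" for y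
    proof -
      define a z where "a = vec_first y n" and "z = vec_last y l"
      have az: "a \<in> carrier_vec n" "z \<in> carrier_vec l" "y = a @\<^sub>v z"
        using y by (auto simp: a_def z_def)
      have "Cbar *\<^sub>v y = (C *\<^sub>v a + 0\<^sub>m p l *\<^sub>v z) @\<^sub>v (0\<^sub>m l n *\<^sub>v a + 1\<^sub>m l *\<^sub>v z)"
        unfolding Cbar_eq az(3) by (rule four_block_mat_mult_vec[of _ p n _ l _ l]) (use C az in auto)
      also have "0\<^sub>m l n *\<^sub>v a + 1\<^sub>m l *\<^sub>v z = z" using az by (auto intro!: eq_vecI)
      also have "C *\<^sub>v a + 0\<^sub>m p l *\<^sub>v z = C *\<^sub>v a" using az C by (auto intro!: eq_vecI)
      finally have "(C *\<^sub>v a) @\<^sub>v z = 0\<^sub>v p @\<^sub>v 0\<^sub>v l" using unseen[OF y] by (simp only: append_zero_vec)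
      then have "C *\<^sub>v a = 0\<^sub>v p \<and> z = 0\<^sub>v l"
        using append_vec_eq[of "C *\<^sub>v a" p "0\<^sub>v p" z "0\<^sub>v l"] C az by simp
      then show ?thesis using az by auto
    qed
    obtain a where a: "a \<in> carrier_vec n" "x = a @\<^sub>v 0\<^sub>v l" using split[OF x] by auto
    have orbit: "P *\<^sub>v (A ^\<^sub>m j *\<^sub>v a @\<^sub>v 0\<^sub>v l) = 0\<^sub>v (n + l) \<and> C *\<^sub>v (A ^\<^sub>m j *\<^sub>v a) = 0\<^sub>v p" for j
    proof (induction j)
      case 0
      have "A ^\<^sub>m 0 *\<^sub>v a = a" using a A by simp
      then show ?case using x split[OF x] a append_vec_eq[OF a(1)] by auto
    next
      case (Suc j)
      define c where "c = A ^\<^sub>m j *\<^sub>v a"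
      have c: "c \<in> carrier_vec n" unfolding c_def by (rule mult_mat_vec_carrier[OF pow_carrier_mat[OF A] a(1)])
      have "Y *\<^sub>v (c @\<^sub>v 0\<^sub>v l) = (A *\<^sub>v c + 0\<^sub>m n l *\<^sub>v 0\<^sub>v l) @\<^sub>v ((G2 * C) *\<^sub>v c + G1 *\<^sub>v 0\<^sub>v l)"
        unfolding Y_eq by (rule four_block_mat_mult_vec[of _ n n _ l _ l]) (use A G1 G2 C c in auto)
      also have "A *\<^sub>v c + 0\<^sub>m n l *\<^sub>v 0\<^sub>v l = A *\<^sub>v c" using A by (auto intro!: eq_vecI)
      also have "(G2 * C) *\<^sub>v c = G2 *\<^sub>v 0\<^sub>v p"
        using Suc G2 C c by (simp add: mat_vec_assoc c_def)
      also have "G2 *\<^sub>v 0\<^sub>v p + G1 *\<^sub>v 0\<^sub>v l = 0\<^sub>v l" using G1 G2 by (auto intro!: eq_vecI simp: scalar_prod_def)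
      also have "A *\<^sub>v c = A ^\<^sub>m Suc j *\<^sub>v a"
        unfolding pow_mat_Suc_left[OF A] c_def using A a by (simp add: mat_vec_assoc)
      finally have Yc: "Y *\<^sub>v (c @\<^sub>v 0\<^sub>v l) = (A ^\<^sub>m Suc j *\<^sub>v a) @\<^sub>v 0\<^sub>v l" .
      have "P *\<^sub>v (Y *\<^sub>v (c @\<^sub>v 0\<^sub>v l)) = 0\<^sub>v (n + l)"
        by (rule riccati_kernel(2)[OF P ric]) (use Suc c in \<open>auto simp: c_def\<close>)
      then have 1: "P *\<^sub>v (A ^\<^sub>m Suc j *\<^sub>v a @\<^sub>v 0\<^sub>v l) = 0\<^sub>v (n + l)" unfolding Yc .
      have 2: "A ^\<^sub>m Suc j *\<^sub>v a \<in> carrier_vec n" by (rule mult_mat_vec_carrier[OF pow_carrier_mat[OF A] a(1)])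
      then have "A ^\<^sub>m Suc j *\<^sub>v a @\<^sub>v 0\<^sub>v l \<in> carrier_vec (n + l)" by simp
      from split[OF this 1] show ?case using 1 append_vec_eq[OF 2] by auto
    qed
    then have "a = 0\<^sub>v n" by (intro observable_kernel[OF A C obs a(1)]) auto
    then show ?thesis using a by (simp add: append_zero_vec)
  qed
  moreover have "P *\<^sub>v x = 0\<^sub>v (n + l)" if "x \<in> carrier_vec (n + l)" "\<not> 0 < x \<bullet> (P *\<^sub>v x)" for x
    using that P by (intro psd_kernel[OF P]) (auto simp: pos_semidef_def not_less intro: antisym)
  ultimately show ?thesis using P unfolding pos_def_def pos_semidef_def by blast
qed

section \<open>Absolutely continuous functions\<close>

lemma primitive_continuous:
  fixes f f' :: "real \<Rightarrow> real"
  assumes "\<And>t. t \<in> {0..T} \<Longrightarrow> (f' has_integral (f t - f 0)) {0..t}"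
  shows "continuous_on {0..T} f"
proof (cases "0 \<le> T")
  case True
  then have int: "f' integrable_on {0..T}" using assms[of T] by auto
  have "continuous_on {0..T} (\<lambda>t. f 0 + integral {0..t} f')"
    by (intro continuous_intros indefinite_integral_continuous_1 int)
  moreover have "f 0 + integral {0..t} f' = f t" if "t \<in> {0..T}" for t
    using integral_unique[OF assms[OF that]] by simp
  ultimately show ?thesis by (rule continuous_on_eq)
qed simp

lemma primitive_increment:
  fixes f f' :: "real \<Rightarrow> real"
  assumes f: "\<And>t. t \<in> {0..T} \<Longrightarrow> (f' has_integral (f t - f 0)) {0..t}" and st: "0 \<le> s" "s \<le> t" "t \<le> T"
  shows "(f' has_integral (f t - f s)) {s..t}"
proof -
  have t: "(f' has_integral (f t - f 0)) {0..t}" and s: "(f' has_integral (f s - f 0)) {0..s}"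
    using f st by auto
  have int: "f' integrable_on {0..t}" using t by auto
  have "integral {0..s} f' + integral {s..t} f' = integral {0..t} f'"
    by (rule Henstock_Kurzweil_Integration.integral_combine[OF st(1,2) int])
  moreover have "f' integrable_on {s..t}"
    by (rule integrable_subinterval_real[OF int]) (use st in auto)
  ultimately show ?thesis using integral_unique[OF t] integral_unique[OF s] by (simp add: has_integral_iff)
qed

lemma abs_integrable_mult_continuous:
  fixes f g :: "real \<Rightarrow> real"
  assumes f: "f absolutely_integrable_on {a..b}" and g: "continuous_on {a..b} g"
  shows "(\<lambda>s. f s * g s) absolutely_integrable_on {a..b}"
proof -
  have "(\<lambda>s. g s * f s) absolutely_integrable_on {a..b}"
    by (rule absolutely_integrable_bounded_measurable_product_real[OF _ _ _ f])
      (use g in \<open>auto intro: continuous_imp_measurable_on_sets_lebesgue compact_imp_bounded compact_continuous_image\<close>)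
  then show ?thesis by (simp add: mult.commute)
qed

text \<open>The defect of the product rule over \<open>[s, t]\<close> is at most \<open>\<epsilon>\<close> times the variation once the
  oscillation of both factors is below \<open>\<epsilon>\<close>; add up over a fine partition.\<close>

lemma primitive_product_rule:
  fixes f g f' g' :: "real \<Rightarrow> real"
  assumes T: "0 \<le> T" and f': "f' absolutely_integrable_on {0..T}" and g': "g' absolutely_integrable_on {0..T}"
    and f: "\<And>t. t \<in> {0..T} \<Longrightarrow> (f' has_integral (f t - f 0)) {0..t}"
    and g: "\<And>t. t \<in> {0..T} \<Longrightarrow> (g' has_integral (g t - g 0)) {0..t}"
  shows "((\<lambda>s. f' s * g s + g' s * f s) has_integral (f T * g T - f 0 * g 0)) {0..T}"
proof -
  have cf: "continuous_on {0..T} f" by (rule primitive_continuous[OF f])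
  have cg: "continuous_on {0..T} g" by (rule primitive_continuous[OF g])
  define \<phi> where "\<phi> s = f' s * g s + g' s * f s" for s
  have "\<phi> absolutely_integrable_on {0..T}"
    unfolding \<phi>_def by (intro set_integral_add abs_integrable_mult_continuous f' g' cf cg)
  then have \<phi>: "\<phi> integrable_on {0..T}" by (simp add: absolutely_integrable_on_def)
  define h where "h t = f t * g t - integral {0..t} \<phi>" for t
  define v where "v s = \<bar>f' s\<bar> + \<bar>g' s\<bar>" for s
  have v: "v integrable_on {0..T}" unfolding v_def
    using f' g' by (intro integrable_add) (auto simp: absolutely_integrable_on_def)
  define G where "G t = integral {0..t} v" for t
  \<comment> \<open>Split \<open>f t * g t - f s * g s = (f t - f s) * g t + (g t - g s) * f s\<close>.\<close>
  have defect: "\<bar>h t - h s\<bar> \<le> \<epsilon> * (G t - G s)"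
    if st: "0 \<le> s" "s \<le> t" "t \<le> T"
      and osc: "\<And>r. r \<in> {s..t} \<Longrightarrow> \<bar>g t - g r\<bar> \<le> \<epsilon> \<and> \<bar>f s - f r\<bar> \<le> \<epsilon>" for s t \<epsilon>
  proof -
    have sub: "{s..t} \<subseteq> {0..T}" using st by auto
    have split: "integral {0..s} k + integral {s..t} k = integral {0..t} k" if "k integrable_on {0..T}" for k :: "real \<Rightarrow> real"
      by (rule Henstock_Kurzweil_Integration.integral_combine[OF st(1,2)])
        (use that st in \<open>auto intro: integrable_subinterval_real\<close>)
    have \<phi>st: "\<phi> integrable_on {s..t}" and vst: "v integrable_on {s..t}"
      using \<phi> v sub by (auto intro: integrable_subinterval_real)
    have "((\<lambda>r. f' r * g t + g' r * f s) has_integral ((f t - f s) * g t + (g t - g s) * f s)) {s..t}"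
      by (rule has_integral_add[OF has_integral_mult_left[OF primitive_increment[OF f st]]
            has_integral_mult_left[OF primitive_increment[OF g st]]])
    from has_integral_diff[OF this integrable_integral[OF \<phi>st]]
    have "((\<lambda>r. f' r * (g t - g r) + g' r * (f s - f r)) has_integral
        ((f t - f s) * g t + (g t - g s) * f s - integral {s..t} \<phi>)) {s..t}"
      by (rule has_integral_eq[rotated]) (simp add: \<phi>_def algebra_simps)
    moreover have "(f t - f s) * g t + (g t - g s) * f s - integral {s..t} \<phi> = h t - h s"
      using split[OF \<phi>] by (simp add: h_def algebra_simps)
    ultimately have hi: "((\<lambda>r. f' r * (g t - g r) + g' r * (f s - f r)) has_integral (h t - h s)) {s..t}" by simp
    have "norm (integral {s..t} (\<lambda>r. f' r * (g t - g r) + g' r * (f s - f r))) \<le> integral {s..t} (\<lambda>r. \<epsilon> * v r)"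
    proof (rule integral_norm_bound_integral)
      show "(\<lambda>r. f' r * (g t - g r) + g' r * (f s - f r)) integrable_on {s..t}" using hi by auto
      show "(\<lambda>r. \<epsilon> * v r) integrable_on {s..t}" using vst by (rule integrable_on_mult_right)
      fix r assume r: "r \<in> {s..t}"
      have "\<bar>f' r * (g t - g r)\<bar> \<le> \<bar>f' r\<bar> * \<epsilon>" "\<bar>g' r * (f s - f r)\<bar> \<le> \<bar>g' r\<bar> * \<epsilon>"
        unfolding abs_mult using osc[OF r] by (auto intro: mult_left_mono)
      then show "norm (f' r * (g t - g r) + g' r * (f s - f r)) \<le> \<epsilon> * v r"
        using abs_triangle_ineq[of "f' r * (g t - g r)" "g' r * (f s - f r)"] by (simp add: v_def algebra_simps)
    qed
    moreover have "G t - G s = integral {s..t} v" using split[OF v] by (simp add: G_def)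
    ultimately show ?thesis using integral_unique[OF hi] by simp
  qed
  have "\<bar>h T - h 0\<bar> \<le> \<epsilon> * G T" if \<epsilon>: "\<epsilon> > 0" for \<epsilon>
  proof -
    have "uniformly_continuous_on {0..T} f" "uniformly_continuous_on {0..T} g"
      using cf cg by (auto intro: compact_uniformly_continuous)
    then obtain d1 d2 where d: "d1 > 0" "d2 > 0"
      "\<And>x y. x \<in> {0..T} \<Longrightarrow> y \<in> {0..T} \<Longrightarrow> dist y x < d1 \<Longrightarrow> dist (f y) (f x) < \<epsilon>"
      "\<And>x y. x \<in> {0..T} \<Longrightarrow> y \<in> {0..T} \<Longrightarrow> dist y x < d2 \<Longrightarrow> dist (g y) (g x) < \<epsilon>"
      using \<epsilon> unfolding uniformly_continuous_on_def by metis
    obtain N :: nat where N: "T / min d1 d2 < real N" using reals_Archimedean2 by blast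
    moreover have "0 \<le> T / min d1 d2" using T d by simp
    ultimately have N0: "0 < real N" by linarith
    have "min d1 d2 > 0" using d by simp
    then have mesh: "T / real N < min d1 d2" using N N0 by (simp only: pos_divide_less_eq) (simp only: mult.commute)
    \<comment> \<open>An equidistant partition whose mesh is below both moduli of continuity.\<close>
    define t where "t k = real k * (T / real N)" for k
    have t_Suc: "t (Suc k) = t k + T / real N" for k by (simp add: t_def add_divide_distrib distrib_right)
    have t_range: "0 \<le> t k" "t k \<le> T" if "k \<le> N" for k
    proof -
      have "real k / real N \<le> 1" using that N0 by (simp add: field_simps)
      then have "T * (real k / real N) \<le> T * 1" using T by (intro mult_left_mono)
      then show "t k \<le> T" by (simp add: t_def mult.commute)
      show "0 \<le> t k" using T by (simp add: t_def)
    qed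
    have ends: "t 0 = 0" "t N = T" using N0 by (auto simp: t_def)
    have step: "\<bar>h (t (Suc k)) - h (t k)\<bar> \<le> \<epsilon> * (G (t (Suc k)) - G (t k))" if k: "k < N" for k
    proof (rule defect)
      show "0 \<le> t k" "t (Suc k) \<le> T" "t k \<le> t (Suc k)" using t_range[of k] t_range[of "Suc k"] k T by (auto simp: t_Suc)
      fix r assume r: "r \<in> {t k..t (Suc k)}"
      have "dist (t (Suc k)) r < min d1 d2" "dist (t k) r < min d1 d2"
        using r mesh by (auto simp: dist_real_def t_Suc)
      then have "dist (g (t (Suc k))) (g r) < \<epsilon>" "dist (f (t k)) (f r) < \<epsilon>"
        using r t_range[of k] t_range[of "Suc k"] k by (auto intro!: d(3,4))
      then show "\<bar>g (t (Suc k)) - g r\<bar> \<le> \<epsilon> \<and> \<bar>f (t k) - f r\<bar> \<le> \<epsilon>" by (auto simp: dist_real_def)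
    qed
    have "h T - h 0 = (\<Sum>k<N. h (t (Suc k)) - h (t k))" using ends sum_lessThan_telescope[of "\<lambda>k. h (t k)" N] by simp
    also have "\<bar>\<dots>\<bar> \<le> (\<Sum>k<N. \<bar>h (t (Suc k)) - h (t k)\<bar>)" by (rule sum_abs)
    also have "\<dots> \<le> (\<Sum>k<N. \<epsilon> * (G (t (Suc k)) - G (t k)))" using step by (intro sum_mono) auto
    also have "\<dots> = \<epsilon> * (G T - G 0)" using ends sum_lessThan_telescope[of "\<lambda>k. G (t k)" N] by (simp only: sum_distrib_left[symmetric])
    finally show ?thesis by (simp add: G_def)
  qed
  then have bound: "\<bar>h T - h 0\<bar> \<le> \<epsilon> * G T" if "\<epsilon> > 0" for \<epsilon> using that .
  have "h T - h 0 = 0"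
  proof (rule ccontr)
    assume n0: "h T - h 0 \<noteq> 0"
    then have pos: "\<bar>h T - h 0\<bar> > 0" by simp
    with bound[of 1] have G: "G T > 0" by linarith
    have "\<bar>h T - h 0\<bar> \<le> (\<bar>h T - h 0\<bar> / (2 * G T)) * G T" using pos G by (intro bound) auto
    with pos G show False by (simp add: field_simps)
  qed
  then have "integral {0..T} \<phi> = f T * g T - f 0 * g 0" by (simp add: h_def)
  then show ?thesis using \<phi> unfolding \<phi>_def by (simp add: has_integral_iff)
qed

text \<open>Monotone convergence along the intervals \<open>[0, n]\<close>. This links the cost, a Lebesgue integral over the
  half line, to the gauge integrals in which the state equation is stated.\<close>

lemma nn_integral_half_line:
  fixes q :: "real \<Rightarrow> real"
  assumes q: "\<And>t. 0 \<le> t \<Longrightarrow> 0 \<le> q t" and int: "\<And>T. 0 \<le> T \<Longrightarrow> q absolutely_integrable_on {0..T}"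
  shows "(\<integral>\<^sup>+t. ennreal (q t) \<partial>lebesgue_on {0..}) = (SUP n. ennreal (integral {0..real n} q))"
proof -
  have fin: "(\<integral>\<^sup>+t. ennreal (q t) * indicator {0..T} t \<partial>lebesgue) = ennreal (integral {0..T} q)" if T: "0 \<le> T" for T
  proof -
    have "(\<integral>\<^sup>+t. ennreal (q t) * indicator {0..T} t \<partial>lebesgue) = (\<integral>\<^sup>+t. ennreal (q t) \<partial>lebesgue_on {0..T})"
      by (simp add: nn_integral_restrict_space)
    also have "\<dots> = ennreal (integral\<^sup>L (lebesgue_on {0..T}) q)"
    proof (rule nn_integral_eq_integral)
      show "integrable (lebesgue_on {0..T}) q" by (rule absolutely_integrable_imp_integrable[OF int[OF T]]) simp
      show "AE t in lebesgue_on {0..T}. 0 \<le> q t" by (rule AE_I2) (simp add: q)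
    qed
    also have "integral\<^sup>L (lebesgue_on {0..T}) q = integral {0..T} q"
      using absolutely_integrable_imp_integrable[OF int[OF T]] by (intro lebesgue_integral_eq_integral) auto
    finally show ?thesis .
  qed
  define F where "F n t = ennreal (q t) * indicator {0..real n} t" for n t
  have meas: "F n \<in> borel_measurable lebesgue" for n
  proof -
    have "(\<lambda>t. indicator {0..real n} t *\<^sub>R q t) \<in> borel_measurable lebesgue"
      using int[of "real n"] by (simp add: set_integrable_def borel_measurable_integrable)
    then have "(\<lambda>t. ennreal (indicator {0..real n} t *\<^sub>R q t)) \<in> borel_measurable lebesgue" by measurable
    moreover have "ennreal (indicator {0..real n} t *\<^sub>R q t) = F n t" for t
      by (auto simp: F_def indicator_def)
    ultimately show ?thesis by simp
  qed
  have mono: "incseq F"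
    by (auto simp: F_def incseq_def le_fun_def indicator_def)
  have sup: "(SUP n. F n t) = ennreal (q t) * indicator {0..} t" for t
  proof (cases "0 \<le> t")
    case True
    obtain N :: nat where N: "t \<le> real N" using real_arch_simple by blast
    have "F n t \<le> ennreal (q t)" for n by (auto simp: F_def indicator_def)
    moreover have "F N t = ennreal (q t)" using N True by (simp add: F_def)
    ultimately have "(SUP n. F n t) = ennreal (q t)"
      by (intro antisym SUP_least) (auto intro: SUP_upper2[of N])
    then show ?thesis using True by simp
  qed (simp add: F_def)
  have "(\<integral>\<^sup>+t. ennreal (q t) \<partial>lebesgue_on {0..}) = (\<integral>\<^sup>+t. (SUP n. F n t) \<partial>lebesgue)"
    by (simp add: nn_integral_restrict_space sup)
  also have "\<dots> = (SUP n. \<integral>\<^sup>+t. F n t \<partial>lebesgue)"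
    using nn_integral_monotone_convergence_SUP[OF mono meas] by simp
  also have "\<dots> = (SUP n. ennreal (integral {0..real n} q))" by (simp add: F_def fin)
  finally show ?thesis .
qed

section \<open>Linear differential equations\<close>

lemma pow_mat_vec_bound:
  fixes A :: "real mat"
  assumes A: "A \<in> carrier_mat k k" and x: "x \<in> carrier_vec k"
  shows "\<exists>b c. \<forall>l. \<forall>i<k. \<bar>(A ^\<^sub>m l *\<^sub>v x) $ i\<bar> \<le> b * c ^ l"
proof -
  define b where "b = (\<Sum>j<k. \<bar>x $ j\<bar>)"
  define c where "c = (\<Sum>i<k. \<Sum>j<k. \<bar>A $$ (i, j)\<bar>)"
  have b0: "0 \<le> b" by (simp add: b_def sum_nonneg)
  have c0: "0 \<le> c" by (simp add: c_def sum_nonneg)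
  have "\<forall>i<k. \<bar>(A ^\<^sub>m l *\<^sub>v x) $ i\<bar> \<le> b * c ^ l" for l
  proof (induction l)
    case 0
    have "\<bar>x $ i\<bar> \<le> b" if "i < k" for i
      unfolding b_def by (rule member_le_sum) (use that in auto)
    then show ?case using A x by simp
  next
    case (Suc l)
    show ?case
    proof (intro allI impI)
      fix i assume i: "i < k"
      have "A ^\<^sub>m Suc l *\<^sub>v x = A *\<^sub>v (A ^\<^sub>m l *\<^sub>v x)"
        unfolding pow_mat_Suc_left[OF A] using A x by (simp add: mat_vec_assoc)
      then have "\<bar>(A ^\<^sub>m Suc l *\<^sub>v x) $ i\<bar> = \<bar>\<Sum>j<k. A $$ (i, j) * (A ^\<^sub>m l *\<^sub>v x) $ j\<bar>"
        using A i by (simp add: scalar_prod_def lessThan_atLeast0)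
      also have "\<dots> \<le> (\<Sum>j<k. \<bar>A $$ (i, j)\<bar> * \<bar>(A ^\<^sub>m l *\<^sub>v x) $ j\<bar>)"
        by (rule order_trans[OF sum_abs]) (simp add: abs_mult)
      also have "\<dots> \<le> (\<Sum>j<k. \<bar>A $$ (i, j)\<bar> * (b * c ^ l))"
        using Suc by (intro sum_mono mult_left_mono) auto
      also have "\<dots> = (\<Sum>j<k. \<bar>A $$ (i, j)\<bar>) * (b * c ^ l)" by (simp add: sum_distrib_right)
      also have "\<dots> \<le> c * (b * c ^ l)"
      proof (rule mult_right_mono)
        show "(\<Sum>j<k. \<bar>A $$ (i, j)\<bar>) \<le> c"
          unfolding c_def by (rule member_le_sum[of i _ "\<lambda>i. \<Sum>j<k. \<bar>A $$ (i, j)\<bar>"]) (use i in \<open>auto intro: sum_nonneg\<close>)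
      qed (use b0 c0 in simp)
      finally show "\<bar>(A ^\<^sub>m Suc l *\<^sub>v x) $ i\<bar> \<le> b * c ^ Suc l" by (simp add: mult_ac)
    qed
  qed
  then show ?thesis by blast
qed

text \<open>The exponential series \<open>\<Sum> A\<^sup>l x0 t\<^sup>l / l!\<close>, taken as one power series in \<open>t\<close> for each entry.\<close>

lemma linear_ode_solvable:
  fixes A :: "real mat"
  assumes A: "A \<in> carrier_mat k k" and x0: "x0 \<in> carrier_vec k"
  shows "\<exists>x. x 0 = x0 \<and> (\<forall>t. x t \<in> carrier_vec k) \<and>
    (\<forall>t. \<forall>i<k. ((\<lambda>t. x t $ i) has_real_derivative (A *\<^sub>v x t) $ i) (at t))"
proof -
  define a where "a i l = (A ^\<^sub>m l *\<^sub>v x0) $ i" for i l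
  define c where "c i l = a i l / fact l" for i l
  have summ: "summable (\<lambda>l. c i l * t ^ l)" if i: "i < k" for i t
  proof -
    obtain b m where bm: "\<And>l. \<bar>a i l\<bar> \<le> b * m ^ l" using pow_mat_vec_bound[OF A x0] i unfolding a_def by blast
    show ?thesis
    proof (rule summable_comparison_test')
      show "summable (\<lambda>l. b * (inverse (fact l) * (m * \<bar>t\<bar>) ^ l))"
        by (intro summable_mult summable_exp)
      fix l
      have "norm (c i l * t ^ l) = \<bar>a i l\<bar> * (\<bar>t\<bar> ^ l / fact l)" by (simp add: c_def abs_mult power_abs)
      also have "\<dots> \<le> (b * m ^ l) * (\<bar>t\<bar> ^ l / fact l)" by (intro mult_right_mono bm) auto
      finally show "norm (c i l * t ^ l) \<le> b * (inverse (fact l) * (m * \<bar>t\<bar>) ^ l)"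
        by (simp add: power_mult_distrib divide_inverse mult_ac)
    qed
  qed
  define x where "x t = vec k (\<lambda>i. \<Sum>l. c i l * t ^ l)" for t
  have rec: "diffs (c i) l = (\<Sum>j<k. A $$ (i, j) * c j l)" if i: "i < k" for i l
  proof -
    have "A ^\<^sub>m Suc l *\<^sub>v x0 = A *\<^sub>v (A ^\<^sub>m l *\<^sub>v x0)"
      unfolding pow_mat_Suc_left[OF A] using A x0 by (simp add: mat_vec_assoc)
    then have "a i (Suc l) = (\<Sum>j<k. A $$ (i, j) * a j l)"
      using A i by (simp add: a_def scalar_prod_def lessThan_atLeast0 del: pow_mat.simps)
    moreover have "diffs (c i) l = a i (Suc l) / fact l"
      by (simp add: diffs_def c_def del: of_nat_Suc)
    ultimately show ?thesis by (simp add: c_def sum_divide_distrib)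
  qed
  have deriv: "((\<lambda>t. x t $ i) has_real_derivative (A *\<^sub>v x t) $ i) (at t)" if i: "i < k" for t i
  proof -
    have "((\<lambda>t. \<Sum>l. c i l * t ^ l) has_real_derivative (\<Sum>l. diffs (c i) l * t ^ l)) (at t)"
      by (rule termdiffs_strong_converges_everywhere) (rule summ[OF i])
    also have "(\<Sum>l. diffs (c i) l * t ^ l) = (\<Sum>l. \<Sum>j<k. A $$ (i, j) * (c j l * t ^ l))"
      by (simp add: rec[OF i] sum_distrib_right mult.assoc)
    also have "\<dots> = (\<Sum>j<k. \<Sum>l. A $$ (i, j) * (c j l * t ^ l))"
      by (rule suminf_sum) (auto intro: summable_mult summ)
    also have "\<dots> = (\<Sum>j<k. A $$ (i, j) * (\<Sum>l. c j l * t ^ l))"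
      by (intro sum.cong refl suminf_mult summ) auto
    also have "\<dots> = (A *\<^sub>v x t) $ i"
      using A i by (simp add: x_def scalar_prod_def lessThan_atLeast0)
    finally show ?thesis using i by (simp add: x_def)
  qed
  have "x 0 = x0"
  proof (rule eq_vecI)
    fix i assume "i < dim_vec x0"
    then have i: "i < k" using x0 by simp
    have "(\<Sum>l. c i l * 0 ^ l) = c i 0" using powser_zero[of "c i"] by simp
    then show "x 0 $ i = x0 $ i" using i A x0 by (simp add: x_def c_def a_def)
  qed (use x0 in \<open>simp add: x_def\<close>)
  then show ?thesis using deriv by (intro exI[of _ x]) (auto simp: x_def)
qed

section \<open>Coercivity\<close>

lemma psd_cauchy_schwarz:
  assumes P: "pos_semidef k P" and x: "x \<in> carrier_vec k" and y: "y \<in> carrier_vec k"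
  shows "(x \<bullet> (P *\<^sub>v y))\<^sup>2 \<le> (x \<bullet> (P *\<^sub>v x)) * (y \<bullet> (P *\<^sub>v y))"
proof (cases "x \<bullet> (P *\<^sub>v x) = 0")
  case True
  have Pc: "P \<in> carrier_mat k k" "P\<^sup>T = P" using P by (auto simp: pos_semidef_def)
  have "x \<bullet> (P *\<^sub>v y) = y \<bullet> (P *\<^sub>v x)" by (rule scalar_prod_symmetric[OF Pc x y])
  also have "P *\<^sub>v x = 0\<^sub>v k" by (rule psd_kernel[OF P x True])
  finally show ?thesis using True y by simp
next
  case False
  have Pc: "P \<in> carrier_mat k k" "P\<^sup>T = P" using P by (auto simp: pos_semidef_def)
  define a b c where "a = x \<bullet> (P *\<^sub>v x)" and "b = x \<bullet> (P *\<^sub>v y)" and "c = y \<bullet> (P *\<^sub>v y)"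
  have sym: "y \<bullet> (P *\<^sub>v x) = b" unfolding b_def by (rule scalar_prod_symmetric[OF Pc y x])
  have a: "a > 0" using False P x unfolding a_def pos_semidef_def by (metis less_le)
  define t where "t = - b / a"
  have "0 \<le> (t \<cdot>\<^sub>v x + y) \<bullet> (P *\<^sub>v (t \<cdot>\<^sub>v x + y))" using P x y by (auto simp: pos_semidef_def)
  also have "(t \<cdot>\<^sub>v x + y) \<bullet> (P *\<^sub>v (t \<cdot>\<^sub>v x + y)) = t * t * a + 2 * t * b + c"
    using x y Pc(1) sym by (simp add: vec_algebra a_def b_def c_def algebra_simps)
  also have "t * t * a + 2 * t * b + c = c - b\<^sup>2 / a"
    using a by (simp add: t_def field_simps power2_eq_square)
  finally show ?thesis using a by (simp add: a_def[symmetric] b_def[symmetric] c_def[symmetric] field_simps)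
qed

lemma psd_one: "pos_semidef k (1\<^sub>m k)"
  by (auto simp: pos_semidef_def scalar_prod_def intro!: sum_nonneg)

lemma scalar_prod_cauchy_schwarz:
  fixes x y :: "real vec"
  assumes "x \<in> carrier_vec k" "y \<in> carrier_vec k"
  shows "(x \<bullet> y)\<^sup>2 \<le> (x \<bullet> x) * (y \<bullet> y)"
  using psd_cauchy_schwarz[OF psd_one assms] assms by simp

lemma scalar_prod_self_nonneg: "0 \<le> (x :: real vec) \<bullet> x"
  by (auto simp: scalar_prod_def intro!: sum_nonneg)

lemma scalar_prod_self_sum: "(x :: real vec) \<in> carrier_vec k \<Longrightarrow> x \<bullet> x = (\<Sum>i<k. (x $ i)\<^sup>2)"
  by (simp add: scalar_prod_def power2_eq_square lessThan_atLeast0)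

lemma mat_vec_bounded:
  fixes N :: "real mat"
  assumes N: "N \<in> carrier_mat r k"
  shows "\<exists>c \<ge> 0. \<forall>x \<in> carrier_vec k. (N *\<^sub>v x) \<bullet> (N *\<^sub>v x) \<le> c * (x \<bullet> x)"
proof (intro exI conjI ballI)
  let ?c = "\<Sum>i<r. row N i \<bullet> row N i"
  show "0 \<le> ?c" by (auto intro: sum_nonneg scalar_prod_self_nonneg)
  fix x :: "real vec" assume x: "x \<in> carrier_vec k"
  have "(N *\<^sub>v x) \<bullet> (N *\<^sub>v x) = (\<Sum>i<r. (row N i \<bullet> x)\<^sup>2)"
    using N scalar_prod_self_sum[of "N *\<^sub>v x" r] by (simp add: carrier_vecI)
  also have "\<dots> \<le> (\<Sum>i<r. (row N i \<bullet> row N i) * (x \<bullet> x))"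
    using N x by (intro sum_mono scalar_prod_cauchy_schwarz[of _ k]) auto
  finally show "(N *\<^sub>v x) \<bullet> (N *\<^sub>v x) \<le> ?c * (x \<bullet> x)" by (simp add: sum_distrib_right)
qed

text \<open>Write \<open>x\<^sub>i = e\<^sub>i \<bullet> x = (P\<^sup>-\<^sup>1 e\<^sub>i) \<bullet> P x\<close> and apply the Cauchy-Schwarz inequality of \<open>P\<close>.\<close>

lemma pos_def_coercive:
  assumes P: "pos_def k P"
  shows "\<exists>c \<ge> 0. \<forall>x \<in> carrier_vec k. x \<bullet> x \<le> c * (x \<bullet> (P *\<^sub>v x))"
proof (intro exI conjI ballI)
  have psd: "pos_semidef k P" by (rule pos_def_imp_psd[OF P])
  have Pc: "P \<in> carrier_mat k k" "P\<^sup>T = P" using P by (auto simp: pos_def_def)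
  note V = pos_def_inverse[OF P]
  define w where "w i = mat_inv P *\<^sub>v unit_vec k i" for i
  have w: "w i \<in> carrier_vec k" for i using V by (auto simp: w_def)
  have Pw: "P *\<^sub>v w i = unit_vec k i" for i
    unfolding w_def using Pc V by (simp add: mat_vec_assoc[symmetric])
  let ?c = "\<Sum>i<k. w i \<bullet> (P *\<^sub>v w i)"
  show "0 \<le> ?c" using psd w by (intro sum_nonneg) (auto simp: pos_semidef_def)
  fix x :: "real vec" assume x: "x \<in> carrier_vec k"
  have "x \<bullet> x = (\<Sum>i<k. (x $ i)\<^sup>2)" by (rule scalar_prod_self_sum[OF x])
  also have "\<dots> \<le> (\<Sum>i<k. (w i \<bullet> (P *\<^sub>v w i)) * (x \<bullet> (P *\<^sub>v x)))"
  proof (rule sum_mono)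
    fix i assume "i \<in> {..<k}"
    then have "x $ i = x \<bullet> (P *\<^sub>v w i)" unfolding Pw using x by simp
    also have "\<dots> = w i \<bullet> (P *\<^sub>v x)" by (rule scalar_prod_symmetric[OF Pc x w])
    finally show "(x $ i)\<^sup>2 \<le> (w i \<bullet> (P *\<^sub>v w i)) * (x \<bullet> (P *\<^sub>v x))"
      using psd_cauchy_schwarz[OF psd w x] by simp
  qed
  finally show "x \<bullet> x \<le> ?c * (x \<bullet> (P *\<^sub>v x))" by (simp add: sum_distrib_right)
qed

section \<open>Square-integrable functions\<close>

text \<open>Measurability is asked for \<open>f\<close> itself and not only for its square, since products of two such
  functions have to be measurable.\<close>

definition square_integrable :: "real \<Rightarrow> (real \<Rightarrow> real) \<Rightarrow> bool" where
  "square_integrable T f \<longleftrightarrow> f \<in> borel_measurable (lebesgue_on {0..T}) \<and>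
     (\<lambda>t. (f t)\<^sup>2) absolutely_integrable_on {0..T}"

lemma abs_integrable_cong:
  fixes f g :: "real \<Rightarrow> real"
  assumes "\<And>t. t \<in> {0..T} \<Longrightarrow> f t = g t"
  shows "f absolutely_integrable_on {0..T} \<longleftrightarrow> g absolutely_integrable_on {0..T}"
  by (rule set_integrable_cong) (use assms in auto)

lemma square_integrable_cong:
  assumes "\<And>t. t \<in> {0..T} \<Longrightarrow> f t = g t"
  shows "square_integrable T f \<longleftrightarrow> square_integrable T g"
proof -
  have "f \<in> borel_measurable (lebesgue_on {0..T}) \<longleftrightarrow> g \<in> borel_measurable (lebesgue_on {0..T})"
    by (rule measurable_cong) (simp add: assms)
  moreover have "(\<lambda>t. (f t)\<^sup>2) absolutely_integrable_on {0..T} \<longleftrightarrow> (\<lambda>t. (g t)\<^sup>2) absolutely_integrable_on {0..T}"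
    by (rule abs_integrable_cong) (simp add: assms)
  ultimately show ?thesis by (simp add: square_integrable_def)
qed

lemma square_integrable_prod:
  assumes f: "square_integrable T f" and g: "square_integrable T g"
  shows "(\<lambda>t. f t * g t) absolutely_integrable_on {0..T}"
proof (rule measurable_bounded_by_integrable_imp_absolutely_integrable)
  show "(\<lambda>t. f t * g t) \<in> borel_measurable (lebesgue_on {0..T})"
    using f g by (auto simp: square_integrable_def)
  show "(\<lambda>t. (f t)\<^sup>2 + (g t)\<^sup>2) integrable_on {0..T}"
    using f g by (intro integrable_add) (auto simp: square_integrable_def absolutely_integrable_on_def)
  show "norm (f t * g t) \<le> (f t)\<^sup>2 + (g t)\<^sup>2" for t
  proof -
    have "2 * (\<bar>f t\<bar> * \<bar>g t\<bar>) \<le> (f t)\<^sup>2 + (g t)\<^sup>2"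
      using sum_squares_bound[of "\<bar>f t\<bar>" "\<bar>g t\<bar>"] by (simp only: power2_abs mult.assoc)
    moreover have "0 \<le> \<bar>f t\<bar> * \<bar>g t\<bar>" by simp
    ultimately show ?thesis unfolding real_norm_def abs_mult by linarith
  qed
qed simp

lemma square_integrable_scale: "square_integrable T f \<Longrightarrow> square_integrable T (\<lambda>t. c * f t)"
  by (auto simp: square_integrable_def power_mult_distrib)

lemma square_integrable_add:
  assumes f: "square_integrable T f" and g: "square_integrable T g"
  shows "square_integrable T (\<lambda>t. f t + g t)"
proof -
  have "(\<lambda>t. (f t)\<^sup>2 + 2 * (f t * g t) + (g t)\<^sup>2) absolutely_integrable_on {0..T}"
    using square_integrable_prod[OF f g] f g
    by (intro set_integral_add set_integrable_mult_right) (auto simp: square_integrable_def)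
  then have "(\<lambda>t. (f t + g t)\<^sup>2) absolutely_integrable_on {0..T}"
    by (simp add: power2_sum algebra_simps)
  then show ?thesis using f g by (auto simp: square_integrable_def)
qed

lemma square_integrable_zero: "square_integrable T (\<lambda>t. 0)"
  by (simp add: square_integrable_def)

lemma square_integrable_sum:
  "finite I \<Longrightarrow> (\<And>i. i \<in> I \<Longrightarrow> square_integrable T (f i)) \<Longrightarrow> square_integrable T (\<lambda>t. \<Sum>i\<in>I. f i t)"
  by (induction I rule: finite_induct) (auto intro: square_integrable_add square_integrable_zero)

lemma square_integrable_continuous:
  assumes "continuous_on {0..T} f"
  shows "square_integrable T f"
  unfolding square_integrable_def
  using assms by (auto intro!: continuous_imp_measurable_on_sets_lebesgue absolutely_integrable_continuous_real continuous_intros)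

definition vec_square_integrable :: "nat \<Rightarrow> real \<Rightarrow> (real \<Rightarrow> real vec) \<Rightarrow> bool" where
  "vec_square_integrable k T v \<longleftrightarrow> (\<forall>t \<in> {0..T}. v t \<in> carrier_vec k) \<and> (\<forall>i < k. square_integrable T (\<lambda>t. v t $ i))"

lemma vec_square_integrable_dim: "vec_square_integrable k T v \<Longrightarrow> t \<in> {0..T} \<Longrightarrow> dim_vec (v t) = k"
  unfolding vec_square_integrable_def by (metis carrier_vecD)

lemma vec_square_integrable_mult:
  assumes N: "N \<in> carrier_mat r k" and v: "vec_square_integrable k T v"
  shows "vec_square_integrable r T (\<lambda>t. N *\<^sub>v v t)"
  unfolding vec_square_integrable_def
proof (intro conjI ballI allI impI)
  fix i assume i: "i < r"
  have "square_integrable T (\<lambda>t. \<Sum>j<k. N $$ (i, j) * v t $ j)"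
    using v by (intro square_integrable_sum square_integrable_scale) (auto simp: vec_square_integrable_def)
  also have "?this \<longleftrightarrow> square_integrable T (\<lambda>t. (N *\<^sub>v v t) $ i)"
  proof (rule square_integrable_cong)
    fix t assume "t \<in> {0..T}"
    then have "v t \<in> carrier_vec k" using v by (simp add: vec_square_integrable_def)
    then show "(\<Sum>j<k. N $$ (i, j) * v t $ j) = (N *\<^sub>v v t) $ i"
      using N i by (simp add: scalar_prod_def lessThan_atLeast0)
  qed
  finally show "square_integrable T (\<lambda>t. (N *\<^sub>v v t) $ i)" .
qed (use N v in \<open>auto simp: vec_square_integrable_def\<close>)

lemma vec_square_integrable_add:
  assumes v: "vec_square_integrable k T v" and w: "vec_square_integrable k T w"
  shows "vec_square_integrable k T (\<lambda>t. v t + w t)"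
  unfolding vec_square_integrable_def
proof (intro conjI ballI allI impI)
  fix i assume i: "i < k"
  have "square_integrable T (\<lambda>t. v t $ i + w t $ i)"
    using v w i by (intro square_integrable_add) (auto simp: vec_square_integrable_def)
  also have "?this \<longleftrightarrow> square_integrable T (\<lambda>t. (v t + w t) $ i)"
    using i vec_square_integrable_dim[OF w] by (intro square_integrable_cong) simp
  finally show "square_integrable T (\<lambda>t. (v t + w t) $ i)" .
qed (use v w in \<open>auto simp: vec_square_integrable_def\<close>)

lemma vec_square_integrable_scalar_prod:
  assumes v: "vec_square_integrable k T v" and w: "vec_square_integrable k T w"
  shows "(\<lambda>t. v t \<bullet> w t) absolutely_integrable_on {0..T}"
proof -
  have "(\<lambda>t. \<Sum>i<k. v t $ i * w t $ i) absolutely_integrable_on {0..T}"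
    using v w by (intro absolutely_integrable_sum square_integrable_prod) (auto simp: vec_square_integrable_def)
  also have "?this \<longleftrightarrow> (\<lambda>t. v t \<bullet> w t) absolutely_integrable_on {0..T}"
    using vec_square_integrable_dim[OF w] by (intro abs_integrable_cong) (simp add: scalar_prod_def lessThan_atLeast0)
  finally show ?thesis .
qed

lemma bilinear_sum:
  fixes P :: "real mat"
  assumes "P \<in> carrier_mat k k" "a \<in> carrier_vec k" "b \<in> carrier_vec k"
  shows "a \<bullet> (P *\<^sub>v b) = (\<Sum>i<k. \<Sum>j<k. P $$ (i, j) * (a $ i * b $ j))"
  using assms by (simp add: scalar_prod_def lessThan_atLeast0 sum_distrib_left mult_ac)

section \<open>The linear-quadratic regulator\<close>

context lq
begin

abbreviation rate :: "(real \<Rightarrow> real vec) \<Rightarrow> (real \<Rightarrow> real vec) \<Rightarrow> real \<Rightarrow> real" where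
  "rate x u t \<equiv> x t \<bullet> (Q *\<^sub>v x t) + u t \<bullet> (R *\<^sub>v u t)"

abbreviation velocity :: "(real \<Rightarrow> real vec) \<Rightarrow> (real \<Rightarrow> real vec) \<Rightarrow> real \<Rightarrow> real vec" where
  "velocity x u t \<equiv> Y *\<^sub>v x t + J *\<^sub>v u t"

lemma admissible_carrier:
  assumes "lqr_admissible Y J x0 x u" "0 \<le> t"
  shows "x t \<in> carrier_vec k" "u t \<in> carrier_vec m"
  using assms by (auto simp: lqr_admissible_def lqr_input_def dims)

lemma admissible_primitive:
  assumes "lqr_admissible Y J x0 x u" "0 \<le> t" "i < k"
  shows "((\<lambda>s. velocity x u s $ i) has_integral (x t $ i - x 0 $ i)) {0..t}"
  using assms by (auto simp: lqr_admissible_def dims)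

lemma admissible_continuous:
  assumes adm: "lqr_admissible Y J x0 x u" and i: "i < k"
  shows "continuous_on {0..T} (\<lambda>t. x t $ i)"
  by (rule primitive_continuous[of T "\<lambda>s. velocity x u s $ i"]) (use admissible_primitive[OF adm _ i] in auto)

lemma admissible_square_integrable:
  assumes adm: "lqr_admissible Y J x0 x u" and T: "0 \<le> T"
  shows "vec_square_integrable k T x" "vec_square_integrable m T u"
proof -
  show "vec_square_integrable k T x"
    using admissible_carrier(1)[OF adm] admissible_continuous[OF adm]
    by (auto simp: vec_square_integrable_def intro: square_integrable_continuous)
  have inp: "lqr_input m u" using adm by (simp add: lqr_admissible_def dims)
  have "square_integrable T (\<lambda>t. u t $ i)" if i: "i < m" for i
    unfolding square_integrable_def
  proof
    have "(\<lambda>t. u t $ i) \<in> borel_measurable (lebesgue_on {0..})" using inp i by (simp add: lqr_input_def)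
    then show "(\<lambda>t. u t $ i) \<in> borel_measurable (lebesgue_on {0..T})"
      by (rule measurable_restrict_mono) auto
    have "integrable (lebesgue_on {0..T}) (\<lambda>t. (u t $ i)\<^sup>2)" using inp i T by (simp add: lqr_input_def)
    then show "(\<lambda>t. (u t $ i)\<^sup>2) absolutely_integrable_on {0..T}"
      by (simp add: integrable_restrict_space set_integrable_def)
  qed
  then show "vec_square_integrable m T u"
    using admissible_carrier(2)[OF adm] by (auto simp: vec_square_integrable_def)
qed

lemma velocity_square_integrable:
  assumes adm: "lqr_admissible Y J x0 x u" and T: "0 \<le> T"
  shows "vec_square_integrable k T (velocity x u)"
  by (intro vec_square_integrable_add vec_square_integrable_mult[OF Y] vec_square_integrable_mult[OF J]
      admissible_square_integrable[OF adm T])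

lemma rate_integrable:
  assumes adm: "lqr_admissible Y J x0 x u" and T: "0 \<le> T"
  shows "rate x u absolutely_integrable_on {0..T}"
  by (intro set_integral_add vec_square_integrable_scalar_prod[of k] vec_square_integrable_scalar_prod[of m]
      vec_square_integrable_mult[OF Q_carrier(1)] vec_square_integrable_mult[OF R_carrier(1)]
      admissible_square_integrable[OF adm T])

lemma rate_nonneg:
  assumes adm: "lqr_admissible Y J x0 x u" and t: "0 \<le> t"
  shows "0 \<le> rate x u t" "0 \<le> x t \<bullet> (Q *\<^sub>v x t)" "0 \<le> u t \<bullet> (R *\<^sub>v u t)"
  using Q pos_def_imp_psd[OF R] admissible_carrier[OF adm t] by (auto simp: pos_semidef_def)

text \<open>The state is only absolutely continuous, so the form is differentiated entry by entry with the
  product rule for primitives.\<close>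

lemma quadratic_primitive:
  assumes adm: "lqr_admissible Y J x0 x u" and T: "0 \<le> T" and P: "P \<in> carrier_mat k k" "P\<^sup>T = P"
  shows "((\<lambda>t. 2 * (velocity x u t \<bullet> (P *\<^sub>v x t))) has_integral (x T \<bullet> (P *\<^sub>v x T) - x 0 \<bullet> (P *\<^sub>v x 0))) {0..T}"
proof -
  let ?v = "velocity x u"
  have v: "(\<lambda>t. ?v t $ i) absolutely_integrable_on {0..T}" if "i < k" for i
  proof -
    have "square_integrable T (\<lambda>t. ?v t $ i)"
      using velocity_square_integrable[OF adm T] that by (simp add: vec_square_integrable_def)
    from square_integrable_prod[OF this square_integrable_continuous[OF continuous_on_const[of _ 1]]]
    show ?thesis by simp
  qed
  have hi: "((\<lambda>t. \<Sum>i<k. \<Sum>j<k. P $$ (i, j) * (?v t $ i * x t $ j + ?v t $ j * x t $ i)) has_integral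
      (\<Sum>i<k. \<Sum>j<k. P $$ (i, j) * (x T $ i * x T $ j - x 0 $ i * x 0 $ j))) {0..T}"
    by (intro has_integral_sum has_integral_mult_right primitive_product_rule T v)
      (auto intro!: admissible_primitive[OF adm])
  have val: "(\<Sum>i<k. \<Sum>j<k. P $$ (i, j) * (x T $ i * x T $ j - x 0 $ i * x 0 $ j)) =
      x T \<bullet> (P *\<^sub>v x T) - x 0 \<bullet> (P *\<^sub>v x 0)"
    using admissible_carrier(1)[OF adm] T
    by (simp add: bilinear_sum[OF P(1)] right_diff_distrib sum_subtractf)
  have "(\<Sum>i<k. \<Sum>j<k. P $$ (i, j) * (?v t $ i * x t $ j + ?v t $ j * x t $ i)) = 2 * (?v t \<bullet> (P *\<^sub>v x t))"
    if t: "t \<in> {0..T}" for t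
  proof -
    have xt: "x t \<in> carrier_vec k" and vt: "?v t \<in> carrier_vec k"
      using admissible_carrier[OF adm, of t] t by (auto simp: dims intro: carrier_vecI)
    have "(\<Sum>i<k. \<Sum>j<k. P $$ (i, j) * (?v t $ i * x t $ j + ?v t $ j * x t $ i)) =
        ?v t \<bullet> (P *\<^sub>v x t) + x t \<bullet> (P *\<^sub>v ?v t)"
      unfolding bilinear_sum[OF P(1) xt vt] bilinear_sum[OF P(1) vt xt]
      by (simp only: distrib_left sum.distrib mult.commute[of "x t $ _"])
    then show ?thesis using scalar_prod_symmetric[OF P xt vt] by simp
  qed
  from has_integral_eq[OF this hi] show ?thesis unfolding val .
qed

text \<open>Along any trajectory, the derivative of \<open>x \<bullet> P x\<close> cancels the running cost up to the square of the
  deviation from the feedback law: write \<open>u = K x + d\<close> and use the Lyapunov form of the Riccati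
  equation.\<close>

lemma completion_of_squares:
  assumes adm: "lqr_admissible Y J x0 x u" and t: "0 \<le> t"
    and P: "P \<in> carrier_mat k k" "P\<^sup>T = P" and ric: "riccati Y J Q R P"
  defines "d \<equiv> u t - gain P *\<^sub>v x t"
  shows "2 * (velocity x u t \<bullet> (P *\<^sub>v x t)) = d \<bullet> (R *\<^sub>v d) - rate x u t"
proof -
  define K where "K = gain P"
  have K: "K \<in> carrier_mat m k" using gain_carrier P by (simp add: K_def)
  define y where "y = x t"
  have y: "y \<in> carrier_vec k" and u: "u t \<in> carrier_vec m"
    using admissible_carrier[OF adm t] by (auto simp: y_def)
  define w where "w = K *\<^sub>v y"
  have w: "w \<in> carrier_vec m" using K y by (auto simp: w_def)
  have d: "d \<in> carrier_vec m" unfolding d_def using u w by (auto simp: w_def K_def y_def)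
  note dd = dims carrier_matD[OF P(1)] carrier_matD[OF K]
  have ud: "u t = d + w" unfolding d_def w_def K_def y_def using u w
    by (intro eq_vecI) (use carrier_matD[OF K] in \<open>auto simp: w_def K_def y_def simp del: index_mult_mat_vec\<close>)
  let ?A = "Y + J * K"
  have A: "?A \<in> carrier_mat k k" using Y J K by auto
  have vel: "velocity x u t = ?A *\<^sub>v y + J *\<^sub>v d"
    unfolding ud y_def[symmetric] w_def using y d dd
    by (simp add: mat_vec_distrib mat_vec_assoc) (auto intro!: eq_vecI simp del: index_mult_mat_vec)
  have "2 * ((?A *\<^sub>v y) \<bullet> (P *\<^sub>v y)) = y \<bullet> ((?A\<^sup>T * P + P * ?A) *\<^sub>v y)"
    by (rule lyapunov_quadratic[OF A P y, symmetric])
  also have "?A\<^sup>T * P + P * ?A = - (Q + K\<^sup>T * R * K)"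
    using riccati_iff_lyapunov[OF P] ric dd by (simp add: K_def mat_assoc)
  also have "y \<bullet> (- (Q + K\<^sup>T * R * K) *\<^sub>v y) = - (y \<bullet> (Q *\<^sub>v y)) - y \<bullet> (K\<^sup>T * R * K *\<^sub>v y)"
    using y dd by (simp add: mat_vec_distrib(1,7) scalar_prod_linear(1,8))
  also have "y \<bullet> (K\<^sup>T * R * K *\<^sub>v y) = w \<bullet> (R *\<^sub>v w)"
    unfolding w_def by (rule quadratic_congruence[OF R_carrier(1) K y])
  finally have 1: "2 * ((?A *\<^sub>v y) \<bullet> (P *\<^sub>v y)) = - (y \<bullet> (Q *\<^sub>v y)) - w \<bullet> (R *\<^sub>v w)" .
  have "(J *\<^sub>v d) \<bullet> (P *\<^sub>v y) = d \<bullet> (J\<^sup>T *\<^sub>v (P *\<^sub>v y))"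
    using scalar_prod_transpose[of "J\<^sup>T" "P *\<^sub>v y" d] d dd by simp
  also have "J\<^sup>T *\<^sub>v (P *\<^sub>v y) = (J\<^sup>T * P) *\<^sub>v y" using y dd by (simp add: mat_vec_assoc)
  also have "J\<^sup>T * P = - (R * K)" using R_gain[OF P(1)] P by (simp add: K_def)
  also have "- (R * K) *\<^sub>v y = - (R *\<^sub>v w)" using y dd by (simp add: mat_vec_distrib mat_vec_assoc w_def)
  finally have 2: "(J *\<^sub>v d) \<bullet> (P *\<^sub>v y) = - (d \<bullet> (R *\<^sub>v w))" using d dd by (simp add: scalar_prod_linear)
  have "velocity x u t \<bullet> (P *\<^sub>v y) = (?A *\<^sub>v y) \<bullet> (P *\<^sub>v y) + (J *\<^sub>v d) \<bullet> (P *\<^sub>v y)"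
    unfolding vel using dd by (simp add: scalar_prod_linear(3))
  with 1 2 have lhs: "2 * (velocity x u t \<bullet> (P *\<^sub>v y)) = - (y \<bullet> (Q *\<^sub>v y)) - w \<bullet> (R *\<^sub>v w) - 2 * (d \<bullet> (R *\<^sub>v w))"
    by simp
  have "w \<bullet> (R *\<^sub>v d) = d \<bullet> (R *\<^sub>v w)" by (rule scalar_prod_symmetric[OF R_carrier w d])
  then have "u t \<bullet> (R *\<^sub>v u t) = d \<bullet> (R *\<^sub>v d) + 2 * (d \<bullet> (R *\<^sub>v w)) + w \<bullet> (R *\<^sub>v w)"
    unfolding ud using d w dd by (simp add: vec_algebra)
  with lhs show ?thesis by (simp add: y_def)
qed

text \<open>The completed square, integrated over \<open>[0, T]\<close>. It holds for every symmetric solution of the Riccati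
  equation and every trajectory.\<close>

lemma cost_identity:
  assumes adm: "lqr_admissible Y J x0 x u" and T: "0 \<le> T"
    and P: "P \<in> carrier_mat k k" "P\<^sup>T = P" and ric: "riccati Y J Q R P"
  defines "e \<equiv> \<lambda>t. (u t - gain P *\<^sub>v x t) \<bullet> (R *\<^sub>v (u t - gain P *\<^sub>v x t))"
  shows "e absolutely_integrable_on {0..T}"
    and "integral {0..T} (rate x u) + x T \<bullet> (P *\<^sub>v x T) = x0 \<bullet> (P *\<^sub>v x0) + integral {0..T} e"
proof -
  have x0: "x 0 = x0" using adm by (simp add: lqr_admissible_def)
  have K: "- gain P \<in> carrier_mat m k" using gain_carrier[OF P(1)] by simp
  let ?d = "\<lambda>t. u t + (- gain P) *\<^sub>v x t"
  have d: "vec_square_integrable m T ?d"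
    by (intro vec_square_integrable_add vec_square_integrable_mult[OF K] admissible_square_integrable[OF adm T])
  have eq: "?d t = u t - gain P *\<^sub>v x t" if "0 \<le> t" for t
    using admissible_carrier[OF adm that] gain_carrier[OF P(1)]
    by (simp add: mat_vec_distrib) (auto intro!: eq_vecI simp del: index_mult_mat_vec)
  have "(\<lambda>t. ?d t \<bullet> (R *\<^sub>v ?d t)) absolutely_integrable_on {0..T}"
    by (intro vec_square_integrable_scalar_prod[of m] vec_square_integrable_mult[OF R_carrier(1)] d)
  also have "?this \<longleftrightarrow> e absolutely_integrable_on {0..T}"
    unfolding e_def by (rule abs_integrable_cong) (simp add: eq)
  finally show e: "e absolutely_integrable_on {0..T}" .
  have rate: "rate x u absolutely_integrable_on {0..T}" by (rule rate_integrable[OF adm T])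
  have "((\<lambda>t. e t - rate x u t) has_integral (x T \<bullet> (P *\<^sub>v x T) - x 0 \<bullet> (P *\<^sub>v x 0))) {0..T}"
  proof (rule has_integral_eq[OF _ quadratic_primitive[OF adm T P]])
    show "2 * (velocity x u t \<bullet> (P *\<^sub>v x t)) = e t - rate x u t" if "t \<in> {0..T}" for t
      unfolding e_def using that by (intro completion_of_squares[OF adm _ P ric]) auto
  qed
  then have "integral {0..T} (\<lambda>t. e t - rate x u t) = x T \<bullet> (P *\<^sub>v x T) - x 0 \<bullet> (P *\<^sub>v x 0)"
    by (rule integral_unique)
  moreover have "integral {0..T} (\<lambda>t. e t - rate x u t) = integral {0..T} e - integral {0..T} (rate x u)"
    using e rate by (intro Henstock_Kurzweil_Integration.integral_diff) (auto simp: absolutely_integrable_on_def)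
  ultimately show "integral {0..T} (rate x u) + x T \<bullet> (P *\<^sub>v x T) = x0 \<bullet> (P *\<^sub>v x0) + integral {0..T} e"
    unfolding x0 by linarith
qed

lemma closed_loop_exists:
  assumes K: "K \<in> carrier_mat m k" and x0: "x0 \<in> carrier_vec k"
  shows "\<exists>x u. lqr_admissible Y J x0 x u \<and> (\<forall>t \<ge> 0. u t = K *\<^sub>v x t)"
proof -
  have A: "Y + J * K \<in> carrier_mat k k" using Y J K by auto
  from linear_ode_solvable[OF A x0] obtain x where x: "x 0 = x0" "\<And>t. x t \<in> carrier_vec k"
    and deriv: "\<And>t i. i < k \<Longrightarrow> ((\<lambda>t. x t $ i) has_real_derivative ((Y + J * K) *\<^sub>v x t) $ i) (at t)" by auto
  define u where "u t = K *\<^sub>v x t" for t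
  have u: "u t \<in> carrier_vec m" for t using K x by (simp add: u_def)
  have vel: "(Y + J * K) *\<^sub>v x t = Y *\<^sub>v x t + J *\<^sub>v u t" for t
    using x(2)[of t] K dims by (simp add: u_def mat_vec_distrib mat_vec_assoc)
  have cx: "continuous_on S (\<lambda>t. x t $ i)" if "i < k" for i S
    using deriv[OF that] by (intro DERIV_continuous_on) (auto intro: DERIV_subset)
  have cu: "continuous_on S (\<lambda>t. u t $ i)" if i: "i < m" for i S
  proof -
    have "u t $ i = (\<Sum>j<k. K $$ (i, j) * x t $ j)" for t
      using x(2)[of t] K i by (simp add: u_def scalar_prod_def lessThan_atLeast0)
    then show ?thesis by (simp only:) (intro continuous_intros cx; simp)
  qed
  have "lqr_input m u"
    unfolding lqr_input_def
  proof (intro conjI allI impI u)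
    fix i assume i: "i < m"
    show "(\<lambda>t. u t $ i) \<in> borel_measurable (lebesgue_on {0..})"
      by (intro continuous_imp_measurable_on_sets_lebesgue cu i) auto
    fix T :: real assume "0 \<le> T"
    have "(\<lambda>t. (u t $ i)\<^sup>2) absolutely_integrable_on {0..T}"
      by (intro absolutely_integrable_continuous_real continuous_intros cu i)
    then show "integrable (lebesgue_on {0..T}) (\<lambda>t. (u t $ i)\<^sup>2)"
      by (rule absolutely_integrable_imp_integrable) auto
  qed
  moreover have "((\<lambda>s. (Y *\<^sub>v x s + J *\<^sub>v u s) $ i) has_integral (x t $ i - x0 $ i)) {0..t}"
    if "0 \<le> t" "i < k" for t i
  proof -
    have "((\<lambda>s. ((Y + J * K) *\<^sub>v x s) $ i) has_integral (x t $ i - x 0 $ i)) {0..t}"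
      using that deriv[OF that(2)]
      by (intro fundamental_theorem_of_calculus)
        (auto simp: has_real_derivative_iff_has_vector_derivative[symmetric] intro: DERIV_subset)
    then show ?thesis by (simp only: vel x(1))
  qed
  ultimately have "lqr_admissible Y J x0 x u" using x dims by (simp add: lqr_admissible_def)
  then show ?thesis by (intro exI[of _ x] exI[of _ u]) (simp add: u_def)
qed

lemma cost_SUP:
  assumes adm: "lqr_admissible Y J x0 x u"
  shows "lqr_cost Q R x u = (SUP n. ennreal (integral {0..real n} (rate x u)))"
  unfolding lqr_cost_def
  by (rule nn_integral_half_line) (use rate_nonneg(1)[OF adm] rate_integrable[OF adm] in auto)

lemma rate_integral_mono:
  assumes adm: "lqr_admissible Y J x0 x u" and "0 \<le> S" "S \<le> T"
  shows "integral {0..S} (rate x u) \<le> integral {0..T} (rate x u)"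
  using assms rate_integrable[OF adm] rate_nonneg(1)[OF adm]
  by (intro integral_subset_le) (auto simp: absolutely_integrable_on_def)

lemma cost_ge:
  assumes adm: "lqr_admissible Y J x0 x u" and T: "0 \<le> T"
  shows "ennreal (integral {0..T} (rate x u)) \<le> lqr_cost Q R x u"
proof -
  obtain n :: nat where "T \<le> real n" using real_arch_simple by blast
  then have "integral {0..T} (rate x u) \<le> integral {0..real n} (rate x u)"
    by (intro rate_integral_mono[OF adm T])
  then show ?thesis unfolding cost_SUP[OF adm] by (intro SUP_upper2[of n]) (auto intro: ennreal_leI)
qed

lemma cost_le:
  assumes adm: "lqr_admissible Y J x0 x u" and "\<And>T. 0 \<le> T \<Longrightarrow> integral {0..T} (rate x u) \<le> c"
  shows "lqr_cost Q R x u \<le> ennreal c"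
  unfolding cost_SUP[OF adm] by (intro SUP_least ennreal_leI) (use assms(2) in auto)

text \<open>Without deviation the cost up to \<open>T\<close> is the initial value of the form minus its terminal value.\<close>

lemma feedback_cost_le:
  assumes adm: "lqr_admissible Y J x0 x u" and P: "pos_semidef k P" and ric: "riccati Y J Q R P"
    and fb: "AE t in lebesgue_on {0..}. u t = gain P *\<^sub>v x t"
  shows "lqr_cost Q R x u \<le> ennreal (x0 \<bullet> (P *\<^sub>v x0))"
proof (rule cost_le[OF adm])
  fix T :: real assume T: "0 \<le> T"
  have Pc: "P \<in> carrier_mat k k" "P\<^sup>T = P" using P by (auto simp: pos_semidef_def)
  let ?e = "\<lambda>t. (u t - gain P *\<^sub>v x t) \<bullet> (R *\<^sub>v (u t - gain P *\<^sub>v x t))"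
  have "AE t in lebesgue. t \<in> {0..} \<longrightarrow> u t = gain P *\<^sub>v x t"
    using fb by (simp add: AE_restrict_space_iff)
  then obtain N where N: "N \<in> null_sets lebesgue"
    "{t \<in> space lebesgue. \<not> (t \<in> {0..} \<longrightarrow> u t = gain P *\<^sub>v x t)} \<subseteq> N"
    unfolding eventually_ae_filter by blast
  have "(?e has_integral 0) {0..T}"
  proof (rule has_integral_spike[of N])
    show "negligible N" using N(1) by (simp add: negligible_iff_null_sets)
    fix t assume t: "t \<in> {0..T} - N"
    then have ut: "u t = gain P *\<^sub>v x t" using N(2) by auto
    have "u t \<in> carrier_vec m" using admissible_carrier(2)[OF adm] t by auto
    then have "u t - gain P *\<^sub>v x t = 0\<^sub>v m" unfolding ut[symmetric] by (intro eq_vecI) auto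
    then show "?e t = 0" using R_carrier by simp
  qed simp
  then have "integral {0..T} ?e = 0" by (rule integral_unique)
  then have "integral {0..T} (rate x u) + x T \<bullet> (P *\<^sub>v x T) = x0 \<bullet> (P *\<^sub>v x0)"
    using cost_identity(2)[OF adm T Pc ric] by simp
  moreover have "0 \<le> x T \<bullet> (P *\<^sub>v x T)" using P admissible_carrier(1)[OF adm T] by (simp add: pos_semidef_def)
  ultimately show "integral {0..T} (rate x u) \<le> x0 \<bullet> (P *\<^sub>v x0)" by simp
qed

end

text \<open>Detectability, witnessed by an output injection: subtracting \<open>H D\<close> makes the system matrix
  Hurwitz, and the running cost controls the output \<open>D x\<close> through the positive definite \<open>S\<close>.\<close>

locale lq_detectable = lq +
  fixes r :: nat and F H D S :: "real mat"
  assumes F: "F \<in> carrier_mat k k" "hurwitz F" and H: "H \<in> carrier_mat k r" and D: "D \<in> carrier_mat r k"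
    and S: "pos_def r S" and Y_eq: "Y = F + H * D" and Q_eq: "Q = D\<^sup>T * S * D"
begin

text \<open>In \<open>x' = F x + (H D x + J u)\<close> the forcing term is bounded by the running cost, since \<open>S\<close> and \<open>R\<close> are
  coercive. The factor \<open>N\<close> is there for the Lyapunov matrix of \<open>F\<close>.\<close>

lemma injection_bound:
  assumes N: "N \<in> carrier_mat k k"
  shows "\<exists>c \<ge> 0. \<forall>y \<in> carrier_vec k. \<forall>v \<in> carrier_vec m.
    (N *\<^sub>v (H *\<^sub>v (D *\<^sub>v y) + J *\<^sub>v v)) \<bullet> (N *\<^sub>v (H *\<^sub>v (D *\<^sub>v y) + J *\<^sub>v v)) \<le>
    c * (y \<bullet> (Q *\<^sub>v y) + v \<bullet> (R *\<^sub>v v))"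
proof -
  have NH: "N * H \<in> carrier_mat k r" and NJ: "N * J \<in> carrier_mat k m" using N H J by auto
  obtain c1 where c1: "c1 \<ge> 0" "\<And>z. z \<in> carrier_vec r \<Longrightarrow> ((N * H) *\<^sub>v z) \<bullet> ((N * H) *\<^sub>v z) \<le> c1 * (z \<bullet> z)"
    using mat_vec_bounded[OF NH] by blast
  obtain c2 where c2: "c2 \<ge> 0" "\<And>z. z \<in> carrier_vec m \<Longrightarrow> ((N * J) *\<^sub>v z) \<bullet> ((N * J) *\<^sub>v z) \<le> c2 * (z \<bullet> z)"
    using mat_vec_bounded[OF NJ] by blast
  obtain s where s: "s \<ge> 0" "\<And>z. z \<in> carrier_vec r \<Longrightarrow> z \<bullet> z \<le> s * (z \<bullet> (S *\<^sub>v z))"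
    using pos_def_coercive[OF S] by blast
  obtain \<rho> where \<rho>: "\<rho> \<ge> 0" "\<And>z. z \<in> carrier_vec m \<Longrightarrow> z \<bullet> z \<le> \<rho> * (z \<bullet> (R *\<^sub>v z))"
    using pos_def_coercive[OF R] by blast
  have Sc: "S \<in> carrier_mat r r" using S by (simp add: pos_def_def)
  let ?c = "2 * (c1 * s) + 2 * (c2 * \<rho>)"
  have "(N *\<^sub>v (H *\<^sub>v (D *\<^sub>v y) + J *\<^sub>v v)) \<bullet> (N *\<^sub>v (H *\<^sub>v (D *\<^sub>v y) + J *\<^sub>v v)) \<le> ?c * (y \<bullet> (Q *\<^sub>v y) + v \<bullet> (R *\<^sub>v v))"
    if y: "y \<in> carrier_vec k" and v: "v \<in> carrier_vec m" for y v
  proof -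
    define a b where "a = (N * H) *\<^sub>v (D *\<^sub>v y)" and "b = (N * J) *\<^sub>v v"
    have ab: "a \<in> carrier_vec k" "b \<in> carrier_vec k" using NH NJ D v y by (auto simp: a_def b_def)
    have z: "D *\<^sub>v y \<in> carrier_vec r" using D y by auto
    have eq: "N *\<^sub>v (H *\<^sub>v (D *\<^sub>v y) + J *\<^sub>v v) = a + b"
      using N H D J y v by (simp add: a_def b_def mat_vec_distrib mat_vec_assoc)
    have "0 \<le> (a - b) \<bullet> (a - b)" by (rule scalar_prod_self_nonneg)
    then have "(a + b) \<bullet> (a + b) \<le> 2 * (a \<bullet> a) + 2 * (b \<bullet> b)"
      using ab by (simp add: scalar_prod_linear)
    moreover have "a \<bullet> a \<le> (c1 * s) * (y \<bullet> (Q *\<^sub>v y))"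
    proof -
      have "a \<bullet> a \<le> c1 * ((D *\<^sub>v y) \<bullet> (D *\<^sub>v y))" unfolding a_def by (rule c1(2)[OF z])
      also have "\<dots> \<le> c1 * (s * ((D *\<^sub>v y) \<bullet> (S *\<^sub>v (D *\<^sub>v y))))" by (intro mult_left_mono s(2)[OF z] c1(1))
      finally show ?thesis unfolding Q_eq quadratic_congruence[OF Sc D y] by (simp add: mult.assoc)
    qed
    moreover have "b \<bullet> b \<le> (c2 * \<rho>) * (v \<bullet> (R *\<^sub>v v))"
    proof -
      have "b \<bullet> b \<le> c2 * (v \<bullet> v)" unfolding b_def by (rule c2(2)[OF v])
      also have "\<dots> \<le> c2 * (\<rho> * (v \<bullet> (R *\<^sub>v v)))" by (intro mult_left_mono \<rho>(2)[OF v] c2(1))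
      finally show ?thesis by (simp add: mult.assoc)
    qed
    moreover have "0 \<le> (c1 * s) * (v \<bullet> (R *\<^sub>v v))" "0 \<le> (c2 * \<rho>) * (y \<bullet> (Q *\<^sub>v y))"
      using c1 c2 s \<rho> Q pos_def_imp_psd[OF R] y v by (auto simp: pos_semidef_def)
    ultimately show ?thesis unfolding eq by (simp add: algebra_simps)
  qed
  then show ?thesis using c1 c2 s \<rho> by (intro exI[of _ ?c]) auto
qed

text \<open>Let \<open>F\<^sup>T X + X F = - I\<close>. The derivative of \<open>x \<bullet> X x\<close> is \<open>- x \<bullet> x\<close> plus a term that is linear in the
  forcing; half of \<open>x \<bullet> x\<close> absorbs the state in that term, and the running cost bounds the rest.\<close>

lemma state_energy_bound:
  assumes adm: "lqr_admissible Y J x0 x u"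
  shows "\<exists>c \<ge> 0. \<exists>b. \<forall>T \<ge> 0. integral {0..T} (\<lambda>t. x t \<bullet> x t) \<le> b + c * integral {0..T} (rate x u)"
proof -
  obtain X where X: "pos_semidef k X" and lyap: "F\<^sup>T * X + X * F = - 1\<^sub>m k"
    using lyapunov_solvable[OF F psd_one] by blast
  have Xc: "X \<in> carrier_mat k k" "X\<^sup>T = X" using X by (auto simp: pos_semidef_def)
  obtain c where c: "c \<ge> 0" "\<And>y v. y \<in> carrier_vec k \<Longrightarrow> v \<in> carrier_vec m \<Longrightarrow>
      (X *\<^sub>v (H *\<^sub>v (D *\<^sub>v y) + J *\<^sub>v v)) \<bullet> (X *\<^sub>v (H *\<^sub>v (D *\<^sub>v y) + J *\<^sub>v v)) \<le> c * (y \<bullet> (Q *\<^sub>v y) + v \<bullet> (R *\<^sub>v v))"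
    using injection_bound[OF Xc(1)] by blast
  have pointwise: "2 * (velocity x u t \<bullet> (X *\<^sub>v x t)) \<le> - (1/2) * (x t \<bullet> x t) + 2 * c * rate x u t"
    if t: "0 \<le> t" for t
  proof -
    define y v w where "y = x t" and "v = u t" and "w = H *\<^sub>v (D *\<^sub>v y) + J *\<^sub>v v"
    have y: "y \<in> carrier_vec k" and v: "v \<in> carrier_vec m"
      using admissible_carrier[OF adm t] by (auto simp: y_def v_def)
    have w: "w \<in> carrier_vec k" using H D J y v by (auto simp: w_def)
    define z where "z = X *\<^sub>v w"
    have z: "z \<in> carrier_vec k" using Xc w by (auto simp: z_def)
    have "velocity x u t = F *\<^sub>v y + w"
      unfolding w_def y_def[symmetric] v_def[symmetric] Y_eq using F H D J y v
      by (simp add: mat_vec_distrib mat_vec_assoc) (auto intro!: eq_vecI simp del: index_mult_mat_vec)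
    then have "2 * (velocity x u t \<bullet> (X *\<^sub>v y)) = 2 * ((F *\<^sub>v y) \<bullet> (X *\<^sub>v y)) + 2 * (w \<bullet> (X *\<^sub>v y))"
      using w y F Xc by (simp add: scalar_prod_linear(3))
    also have "2 * ((F *\<^sub>v y) \<bullet> (X *\<^sub>v y)) = y \<bullet> ((F\<^sup>T * X + X * F) *\<^sub>v y)"
      by (rule lyapunov_quadratic[OF F(1) Xc y, symmetric])
    also have "\<dots> = - (y \<bullet> y)" unfolding lyap using y by (simp add: mat_vec_distrib scalar_prod_linear)
    also have "w \<bullet> (X *\<^sub>v y) = y \<bullet> z" unfolding z_def by (rule scalar_prod_symmetric[OF Xc w y])
    also have "2 * (y \<bullet> z) \<le> (1/2) * (y \<bullet> y) + 2 * (z \<bullet> z)"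
    proof -
      have "0 \<le> ((1/2) \<cdot>\<^sub>v y - z) \<bullet> ((1/2) \<cdot>\<^sub>v y - z)" by (rule scalar_prod_self_nonneg)
      also have "((1/2) \<cdot>\<^sub>v y - z) \<bullet> ((1/2) \<cdot>\<^sub>v y - z) = (1/4) * (y \<bullet> y) - y \<bullet> z + z \<bullet> z"
        using y z scalar_prod_commute[of z y] by (simp add: scalar_prod_linear field_simps)
      finally show ?thesis by simp
    qed
    also have "z \<bullet> z \<le> c * rate x u t" using c(2)[OF y v] by (simp add: z_def w_def y_def v_def)
    finally show ?thesis by (simp add: y_def)
  qed
  have "integral {0..T} (\<lambda>t. x t \<bullet> x t) \<le> 2 * (x 0 \<bullet> (X *\<^sub>v x 0)) + 4 * c * integral {0..T} (rate x u)" if T: "0 \<le> T" for T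
  proof -
    have xx: "(\<lambda>t. x t \<bullet> x t) integrable_on {0..T}"
      using vec_square_integrable_scalar_prod[OF admissible_square_integrable(1)[OF adm T] admissible_square_integrable(1)[OF adm T]]
      by (simp add: absolutely_integrable_on_def)
    have rt: "rate x u integrable_on {0..T}" using rate_integrable[OF adm T] by (simp add: absolutely_integrable_on_def)
    have "x T \<bullet> (X *\<^sub>v x T) - x 0 \<bullet> (X *\<^sub>v x 0) \<le> - (1/2) * integral {0..T} (\<lambda>t. x t \<bullet> x t) + 2 * c * integral {0..T} (rate x u)"
    proof (rule has_integral_le[OF quadratic_primitive[OF adm T Xc]])
      show "((\<lambda>t. - (1/2) * (x t \<bullet> x t) + 2 * c * rate x u t) has_integral
          (- (1/2) * integral {0..T} (\<lambda>t. x t \<bullet> x t) + 2 * c * integral {0..T} (rate x u))) {0..T}"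
        by (intro has_integral_add has_integral_mult_right integrable_integral xx rt)
    qed (use pointwise in auto)
    moreover have "0 \<le> x T \<bullet> (X *\<^sub>v x T)" using X admissible_carrier(1)[OF adm T] by (simp add: pos_semidef_def)
    ultimately show ?thesis by simp
  qed
  then show ?thesis using c(1) by (intro exI[of _ "4 * c"] conjI exI[of _ "2 * (x 0 \<bullet> (X *\<^sub>v x 0))"]) auto
qed

text \<open>Finite cost makes \<open>x \<bullet> x\<close> integrable, so it cannot stay above a positive bound. Arbitrarily late
  times at which the state is small suffice to remove the terminal term of the cost identity.\<close>

lemma state_returns_to_zero:
  assumes adm: "lqr_admissible Y J x0 x u" and fin: "lqr_cost Q R x u < \<infinity>"
    and P: "P \<in> carrier_mat k k" and \<epsilon>: "\<epsilon> > 0"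
  shows "\<exists>T \<ge> T0. 0 \<le> T \<and> x T \<bullet> (P *\<^sub>v x T) < \<epsilon>"
proof -
  obtain C where C: "lqr_cost Q R x u = ennreal C" "0 \<le> C" using fin by (cases "lqr_cost Q R x u") auto
  have rate_le: "integral {0..T} (rate x u) \<le> C" if "0 \<le> T" for T
    using cost_ge[OF adm that] C by (simp add: ennreal_le_iff)
  obtain c b where c: "c \<ge> 0" and bd: "\<And>T. 0 \<le> T \<Longrightarrow> integral {0..T} (\<lambda>t. x t \<bullet> x t) \<le> b + c * integral {0..T} (rate x u)"
    using state_energy_bound[OF adm] by blast
  have xx_le: "integral {0..T} (\<lambda>t. x t \<bullet> x t) \<le> b + c * C" if "0 \<le> T" for T
    using bd[OF that] mult_left_mono[OF rate_le[OF that] c] by linarith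
  obtain p where p: "p \<ge> 0" "\<And>y. y \<in> carrier_vec k \<Longrightarrow> (P *\<^sub>v y) \<bullet> (P *\<^sub>v y) \<le> p * (y \<bullet> y)"
    using mat_vec_bounded[OF P] by blast
  have form: "y \<bullet> (P *\<^sub>v y) \<le> (1 + p) * (y \<bullet> y)" if y: "y \<in> carrier_vec k" for y
  proof -
    have "0 \<le> (y - P *\<^sub>v y) \<bullet> (y - P *\<^sub>v y)" by (rule scalar_prod_self_nonneg)
    also have "\<dots> = y \<bullet> y - 2 * (y \<bullet> (P *\<^sub>v y)) + (P *\<^sub>v y) \<bullet> (P *\<^sub>v y)"
      using y P scalar_prod_commute[of "P *\<^sub>v y" y] by (simp add: scalar_prod_linear)
    finally show ?thesis using p(2)[OF y] scalar_prod_self_nonneg[of y] mult_nonneg_nonneg[OF p(1) scalar_prod_self_nonneg[of y]]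
      unfolding distrib_right by linarith
  qed
  define \<delta> where "\<delta> = \<epsilon> / (1 + p)"
  have \<delta>: "\<delta> > 0" "(1 + p) * \<delta> = \<epsilon>" using \<epsilon> p by (auto simp: \<delta>_def)
  define s where "s = max T0 0"
  have "\<exists>T \<ge> s. x T \<bullet> x T < \<delta>"
  proof (rule ccontr)
    assume "\<not> ?thesis"
    then have ge: "\<delta> \<le> x t \<bullet> x t" if "s \<le> t" for t using that by (auto simp: not_less)
    \<comment> \<open>Staying above \<open>\<delta>\<close> from \<open>s\<close> to this \<open>T\<close> would use more than the available energy \<open>b + c C\<close>.\<close>
    define T where "T = s + (\<bar>b + c * C\<bar> + 1) / \<delta>"
    have T: "s \<le> T" "0 \<le> T" using \<delta> by (auto simp: T_def s_def)
    have xx: "(\<lambda>t. x t \<bullet> x t) integrable_on {0..T}"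
      using vec_square_integrable_scalar_prod[OF admissible_square_integrable(1)[OF adm T(2)] admissible_square_integrable(1)[OF adm T(2)]]
      by (simp add: absolutely_integrable_on_def)
    have xs: "(\<lambda>t. x t \<bullet> x t) integrable_on {s..T}"
      by (rule integrable_subinterval_real[OF xx]) (auto simp: s_def)
    have "\<bar>b + c * C\<bar> + 1 = (T - s) * \<delta>" using \<delta> by (simp add: T_def)
    also have "\<dots> = integral {s..T} (\<lambda>_. \<delta>)" using T by simp
    also have "\<dots> \<le> integral {s..T} (\<lambda>t. x t \<bullet> x t)"
      by (rule integral_le) (use xs ge in auto)
    also have "\<dots> \<le> integral {0..T} (\<lambda>t. x t \<bullet> x t)"
      by (rule integral_subset_le) (use xs xx in \<open>auto simp: s_def intro: scalar_prod_self_nonneg\<close>)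
    also have "\<dots> \<le> b + c * C" by (rule xx_le[OF T(2)])
    finally show False by linarith
  qed
  then obtain T where T: "T \<ge> s" "x T \<bullet> x T < \<delta>" by blast
  then have T0: "T0 \<le> T" "0 \<le> T" by (auto simp: s_def)
  have "x T \<bullet> (P *\<^sub>v x T) \<le> (1 + p) * (x T \<bullet> x T)" by (rule form[OF admissible_carrier(1)[OF adm T0(2)]])
  also have "\<dots> < \<epsilon>" using T(2) p(1) unfolding \<delta>(2)[symmetric] by (intro mult_strict_left_mono) auto
  finally show ?thesis using T0 by blast
qed

text \<open>Take the cost identity at late times when the terminal term is below \<open>\<epsilon>\<close>. This one estimate shows both
  that \<open>x0 \<bullet> P x0\<close> is a lower bound of the cost and that reaching it leaves no deviation.\<close>

lemma deviation_le:
  assumes adm: "lqr_admissible Y J x0 x u" and C: "lqr_cost Q R x u = ennreal C" "0 \<le> C"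
    and P: "pos_semidef k P" and ric: "riccati Y J Q R P" and s: "0 \<le> s"
  defines "e \<equiv> \<lambda>t. (u t - gain P *\<^sub>v x t) \<bullet> (R *\<^sub>v (u t - gain P *\<^sub>v x t))"
  shows "integral {0..s} e \<le> C - x0 \<bullet> (P *\<^sub>v x0)"
proof (rule field_le_epsilon)
  fix \<epsilon> :: real assume \<epsilon>: "\<epsilon> > 0"
  have Pc: "P \<in> carrier_mat k k" "P\<^sup>T = P" using P by (auto simp: pos_semidef_def)
  obtain T where T: "s \<le> T" "0 \<le> T" "x T \<bullet> (P *\<^sub>v x T) < \<epsilon>"
    using state_returns_to_zero[OF adm _ Pc(1) \<epsilon>, of s] C by auto
  have e0: "0 \<le> e t" if "0 \<le> t" for t
  proof -
    have "u t - gain P *\<^sub>v x t \<in> carrier_vec m"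
      using admissible_carrier[OF adm that] gain_carrier[OF Pc(1)] by auto
    then show ?thesis using pos_def_imp_psd[OF R] by (simp add: e_def pos_semidef_def)
  qed
  have "integral {0..s} e \<le> integral {0..T} e"
    using cost_identity(1)[OF adm s Pc ric] cost_identity(1)[OF adm T(2) Pc ric] T e0
    by (intro integral_subset_le) (auto simp: e_def absolutely_integrable_on_def)
  also have "\<dots> = integral {0..T} (rate x u) + x T \<bullet> (P *\<^sub>v x T) - x0 \<bullet> (P *\<^sub>v x0)"
    using cost_identity(2)[OF adm T(2) Pc ric] by (simp add: e_def)
  also have "integral {0..T} (rate x u) \<le> C" using cost_ge[OF adm T(2)] C by (simp add: ennreal_le_iff)
  finally show "integral {0..s} e \<le> C - x0 \<bullet> (P *\<^sub>v x0) + \<epsilon>" using T by simp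
qed

lemma cost_lower_bound:
  assumes adm: "lqr_admissible Y J x0 x u" and P: "pos_semidef k P" and ric: "riccati Y J Q R P"
  shows "ennreal (x0 \<bullet> (P *\<^sub>v x0)) \<le> lqr_cost Q R x u"
proof (cases "lqr_cost Q R x u")
  case (real C)
  have "0 \<le> C - x0 \<bullet> (P *\<^sub>v x0)" using deviation_le[OF adm real(2,1) P ric, of 0] by simp
  then show ?thesis using real by (simp add: ennreal_leI)
qed simp

lemma optimal_imp_feedback:
  assumes adm: "lqr_admissible Y J x0 x u" and P: "pos_semidef k P" and ric: "riccati Y J Q R P"
    and le: "lqr_cost Q R x u \<le> ennreal (x0 \<bullet> (P *\<^sub>v x0))"
  shows "AE t in lebesgue_on {0..}. u t = gain P *\<^sub>v x t"
proof -
  have Pc: "P \<in> carrier_mat k k" "P\<^sup>T = P" using P by (auto simp: pos_semidef_def)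
  have x0: "x0 \<in> carrier_vec k" using admissible_carrier(1)[OF adm, of 0] adm by (simp add: lqr_admissible_def)
  have v0: "0 \<le> x0 \<bullet> (P *\<^sub>v x0)" using P x0 by (simp add: pos_semidef_def)
  have cost: "lqr_cost Q R x u = ennreal (x0 \<bullet> (P *\<^sub>v x0))"
    using le cost_lower_bound[OF adm P ric] by (rule antisym)
  let ?e = "\<lambda>t. (u t - gain P *\<^sub>v x t) \<bullet> (R *\<^sub>v (u t - gain P *\<^sub>v x t))"
  have dcar: "u t - gain P *\<^sub>v x t \<in> carrier_vec m" if "0 \<le> t" for t
    using admissible_carrier[OF adm that] gain_carrier[OF Pc(1)] by auto
  have e0: "0 \<le> ?e t" if "0 \<le> t" for t
    using dcar[OF that] pos_def_imp_psd[OF R] by (simp add: pos_semidef_def)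
  have fb: "u t = gain P *\<^sub>v x t" if t: "0 \<le> t" and 0: "?e t = 0" for t
  proof -
    have z: "u t - gain P *\<^sub>v x t = 0\<^sub>v m" using R dcar[OF t] 0 unfolding pos_def_def by (metis less_irrefl)
    have "u t $ i = (gain P *\<^sub>v x t) $ i" if "i < m" for i
      using arg_cong[OF z, of "\<lambda>w. w $ i"] that gain_carrier[OF Pc(1)] by (simp del: index_mult_mat_vec)
    then show ?thesis using admissible_carrier(2)[OF adm t] gain_carrier[OF Pc(1)] by (intro eq_vecI) auto
  qed
  have "AE t in lebesgue. t \<in> {0..real n} \<longrightarrow> ?e t = 0" for n
  proof -
    have abs: "?e absolutely_integrable_on {0..real n}" using cost_identity(1)[OF adm _ Pc ric] by simp
    have int: "integrable (lebesgue_on {0..real n}) ?e" by (rule absolutely_integrable_imp_integrable[OF abs]) simp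
    have ae: "AE t in lebesgue_on {0..real n}. 0 \<le> ?e t" by (rule AE_I2) (simp add: e0)
    have "integral {0..real n} ?e \<le> 0" using deviation_le[OF adm cost v0 P ric, of "real n"] by simp
    moreover have "0 \<le> integral {0..real n} ?e"
      using abs e0 by (intro Henstock_Kurzweil_Integration.integral_nonneg) (auto simp: absolutely_integrable_on_def)
    ultimately have "integral\<^sup>L (lebesgue_on {0..real n}) ?e = 0"
      using lebesgue_integral_eq_integral[OF int] by simp
    then have "AE t in lebesgue_on {0..real n}. ?e t = 0"
      using integral_nonneg_eq_0_iff_AE[OF int ae] by simp
    then show ?thesis by (simp add: AE_restrict_space_iff)
  qed
  then have "AE t in lebesgue. \<forall>n. t \<in> {0..real n} \<longrightarrow> ?e t = 0" by (subst AE_all_countable) blast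
  then have "AE t in lebesgue. t \<in> {0..} \<longrightarrow> u t = gain P *\<^sub>v x t"
  proof (rule AE_mp[OF _ AE_I2], intro impI)
    fix t assume h: "\<forall>n. t \<in> {0..real n} \<longrightarrow> ?e t = 0" "t \<in> {0..}"
    obtain n :: nat where "t \<le> real n" using real_arch_simple by blast
    then show "u t = gain P *\<^sub>v x t" using h by (intro fb) auto
  qed
  then show ?thesis by (simp add: AE_restrict_space_iff)
qed

text \<open>The lower bound \<open>x0 \<bullet> P x0\<close> is attained by the feedback law and, up to null sets, by nothing else.\<close>

theorem feedback_optimal:
  assumes P: "pos_semidef k P" and ric: "riccati Y J Q R P"
  shows "lqr_solution Y J Q R (gain P)"
  unfolding lqr_solution_def dims
proof (intro ballI conjI allI impI)
  have Pc: "P \<in> carrier_mat k k" using P by (auto simp: pos_semidef_def)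
  fix x0 :: "real vec" assume x0: "x0 \<in> carrier_vec k"
  show ex: "\<exists>x u. lqr_admissible Y J x0 x u \<and> (\<forall>t \<ge> 0. u t = gain P *\<^sub>v x t)"
    by (rule closed_loop_exists[OF gain_carrier[OF Pc] x0])
  then obtain x' u' where adm': "lqr_admissible Y J x0 x' u'" and fb': "\<forall>t \<ge> 0. u' t = gain P *\<^sub>v x' t" by blast
  have "AE t in lebesgue_on {0..}. u' t = gain P *\<^sub>v x' t" by (rule AE_I2) (simp add: fb')
  then have le': "lqr_cost Q R x' u' \<le> ennreal (x0 \<bullet> (P *\<^sub>v x0))" by (rule feedback_cost_le[OF adm' P ric])
  fix x u assume adm: "lqr_admissible Y J x0 x u"
  show "lqr_optimal Y J Q R x0 x u \<longleftrightarrow> (AE t in lebesgue_on {0..}. u t = gain P *\<^sub>v x t)"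
  proof
    assume "lqr_optimal Y J Q R x0 x u"
    then have "lqr_cost Q R x u \<le> lqr_cost Q R x' u'" using adm' by (simp add: lqr_optimal_def)
    then show "AE t in lebesgue_on {0..}. u t = gain P *\<^sub>v x t"
      by (intro optimal_imp_feedback[OF adm P ric] order_trans[OF _ le'])
  next
    assume "AE t in lebesgue_on {0..}. u t = gain P *\<^sub>v x t"
    then have le: "lqr_cost Q R x u \<le> ennreal (x0 \<bullet> (P *\<^sub>v x0))" by (rule feedback_cost_le[OF adm P ric])
    show "lqr_optimal Y J Q R x0 x u"
      unfolding lqr_optimal_def
    proof (intro conjI allI impI adm)
      show "lqr_cost Q R x u < \<infinity>" using le by (rule order_le_less_trans) simp
      show "lqr_cost Q R x u \<le> lqr_cost Q R y v" if "lqr_admissible Y J x0 y v" for y v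
        using le cost_lower_bound[OF that P ric] by (rule order_trans)
    qed
  qed
qed

text \<open>Run the feedback of \<open>P'\<close>: its cost is at most \<open>x \<bullet> P' x\<close>, and at least \<open>x \<bullet> P x\<close> by the lower bound
  for the other solution. By symmetry the two forms agree.\<close>

theorem riccati_unique:
  assumes P1: "pos_semidef k P1" "riccati Y J Q R P1" and P2: "pos_semidef k P2" "riccati Y J Q R P2"
  shows "P1 = P2"
proof -
  have le: "x \<bullet> (P *\<^sub>v x) \<le> x \<bullet> (P' *\<^sub>v x)"
    if P: "pos_semidef k P" "riccati Y J Q R P" and P': "pos_semidef k P'" "riccati Y J Q R P'"
      and x: "x \<in> carrier_vec k" for P P' x
  proof -
    obtain y u where adm: "lqr_admissible Y J x y u" and fb: "\<forall>t \<ge> 0. u t = gain P' *\<^sub>v y t"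
      using closed_loop_exists[OF gain_carrier x, of P'] P'(1) by (auto simp: pos_semidef_def)
    have "AE t in lebesgue_on {0..}. u t = gain P' *\<^sub>v y t" by (rule AE_I2) (simp add: fb)
    from cost_lower_bound[OF adm P] feedback_cost_le[OF adm P' this]
    have "ennreal (x \<bullet> (P *\<^sub>v x)) \<le> ennreal (x \<bullet> (P' *\<^sub>v x))" by (rule order_trans)
    moreover have "0 \<le> x \<bullet> (P' *\<^sub>v x)" using P' x by (simp add: pos_semidef_def)
    ultimately show ?thesis by (simp add: ennreal_le_iff)
  qed
  show ?thesis
  proof (rule symmetric_mat_eqI)
    show "x \<bullet> (P1 *\<^sub>v x) = x \<bullet> (P2 *\<^sub>v x)" if "x \<in> carrier_vec k" for x
      using le[OF P1 P2 that] le[OF P2 P1 that] by (rule order_antisym)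
  qed (use P1 P2 in \<open>auto simp: pos_semidef_def\<close>)
qed

end

section \<open>The parametrization of the plant state\<close>

lemma resolvent_coeff_carrier: "F \<in> carrier_mat n n \<Longrightarrow> resolvent_coeff F k \<in> carrier_mat n n"
  using adj_mat(1)[of "char_poly_matrix F" n] by (simp add: resolvent_coeff_def)

text \<open>Compare the coefficients of \<open>s\<^sup>k\<close> in \<open>(s I - F) adj (s I - F) = det (s I - F) I\<close>.\<close>

lemma resolvent_coeff_recursion:
  assumes F: "F \<in> carrier_mat n n" and ij: "i < n" "j < n"
  shows "(F * resolvent_coeff F k) $$ (i, j) =
    (if k = 0 then 0 else resolvent_coeff F (k - 1) $$ (i, j)) - (if i = j then coeff (char_poly F) k else 0)"
proof -
  let ?X = "char_poly_matrix F"
  have X: "?X \<in> carrier_mat n n" using F by simp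
  note adj = adj_mat[OF X]
  have D: "resolvent_coeff F l $$ (a, b) = coeff (adj_mat ?X $$ (a, b)) l" if "a < n" "b < n" for a b l
    using that adj(1) by (simp add: resolvent_coeff_def)
  have "(?X * adj_mat ?X) $$ (i, j) = (\<Sum>l<n. ?X $$ (i, l) * adj_mat ?X $$ (l, j))"
    using ij X adj(1) by (simp add: scalar_prod_def lessThan_atLeast0)
  also have "\<dots> = (\<Sum>l<n. (if l = i then pCons 0 (adj_mat ?X $$ (l, j)) else 0) - Polynomial.smult (F $$ (i, l)) (adj_mat ?X $$ (l, j)))"
    using ij F by (intro sum.cong refl) (auto simp: char_poly_matrix_def)
  also have "\<dots> = pCons 0 (adj_mat ?X $$ (i, j)) - (\<Sum>l<n. Polynomial.smult (F $$ (i, l)) (adj_mat ?X $$ (l, j)))"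
    using ij by (simp add: sum_subtractf)
  also have "coeff \<dots> k = (if k = 0 then 0 else resolvent_coeff F (k - 1) $$ (i, j)) -
      (\<Sum>l<n. F $$ (i, l) * resolvent_coeff F k $$ (l, j))"
    using ij by (cases k) (simp_all add: coeff_sum D)
  also have "(\<Sum>l<n. F $$ (i, l) * resolvent_coeff F k $$ (l, j)) = (F * resolvent_coeff F k) $$ (i, j)"
    using ij F resolvent_coeff_carrier[OF F, of k] by (simp add: scalar_prod_def lessThan_atLeast0)
  finally have "coeff ((?X * adj_mat ?X) $$ (i, j)) k = (if k = 0 then 0 else resolvent_coeff F (k - 1) $$ (i, j)) -
      (F * resolvent_coeff F k) $$ (i, j)" .
  moreover have "coeff ((?X * adj_mat ?X) $$ (i, j)) k = (if i = j then coeff (char_poly F) k else 0)"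
    unfolding adj(2) char_poly_def using ij by simp
  ultimately show ?thesis by simp
qed

text \<open>The recursion at \<open>k = n\<close>: there \<open>D\<^sub>n = 0\<close>, and the characteristic polynomial is monic.\<close>

lemma resolvent_coeff_top:
  assumes F: "F \<in> carrier_mat n n" and n: "0 < n"
  shows "resolvent_coeff F (n - 1) = 1\<^sub>m n"
proof (rule eq_matI)
  fix i j assume "i < dim_row (1\<^sub>m n :: real mat)" "j < dim_col (1\<^sub>m n :: real mat)"
  then have ij: "i < n" "j < n" by auto
  have Dn: "resolvent_coeff F n = 0\<^sub>m n n"
    using adj_mat(1)[of "char_poly_matrix F" n] F degree_adj_char_poly_matrix[OF F]
    by (auto simp: mat_eq_iff resolvent_coeff_def coeff_eq_0)
  have "(F * resolvent_coeff F n) $$ (i, j) = 0" unfolding Dn using ij F by (simp add: mat_zero)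
  moreover have "coeff (char_poly F) n = 1" using degree_monic_char_poly[OF F] by auto
  ultimately show "resolvent_coeff F (n - 1) $$ (i, j) = 1\<^sub>m n $$ (i, j)"
    using resolvent_coeff_recursion[OF F ij, of n] n ij by (auto split: if_splits)
qed (use resolvent_coeff_carrier[OF F] in auto)

lemma companion_carrier: "F \<in> carrier_mat n n \<Longrightarrow> companion (char_poly F) \<in> carrier_mat n n"
  using degree_monic_char_poly[of F n] by (simp add: companion_def Let_def)

text \<open>The superdiagonal makes every eigenvector a multiple of \<open>(1, \<mu>, \<dots>, \<mu>\<^sup>n\<^sup>-\<^sup>1)\<close>, and the last row
  then says that \<open>\<mu>\<close> is a root of the characteristic polynomial.\<close>

lemma companion_eigenvalue:
  assumes F: "F \<in> carrier_mat n n" and n: "0 < n" and v: "v \<in> carrier_vec n" "v \<noteq> 0\<^sub>v n"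
    and eig: "cmat (companion (char_poly F)) *\<^sub>v v = \<mu> \<cdot>\<^sub>v v"
  shows "eigenvalue (cmat F) \<mu>"
proof -
  let ?A = "companion (char_poly F)" and ?f = "char_poly F"
  have A: "?A \<in> carrier_mat n n" by (rule companion_carrier[OF F])
  have deg: "degree ?f = n" and monic: "coeff ?f n = 1" using degree_monic_char_poly[OF F] by auto
  have row: "(\<Sum>j<n. of_real (?A $$ (i, j)) * v $ j) = \<mu> * v $ i" if i: "i < n" for i
  proof -
    have "(\<Sum>j<n. of_real (?A $$ (i, j)) * v $ j) = (cmat ?A *\<^sub>v v) $ i"
      using i A v by (simp add: scalar_prod_def lessThan_atLeast0)
    then show ?thesis unfolding eig using i v by simp
  qed
  have next_entry: "v $ Suc i = \<mu> * v $ i" if i: "Suc i < n" for i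
  proof -
    have "(\<Sum>j<n. of_real (?A $$ (i, j)) * v $ j) = (\<Sum>j<n. if j = Suc i then v $ j else 0)"
      using i deg by (intro sum.cong refl) (auto simp: companion_def Let_def)
    also have "\<dots> = v $ Suc i" using i by simp
    finally show ?thesis using row[of i] i by simp
  qed
  have pow: "v $ i = \<mu> ^ i * v $ 0" if "i < n" for i
    using that by (induction i) (simp_all add: next_entry)
  have "(\<Sum>j<n. of_real (?A $$ (n - 1, j)) * v $ j) = - (\<Sum>j<n. of_real (coeff ?f j) * (\<mu> ^ j * v $ 0))"
    unfolding sum_negf[symmetric]
  proof (rule sum.cong[OF refl])
    fix j assume "j \<in> {..<n}"
    then have "j < n" "?A $$ (n - 1, j) = - coeff ?f j" using n deg by (auto simp: companion_def Let_def)
    then show "of_real (?A $$ (n - 1, j)) * v $ j = - (of_real (coeff ?f j) * (\<mu> ^ j * v $ 0))"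
      using pow[of j] by simp
  qed
  then have last: "- (\<Sum>j<n. of_real (coeff ?f j) * (\<mu> ^ j * v $ 0)) = \<mu> * (\<mu> ^ (n - 1) * v $ 0)"
    using row[of "n - 1"] pow[of "n - 1"] n by simp
  have "poly (map_poly of_real ?f) \<mu> = (\<Sum>j\<le>n. of_real (coeff ?f j) * \<mu> ^ j)"
    unfolding poly_altdef by (simp add: coeff_map_poly deg)
  also have "\<dots> = (\<Sum>j<n. of_real (coeff ?f j) * \<mu> ^ j) + \<mu> ^ n"
    unfolding lessThan_Suc_atMost[symmetric] by (simp add: monic)
  finally have "poly (map_poly of_real ?f) \<mu> * v $ 0 = (\<Sum>j<n. of_real (coeff ?f j) * (\<mu> ^ j * v $ 0)) + \<mu> ^ n * v $ 0"
    by (simp add: distrib_right sum_distrib_right mult.assoc)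
  also have "\<mu> ^ n * v $ 0 = \<mu> * (\<mu> ^ (n - 1) * v $ 0)" using n by (cases n) (auto simp: mult.assoc)
  also have "\<dots> = - (\<Sum>j<n. of_real (coeff ?f j) * (\<mu> ^ j * v $ 0))" using last by simp
  finally have "poly (map_poly of_real ?f) \<mu> * v $ 0 = 0" by simp
  moreover have "v $ 0 \<noteq> 0"
  proof
    assume "v $ 0 = 0"
    then have "v = 0\<^sub>v n" using v(1) pow by (intro eq_vecI) auto
    with v(2) show False ..
  qed
  ultimately have "poly (char_poly (cmat F)) \<mu> = 0" by (simp add: of_real_hom.char_poly_hom[OF F])
  then show ?thesis using eigenvalue_root_char_poly[of "cmat F" n] F by auto
qed

lemma hurwitz_rep_diag_companion:
  assumes F: "F \<in> carrier_mat n n" and n: "0 < n" and h: "hurwitz F"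
  shows "hurwitz (rep_diag N (companion (char_poly F)))"
proof (rule hurwitzI[of _ "N * n"])
  let ?A = "companion (char_poly F)"
  have A: "?A \<in> carrier_mat n n" by (rule companion_carrier[OF F])
  show "rep_diag N ?A \<in> carrier_mat (N * n) (N * n)" using A by (intro carrier_matI) auto
  fix \<mu> v assume v: "v \<in> carrier_vec (N * n)" "cmat (rep_diag N ?A) *\<^sub>v v = \<mu> \<cdot>\<^sub>v v" "0 \<le> Re \<mu>"
  show "v = 0\<^sub>v (N * n)"
  proof (rule vec_blocks_eq_0I[OF v(1)], rule ccontr)
    fix i assume i: "i < N" "vec_block n v i \<noteq> 0\<^sub>v n"
    have "cmat ?A *\<^sub>v vec_block n v i = \<mu> \<cdot>\<^sub>v vec_block n v i"
      by (rule rep_diag_eigen[OF _ v(1) _ i(1)]) (use A v(2) in \<open>auto simp: map_rep_diag\<close>)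
    from companion_eigenvalue[OF F n _ i(2) this] have "eigenvalue (cmat F) \<mu>" by simp
    then show False using h v(3) unfolding hurwitz_def by fastforce
  qed
qed

text \<open>The column \<open>f\<^sub>i\<close> of the parametrization, counted from zero.\<close>

definition input_col :: "real mat \<Rightarrow> real mat \<Rightarrow> nat \<Rightarrow> real vec" where
  "input_col B L i = (if i < dim_col B then col B i else col L (i - dim_col B))"

lemma input_col_carrier:
  assumes "B \<in> carrier_mat n m" "L \<in> carrier_mat n p" "i < m + p"
  shows "input_col B L i \<in> carrier_vec n"
  using assms by (auto simp: input_col_def)

lemma param_mat_carrier:
  "A \<in> carrier_mat n n \<Longrightarrow> B \<in> carrier_mat n m \<Longrightarrow> L \<in> carrier_mat n p \<Longrightarrow>
    param_mat A B C L \<in> carrier_mat n (n * (m + p))"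
  by (simp add: param_mat_def Let_def)

lemma param_mat_index:
  assumes "A \<in> carrier_mat n n" "B \<in> carrier_mat n m" "L \<in> carrier_mat n p" "r < n" "i < m + p" "k < n"
  shows "param_mat A B C L $$ (r, i * n + k) = (resolvent_coeff (A - L * C) k *\<^sub>v input_col B L i) $ r"
proof -
  have "i * n + k < n * (m + p)" using block_index[OF assms(5,6)] by (simp add: mult.commute)
  then show ?thesis using assms by (simp add: param_mat_def Let_def input_col_def)
qed

lemma param_mat_mult_index:
  assumes A: "A \<in> carrier_mat n n" and B: "B \<in> carrier_mat n m" and L: "L \<in> carrier_mat n p"
    and Z: "Z \<in> carrier_mat (n * (m + p)) c" and r: "r < n" and j: "j < c"
  shows "(param_mat A B C L * Z) $$ (r, j) =
    (\<Sum>i<m + p. \<Sum>k<n. (resolvent_coeff (A - L * C) k *\<^sub>v input_col B L i) $ r * Z $$ (i * n + k, j))"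
proof -
  have "(param_mat A B C L * Z) $$ (r, j) = (\<Sum>l<(m + p) * n. param_mat A B C L $$ (r, l) * Z $$ (l, j))"
    using param_mat_carrier[OF A B L, of C] Z r j by (simp add: scalar_prod_def lessThan_atLeast0 mult.commute)
  also have "\<dots> = (\<Sum>i<m + p. \<Sum>k<n. param_mat A B C L $$ (r, i * n + k) * Z $$ (i * n + k, j))"
    by (rule sum_blocks)
  also have "\<dots> = (\<Sum>i<m + p. \<Sum>k<n. (resolvent_coeff (A - L * C) k *\<^sub>v input_col B L i) $ r * Z $$ (i * n + k, j))"
    using param_mat_index[OF A B L r] by (intro sum.cong refl) auto
  finally show ?thesis .
qed

text \<open>Column \<open>k\<close> of the companion matrix has a one in row \<open>k - 1\<close> and \<open>- \<alpha>\<^sub>k\<close> in the last row, so column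
  \<open>k\<close> of the \<open>i\<close>-th block on the left is \<open>D\<^sub>k\<^sub>-\<^sub>1 f\<^sub>i - \<alpha>\<^sub>k D\<^sub>n\<^sub>-\<^sub>1 f\<^sub>i\<close>. Since \<open>D\<^sub>n\<^sub>-\<^sub>1 = I\<close>,
  the recursion identifies it with \<open>F D\<^sub>k f\<^sub>i\<close>.\<close>

lemma param_mat_companion:
  assumes A: "A \<in> carrier_mat n n" and B: "B \<in> carrier_mat n m" and L: "L \<in> carrier_mat n p"
    and C: "C \<in> carrier_mat p n" and n: "0 < n"
  defines "F \<equiv> A - L * C" and "M \<equiv> param_mat A B C L"
  shows "M * rep_diag (m + p) (companion (char_poly F)) = F * M"
proof (rule eq_matI)
  let ?A = "companion (char_poly F)"
  have F: "F \<in> carrier_mat n n" unfolding F_def by (rule minus_carrier_mat) (use L C in auto)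
  have cA: "?A \<in> carrier_mat n n" by (rule companion_carrier[OF F])
  have M: "M \<in> carrier_mat n (n * (m + p))" unfolding M_def by (rule param_mat_carrier[OF A B L])
  have rd: "rep_diag (m + p) ?A \<in> carrier_mat (n * (m + p)) (n * (m + p))"
    using cA by (intro carrier_matI) (auto simp: mult.commute)
  show "dim_row (M * rep_diag (m + p) ?A) = dim_row (F * M)" "dim_col (M * rep_diag (m + p) ?A) = dim_col (F * M)"
    using M F cA by (auto simp: mult.commute)
  fix r j assume "r < dim_row (F * M)" "j < dim_col (F * M)"
  then have r: "r < n" and j: "j < n * (m + p)" using F M by auto
  define i k where "i = j div n" and "k = j mod n"
  have k: "k < n" and jk: "j = i * n + k" using n by (auto simp: i_def k_def)
  have i: "i < m + p" using j unfolding i_def by (simp add: less_mult_imp_div_less mult.commute)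
  define f where "f = input_col B L i"
  have f: "f \<in> carrier_vec n" unfolding f_def by (rule input_col_carrier[OF B L i])
  let ?D = "resolvent_coeff F"
  have D: "?D l \<in> carrier_mat n n" for l by (rule resolvent_coeff_carrier[OF F])
  have deg: "degree (char_poly F) = n" using degree_monic_char_poly[OF F] by auto
  have "(M * rep_diag (m + p) ?A) $$ (r, j) =
      (\<Sum>i'<m + p. \<Sum>k'<n. (?D k' *\<^sub>v input_col B L i') $ r * rep_diag (m + p) ?A $$ (i' * n + k', j))"
    unfolding M_def F_def by (rule param_mat_mult_index[OF A B L _ r j]) (use rd in \<open>simp add: F_def\<close>)
  also have "\<dots> = (\<Sum>i'<m + p. if i' = i then \<Sum>k'<n. (?D k' *\<^sub>v f) $ r * ?A $$ (k', k) else 0)"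
  proof (rule sum.cong[OF refl])
    fix i' assume "i' \<in> {..<m + p}"
    then have i': "i' < m + p" by simp
    have "rep_diag (m + p) ?A $$ (i' * n + k', j) = (if i' = i then ?A $$ (k', k) else 0)" if k': "k' < n" for k'
      using block_index[OF i' k'] block_index[OF i k] cA k k' unfolding jk by (simp add: rep_diag_def)
    then show "(\<Sum>k'<n. (?D k' *\<^sub>v input_col B L i') $ r * rep_diag (m + p) ?A $$ (i' * n + k', j)) =
        (if i' = i then \<Sum>k'<n. (?D k' *\<^sub>v f) $ r * ?A $$ (k', k) else 0)"
      by (simp add: f_def)
  qed
  also have "\<dots> = (\<Sum>k'<n. (?D k' *\<^sub>v f) $ r * ?A $$ (k', k))" using i by simp
  also have "\<dots> = (\<Sum>k'<n. (if Suc k' = k then (?D k' *\<^sub>v f) $ r else 0) -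
      (if k' = n - 1 then (?D k' *\<^sub>v f) $ r * coeff (char_poly F) k else 0))"
    using k deg by (intro sum.cong refl) (auto simp: companion_def Let_def)
  also have "\<dots> = (if k = 0 then 0 else (?D (k - 1) *\<^sub>v f) $ r) - (?D (n - 1) *\<^sub>v f) $ r * coeff (char_poly F) k"
  proof -
    have "(\<Sum>k'<n. if Suc k' = k then (?D k' *\<^sub>v f) $ r else 0) = (if k = 0 then 0 else (?D (k - 1) *\<^sub>v f) $ r)"
      using k by (cases k) (simp_all del: index_mult_mat_vec)
    moreover have "(\<Sum>k'<n. if k' = n - 1 then (?D k' *\<^sub>v f) $ r * coeff (char_poly F) k else 0) =
        (?D (n - 1) *\<^sub>v f) $ r * coeff (char_poly F) k"
      using n by (simp del: index_mult_mat_vec)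
    ultimately show ?thesis by (simp only: sum_subtractf)
  qed
  also have "\<dots> = ((F * ?D k) *\<^sub>v f) $ r"
  proof -
    have "(G *\<^sub>v f) $ r = (\<Sum>l<n. G $$ (r, l) * f $ l)" if "G \<in> carrier_mat n n" for G
      using r f that by (simp add: scalar_prod_def lessThan_atLeast0)
    from this[OF mult_carrier_mat[OF F D]]
    have "((F * ?D k) *\<^sub>v f) $ r = (\<Sum>l<n. (F * ?D k) $$ (r, l) * f $ l)" .
    also have "\<dots> = (\<Sum>l<n. (if k = 0 then 0 else ?D (k - 1) $$ (r, l)) * f $ l - (if l = r then coeff (char_poly F) k * f $ l else 0))"
      using resolvent_coeff_recursion[OF F r, of _ k] by (intro sum.cong refl) (auto simp: left_diff_distrib)
    also have "\<dots> = (\<Sum>l<n. (if k = 0 then 0 else ?D (k - 1) $$ (r, l)) * f $ l) - coeff (char_poly F) k * f $ r"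
      using r by (simp add: sum_subtractf)
    also have "(\<Sum>l<n. (if k = 0 then 0 else ?D (k - 1) $$ (r, l)) * f $ l) = (if k = 0 then 0 else (?D (k - 1) *\<^sub>v f) $ r)"
      using r D[of "k - 1"] f by (simp add: scalar_prod_def lessThan_atLeast0)
    also have "f $ r = (?D (n - 1) *\<^sub>v f) $ r" unfolding resolvent_coeff_top[OF F n] using f by simp
    finally show ?thesis by (simp add: mult.commute)
  qed
  also have "\<dots> = (F * M) $$ (r, j)"
  proof -
    have "col M j = ?D k *\<^sub>v f"
    proof (rule eq_vecI)
      fix a assume "a < dim_vec (?D k *\<^sub>v f)"
      then have a: "a < n" using carrier_matD[OF D[of k]] by auto
      have "col M j $ a = M $$ (a, i * n + k)" using M j a jk by simp
      also have "\<dots> = (?D k *\<^sub>v f) $ a" unfolding M_def f_def F_def by (rule param_mat_index[OF A B L a i k])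
      finally show "col M j $ a = (?D k *\<^sub>v f) $ a" .
    qed (use M carrier_matD[OF D[of k]] in auto)
    moreover have "((F * ?D k) *\<^sub>v f) $ r = (F *\<^sub>v (?D k *\<^sub>v f)) $ r"
      using F carrier_matD[OF D[of k]] f by (subst mat_vec_assoc) auto
    ultimately show ?thesis using r j F M by simp
  qed
  finally show "(M * rep_diag (m + p) ?A) $$ (r, j) = (F * M) $$ (r, j)" .
qed

text \<open>As \<open>D\<^sub>n\<^sub>-\<^sub>1 = I\<close>, a unit vector at the last position of block \<open>i\<close> picks \<open>f\<^sub>i\<close> out of \<open>M\<close>; the
  offset \<open>s\<close> tells the columns of \<open>B\<close> from those of \<open>L\<close>.\<close>

lemma param_mat_select:
  assumes A: "A \<in> carrier_mat n n" and B: "B \<in> carrier_mat n m" and L: "L \<in> carrier_mat n p"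
    and C: "C \<in> carrier_mat p n" and n: "0 < n"
    and Z: "Z \<in> carrier_mat (n * (m + p)) c"
    and sel: "\<And>i k j. i < m + p \<Longrightarrow> k < n \<Longrightarrow> j < c \<Longrightarrow> Z $$ (i * n + k, j) = (if i = s + j \<and> k = n - 1 then 1 else 0)"
    and s: "s + c \<le> m + p" and j: "j < c" and r: "r < n"
  shows "(param_mat A B C L * Z) $$ (r, j) = input_col B L (s + j) $ r"
proof -
  have F: "A - L * C \<in> carrier_mat n n" by (rule minus_carrier_mat) (use L C in auto)
  let ?D = "resolvent_coeff (A - L * C)"
  have sj: "s + j < m + p" using s j by simp
  have "(param_mat A B C L * Z) $$ (r, j) =
      (\<Sum>i<m + p. \<Sum>k<n. (?D k *\<^sub>v input_col B L i) $ r * Z $$ (i * n + k, j))"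
    by (rule param_mat_mult_index[OF A B L Z r j])
  also have "\<dots> = (\<Sum>i<m + p. if i = s + j then (?D (n - 1) *\<^sub>v input_col B L i) $ r else 0)"
  proof (rule sum.cong[OF refl])
    fix i assume "i \<in> {..<m + p}"
    then have i: "i < m + p" by simp
    define h where "h k = (?D k *\<^sub>v input_col B L i) $ r" for k
    have "(\<Sum>k<n. h k * Z $$ (i * n + k, j)) = (\<Sum>k<n. if k = n - 1 then (if i = s + j then h k else 0) else 0)"
      by (rule sum.cong[OF refl]) (simp add: sel i j)
    also have "\<dots> = (if i = s + j then h (n - 1) else 0)" using n by simp
    finally show "(\<Sum>k<n. (?D k *\<^sub>v input_col B L i) $ r * Z $$ (i * n + k, j)) =
        (if i = s + j then (?D (n - 1) *\<^sub>v input_col B L i) $ r else 0)" by (simp only: h_def)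
  qed
  also have "\<dots> = (?D (n - 1) *\<^sub>v input_col B L (s + j)) $ r" using sj by (simp del: index_mult_mat_vec)
  also have "\<dots> = input_col B L (s + j) $ r"
    unfolding resolvent_coeff_top[OF F n] using input_col_carrier[OF B L sj] by simp
  finally show ?thesis .
qed

lemma append_rows_index:
  assumes "A \<in> carrier_mat r1 c" "B \<in> carrier_mat r2 c" "i < r1 + r2" "j < c"
  shows "(A @\<^sub>r B) $$ (i, j) = (if i < r1 then A $$ (i, j) else B $$ (i - r1, j))"
  using assms by (auto simp: append_rows_def)

lemma rep_diag_last_unit:
  assumes "i < N" "k < n" "j < N"
  shows "rep_diag N (last_unit n) $$ (i * n + k, j) = (if i = j \<and> k = n - 1 then 1 else 0)"
proof -
  have "(i * n + k) div n = i" "(i * n + k) mod n = k" using assms(2) by auto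
  moreover have "rep_diag N (last_unit n) $$ (a, j) = (if a div n = j \<and> a mod n = n - 1 then 1 else 0)" if "a < N * n" for a
    using that assms by (simp add: rep_diag_def last_unit_def)
  ultimately show ?thesis using block_index[OF assms(1,2)] by (simp only:)
qed

lemma block_less_iff: "k < n \<Longrightarrow> i * n + k < m * n \<longleftrightarrow> i < (m :: nat)"
  using block_index[of i m k n] by (metis add_lessD1 mult_less_cancel2)

lemma param_mat_input:
  assumes A: "A \<in> carrier_mat n n" and B: "B \<in> carrier_mat n m" and L: "L \<in> carrier_mat n p"
    and C: "C \<in> carrier_mat p n" and n: "0 < n"
  shows "param_mat A B C L * (rep_diag m (last_unit n) @\<^sub>r 0\<^sub>m (p * n) m) = B"
    and "param_mat A B C L * (0\<^sub>m (m * n) p @\<^sub>r rep_diag p (last_unit n)) = L"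
proof -
  have M: "param_mat A B C L \<in> carrier_mat n (n * (m + p))" by (rule param_mat_carrier[OF A B L])
  have lu: "rep_diag N (last_unit n) \<in> carrier_mat (N * n) N" for N
    by (intro carrier_matI) (auto simp: last_unit_def)
  have size: "m * n + p * n = n * (m + p)" by (simp add: distrib_left mult.commute)
  have Z1: "rep_diag m (last_unit n) @\<^sub>r 0\<^sub>m (p * n) m \<in> carrier_mat (n * (m + p)) m"
    using carrier_append_rows[OF lu zero_carrier_mat, of m "p * n"] size by simp
  have Z2: "0\<^sub>m (m * n) p @\<^sub>r rep_diag p (last_unit n) \<in> carrier_mat (n * (m + p)) p"
    using carrier_append_rows[OF zero_carrier_mat lu, of "m * n" p] size by simp
  have idx: "i * n + k < m * n + p * n" if "i < m + p" "k < n" for i k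
    using block_index[OF that] by (simp add: distrib_right)
  have sel1: "(rep_diag m (last_unit n) @\<^sub>r 0\<^sub>m (p * n) m) $$ (i * n + k, j) = (if i = 0 + j \<and> k = n - 1 then 1 else 0)"
    if "i < m + p" "k < n" "j < m" for i k j
  proof (cases "i < m")
    case True
    then show ?thesis using that append_rows_index[OF lu zero_carrier_mat idx[OF that(1,2)] that(3)] block_less_iff[OF that(2), of i m]
      by (simp add: rep_diag_last_unit)
  next
    case False
    then show ?thesis using that append_rows_index[OF lu zero_carrier_mat idx[OF that(1,2)] that(3)] block_less_iff[OF that(2), of i m]
        idx[OF that(1,2)] by simp
  qed
  have sel2: "(0\<^sub>m (m * n) p @\<^sub>r rep_diag p (last_unit n)) $$ (i * n + k, j) = (if i = m + j \<and> k = n - 1 then 1 else 0)"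
    if "i < m + p" "k < n" "j < p" for i k j
  proof (cases "i < m")
    case False
    then obtain i' where i': "i = m + i'" using le_Suc_ex by (metis not_less)
    have "i * n + k - m * n = i' * n + k" by (simp add: i' distrib_right)
    then show ?thesis
      using that idx[OF that(1,2)] append_rows_index[OF zero_carrier_mat lu idx[OF that(1,2)] that(3)] block_less_iff[OF that(2), of i m] False
      by (auto simp: rep_diag_last_unit i')
  next
    case True
    then show ?thesis
      using that idx[OF that(1,2)] append_rows_index[OF zero_carrier_mat lu idx[OF that(1,2)] that(3)] block_less_iff[OF that(2), of i m]
      by auto
  qed
  show "param_mat A B C L * (rep_diag m (last_unit n) @\<^sub>r 0\<^sub>m (p * n) m) = B"
  proof (rule eq_matI)
    fix r j assume "r < dim_row B" "j < dim_col B"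
    then have rj: "r < n" "j < m" using B by auto
    show "(param_mat A B C L * (rep_diag m (last_unit n) @\<^sub>r 0\<^sub>m (p * n) m)) $$ (r, j) = B $$ (r, j)"
      using param_mat_select[OF A B L C n Z1 sel1 _ rj(2,1)] rj B by (simp add: input_col_def)
  qed (use B M Z1 in auto)
  show "param_mat A B C L * (0\<^sub>m (m * n) p @\<^sub>r rep_diag p (last_unit n)) = L"
  proof (rule eq_matI)
    fix r j assume "r < dim_row L" "j < dim_col L"
    then have rj: "r < n" "j < p" using L by auto
    show "(param_mat A B C L * (0\<^sub>m (m * n) p @\<^sub>r rep_diag p (last_unit n))) $$ (r, j) = L $$ (r, j)"
      using param_mat_select[OF A B L C n Z2 sel2 _ rj(2,1)] rj B L by (simp add: input_col_def)
  qed (use L M Z2 in auto)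
qed

section \<open>Pulling the Riccati equation back along an intertwining matrix\<close>

text \<open>The residual of the equation at \<open>W\<^sup>T P W\<close> is \<open>W\<^sup>T E W\<close>, where \<open>E\<close> is the residual at \<open>P\<close>.\<close>

lemma riccati_pullback:
  assumes Y: "Y \<in> carrier_mat k k" and J: "J \<in> carrier_mat k m" and Q: "Q \<in> carrier_mat k k" and P: "P \<in> carrier_mat k k"
    and V: "V \<in> carrier_mat m m" "mat_inv R = V" and W: "W \<in> carrier_mat k k'"
    and A: "A \<in> carrier_mat k' k'" and B: "B \<in> carrier_mat k' m"
    and WA: "W * A = Y * W" and WB: "W * B = J" and ric: "riccati Y J Q R P"
  shows "riccati A B (W\<^sup>T * Q * W) R (W\<^sup>T * P * W)"
proof -
  note d = carrier_matD[OF Y] carrier_matD[OF J] carrier_matD[OF Q] carrier_matD[OF P] carrier_matD[OF V(1)]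
    carrier_matD[OF W] carrier_matD[OF A] carrier_matD[OF B]
  have AW: "A\<^sup>T * W\<^sup>T = W\<^sup>T * Y\<^sup>T" "B\<^sup>T * W\<^sup>T = J\<^sup>T"
    using arg_cong[OF WA, of transpose_mat] arg_cong[OF WB, of transpose_mat] d by (simp_all add: mat_transpose)
  let ?E = "Y\<^sup>T * P + P * Y + Q - P * J * V * J\<^sup>T * P"
  have 1: "A\<^sup>T * (W\<^sup>T * P * W) = W\<^sup>T * (Y\<^sup>T * P) * W"
  proof -
    have "A\<^sup>T * (W\<^sup>T * P * W) = (A\<^sup>T * W\<^sup>T) * (P * W)" using d by (simp add: mat_assoc)
    then show ?thesis unfolding AW using d by (simp add: mat_assoc)
  qed
  have 2: "W\<^sup>T * P * W * A = W\<^sup>T * (P * Y) * W"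
  proof -
    have "W\<^sup>T * P * W * A = W\<^sup>T * P * (W * A)" using d by (simp add: mat_assoc)
    then show ?thesis unfolding WA using d by (simp add: mat_assoc)
  qed
  have 3: "W\<^sup>T * P * W * B * V * B\<^sup>T * (W\<^sup>T * P * W) = W\<^sup>T * (P * J * V * J\<^sup>T * P) * W"
  proof -
    have "W\<^sup>T * P * W * B * V * B\<^sup>T * (W\<^sup>T * P * W) = W\<^sup>T * P * (W * B) * V * (B\<^sup>T * W\<^sup>T) * (P * W)"
      using d by (simp add: mat_assoc)
    then show ?thesis unfolding WB AW using d by (simp add: mat_assoc)
  qed
  have "A\<^sup>T * (W\<^sup>T * P * W) + W\<^sup>T * P * W * A + W\<^sup>T * Q * W - W\<^sup>T * P * W * B * V * B\<^sup>T * (W\<^sup>T * P * W) = W\<^sup>T * ?E * W"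
    unfolding 1 2 3 using d by (simp add: mat_distrib)
  also have "?E = 0\<^sub>m k k" using ric d by (simp add: riccati_def V)
  also have "W\<^sup>T * 0\<^sub>m k k * W = 0\<^sub>m k' k'" using d by (simp add: mat_zero)
  finally show ?thesis unfolding riccati_def V(2) d .
qed

section \<open>Regulation with the parametrized state\<close>

lemma hurwitz_minus_one: "hurwitz (- 1\<^sub>m l)"
proof (rule hurwitzI[of _ l])
  fix \<mu> v assume v: "v \<in> carrier_vec l" "cmat (- 1\<^sub>m l) *\<^sub>v v = \<mu> \<cdot>\<^sub>v v" "0 \<le> Re \<mu>"
  have "cmat (- 1\<^sub>m l) = - 1\<^sub>m l" by (auto simp: mat_eq_iff)
  then have eq: "- v = \<mu> \<cdot>\<^sub>v v" using v by (simp add: mat_vec_distrib)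
  have "\<mu> + 1 \<noteq> 0" using v(3) by (auto simp: complex_eq_iff)
  moreover have "(\<mu> + 1) * v $ i = 0" if "i < l" for i
    using arg_cong[OF eq, of "\<lambda>w. w $ i"] that v(1) by (simp add: distrib_right) (metis add.left_inverse)
  ultimately show "v = 0\<^sub>v l" using v(1) by (intro eq_vecI) auto
qed auto

lemma minus_one_cancel: "dim_row G = l \<Longrightarrow> dim_col G = l \<Longrightarrow> - 1\<^sub>m l + (G + 1\<^sub>m l) = (G :: real mat)"
  by (auto simp: mat_eq_iff)

lemma diag_block_pair:
  "diag_block_mat [A, B] = four_block_mat A (0\<^sub>m (dim_row A) (dim_col B)) (0\<^sub>m (dim_row B) (dim_col A)) B"
  by (simp only: diag_block_mat.simps(2)[of A "[B]"] diag_block_mat_singleton Let_def)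

theorem theorem4:
  fixes n m p q nz :: nat
    and A B C S L R Qbar G1 G2 b M B\<zeta> E\<zeta> A\<zeta> Y J A\<rho> B\<rho> W Cbar Q\<xi> Q\<rho> :: "real mat"
  assumes dims: "0 < n" "0 < m" "0 < p" "0 < q"
    and A: "A \<in> carrier_mat n n" and B: "B \<in> carrier_mat n m"
    and C: "C \<in> carrier_mat p n" and S: "S \<in> carrier_mat q q"
    and stab: "stabilizable A B"
    and obs: "observable A C"
    and S_spec: "\<And>\<mu>. eigenvalue (cmat S) \<mu> \<Longrightarrow> \<not> Re \<mu> < 0"
    and rank: "\<And>\<mu>. eigenvalue (cmat S) \<mu> \<Longrightarrow>
      mat_rank (four_block_mat (cmat A - \<mu> \<cdot>\<^sub>m 1\<^sub>m n) (cmat B) (cmat C) (0\<^sub>m p m)) = n + p"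
    and model: "minimal_internal_model p S G1 G2"
    and nz: "nz = dim_row G1"
    and L: "L \<in> carrier_mat n p" and L_hurwitz: "hurwitz (A - L * C)"
    and R: "pos_def m R"
    and Qbar: "pos_def (p + nz) Qbar"
    and b: "b = last_unit n"
    and M: "M = param_mat A B C L"
    and B\<zeta>: "B\<zeta> = kron (1\<^sub>m m) b @\<^sub>r 0\<^sub>m (p * n) m"
    and E\<zeta>: "E\<zeta> = 0\<^sub>m (m * n) p @\<^sub>r kron (1\<^sub>m p) b"
    and A\<zeta>: "A\<zeta> = kron (1\<^sub>m (m + p)) (companion (char_poly (A - L * C))) + E\<zeta> * C * M"
    and Y: "Y = four_block_mat A (0\<^sub>m n nz) (G2 * C) G1"
    and J: "J = B @\<^sub>r 0\<^sub>m nz m"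
    and A\<rho>: "A\<rho> = four_block_mat A\<zeta> (0\<^sub>m (n * (m + p)) nz) (G2 * C * M) G1"
    and B\<rho>: "B\<rho> = B\<zeta> @\<^sub>r 0\<^sub>m nz m"
    and W: "W = diag_block_mat [M, 1\<^sub>m nz]"
    and Cbar: "Cbar = diag_block_mat [C, 1\<^sub>m nz]"
    and Q\<xi>: "Q\<xi> = Cbar\<^sup>T * Qbar * Cbar"
    and Q\<rho>: "Q\<rho> = W\<^sup>T * Q\<xi> * W"
  shows "(\<exists>!P\<xi>. pos_def (n + nz) P\<xi> \<and> riccati Y J Q\<xi> R P\<xi>) \<and>
    (\<forall>P\<xi>. pos_def (n + nz) P\<xi> \<and> riccati Y J Q\<xi> R P\<xi> \<longrightarrow>
       (\<exists>!P\<rho>. pos_semidef (n * (m + p) + nz) P\<rho> \<and> riccati A\<rho> B\<rho> Q\<rho> R P\<rho>) \<and>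
       (\<forall>P\<rho>. pos_semidef (n * (m + p) + nz) P\<rho> \<and> riccati A\<rho> B\<rho> Q\<rho> R P\<rho> \<longrightarrow>
          P\<rho> = W\<^sup>T * P\<xi> * W \<and>
          (\<forall>K\<rho> K\<xi>. K\<rho> = - (mat_inv R * B\<rho>\<^sup>T * P\<rho>) \<and> K\<xi> = - (mat_inv R * J\<^sup>T * P\<xi>) \<longrightarrow>
             K\<rho> = - (mat_inv R * B\<rho>\<^sup>T * W\<^sup>T * P\<xi> * W) \<and>
             K\<rho> = K\<xi> * W \<and>
             lqr_solution A\<rho> B\<rho> Q\<rho> R K\<rho>)))"
proof -
  obtain l where G1l: "G1 \<in> carrier_mat l l" and G2l: "G2 \<in> carrier_mat l p"
    by (rule internal_model_facts[OF S model]) blast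
  have l: "l = nz" using G1l nz by simp
  have G1: "G1 \<in> carrier_mat nz nz" and G2: "G2 \<in> carrier_mat nz p" using G1l G2l l by auto
  define k where "k = n * (m + p)"
  have k: "m * n + p * n = k" "(m + p) * n = k" by (auto simp: k_def algebra_simps)
  define \<Phi> where "\<Phi> = A - L * C"
  have \<Phi>: "\<Phi> \<in> carrier_mat n n" unfolding \<Phi>_def by (rule minus_carrier_mat) (use L C in auto)
  define \<A> where "\<A> = rep_diag (m + p) (companion (char_poly \<Phi>))"
  have \<A>: "\<A> \<in> carrier_mat k k" "hurwitz \<A>"
    using companion_carrier[OF \<Phi>] hurwitz_rep_diag_companion[OF \<Phi> dims(1)] L_hurwitz
    by (auto simp: \<A>_def \<Phi>_def k intro!: carrier_matI)
  have Mc: "M \<in> carrier_mat n k" unfolding M k_def by (rule param_mat_carrier[OF A B L])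
  have lu: "rep_diag N (last_unit n) \<in> carrier_mat (N * n) N" for N
    by (intro carrier_matI) (auto simp: last_unit_def)
  have B\<zeta>_eq: "B\<zeta> = rep_diag m (last_unit n) @\<^sub>r 0\<^sub>m (p * n) m"
    and E\<zeta>_eq: "E\<zeta> = 0\<^sub>m (m * n) p @\<^sub>r rep_diag p (last_unit n)"
    by (simp_all add: B\<zeta> E\<zeta> b kron_one_rep_diag)
  have B\<zeta>c: "B\<zeta> \<in> carrier_mat k m"
    unfolding B\<zeta>_eq k(1)[symmetric] by (rule carrier_append_rows[OF lu zero_carrier_mat])
  have E\<zeta>c: "E\<zeta> \<in> carrier_mat k p"
    unfolding E\<zeta>_eq k(1)[symmetric] by (rule carrier_append_rows[OF zero_carrier_mat lu])
  have A\<zeta>_eq: "A\<zeta> = \<A> + E\<zeta> * C * M" by (simp add: A\<zeta> \<A>_def \<Phi>_def kron_one_rep_diag)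
  have A\<zeta>c: "A\<zeta> \<in> carrier_mat k k" unfolding A\<zeta>_eq using \<A> E\<zeta>c C Mc by auto
  note d = carrier_matD[OF A] carrier_matD[OF B] carrier_matD[OF C] carrier_matD[OF L] carrier_matD[OF G1]
    carrier_matD[OF G2] carrier_matD[OF \<Phi>] carrier_matD[OF \<A>(1)] carrier_matD[OF Mc] carrier_matD[OF B\<zeta>c]
    carrier_matD[OF E\<zeta>c] carrier_matD[OF A\<zeta>c]
  have MB: "M * B\<zeta> = B" and ME: "M * E\<zeta> = L"
    unfolding M B\<zeta>_eq E\<zeta>_eq by (rule param_mat_input[OF A B L C dims(1)])+
  have M\<A>: "M * \<A> = \<Phi> * M"
    unfolding M \<A>_def \<Phi>_def by (rule param_mat_companion[OF A B L C dims(1)])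
  have \<Phi>LC: "\<Phi> + L * C = A" unfolding \<Phi>_def using A L C by (auto simp: mat_eq_iff simp del: index_mult_mat(1))
  \<comment> \<open>The term \<open>E\<zeta> C M\<close> in \<open>A\<zeta>\<close> is the image of the injection \<open>L C\<close> that turns \<open>\<Phi>\<close> back into \<open>A\<close>.\<close>
  have MA: "M * A\<zeta> = A * M"
  proof -
    have "M * A\<zeta> = M * \<A> + (M * E\<zeta>) * (C * M)" unfolding A\<zeta>_eq using d by (simp add: mat_distrib mat_assoc)
    also have "\<dots> = (\<Phi> + L * C) * M" unfolding M\<A> ME using d by (simp add: mat_distrib mat_assoc)
    finally show ?thesis unfolding \<Phi>LC .
  qed
  have W_eq: "W = four_block_mat M (0\<^sub>m n nz) (0\<^sub>m nz k) (1\<^sub>m nz)" unfolding W diag_block_pair using d by simp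
  have Cbar_eq: "Cbar = four_block_mat C (0\<^sub>m p nz) (0\<^sub>m nz n) (1\<^sub>m nz)" unfolding Cbar diag_block_pair using d by simp
  have J_eq: "J = four_block_mat B (0\<^sub>m n 0) (0\<^sub>m nz m) (0\<^sub>m nz 0)" using d by (simp add: J append_rows_def)
  have B\<rho>_eq: "B\<rho> = four_block_mat B\<zeta> (0\<^sub>m k 0) (0\<^sub>m nz m) (0\<^sub>m nz 0)" using d by (simp add: B\<rho> append_rows_def)
  have A\<rho>_eq: "A\<rho> = four_block_mat A\<zeta> (0\<^sub>m k nz) (G2 * C * M) G1" by (simp add: A\<rho> k_def)
  have Wc: "W \<in> carrier_mat (n + nz) (k + nz)" unfolding W_eq using Mc by auto
  have Cbarc: "Cbar \<in> carrier_mat (p + nz) (n + nz)" unfolding Cbar_eq using C by auto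
  have Yc: "Y \<in> carrier_mat (n + nz) (n + nz)" unfolding Y using A G1 by auto
  have Jc: "J \<in> carrier_mat (n + nz) m" using carrier_append_rows[OF B zero_carrier_mat, of nz] by (simp add: J)
  have A\<rho>c: "A\<rho> \<in> carrier_mat (k + nz) (k + nz)" unfolding A\<rho>_eq using A\<zeta>c G1 by auto
  have B\<rho>c: "B\<rho> \<in> carrier_mat (k + nz) m" using carrier_append_rows[OF B\<zeta>c zero_carrier_mat, of nz] by (simp add: B\<rho>)
  have WA: "W * A\<rho> = Y * W"
    unfolding W_eq A\<rho>_eq Y using d by (simp add: block_mult mat_one mat_zero mat_add_zero MA)
  have WB: "W * B\<rho> = J"
    unfolding W_eq B\<rho>_eq J_eq using d by (simp add: block_mult mat_one mat_zero mat_add_zero MB)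

  \<comment> \<open>The running cost sees both \<open>C x\<close> and \<open>z\<close>, so output injection may replace \<open>A\<close> by \<open>A - L C\<close>, remove
    the coupling and replace \<open>G1\<close> by \<open>- I\<close>.\<close>
  interpret xi: lq_detectable "n + nz" m Y J Q\<xi> R "p + nz" "four_block_mat \<Phi> (0\<^sub>m n nz) (0\<^sub>m nz n) (- 1\<^sub>m nz)"
    "four_block_mat L (0\<^sub>m n nz) G2 (G1 + 1\<^sub>m nz)" Cbar Qbar
  proof
    show "pos_semidef (n + nz) Q\<xi>" unfolding Q\<xi> by (rule psd_congruence[OF pos_def_imp_psd[OF Qbar] Cbarc])
    show "hurwitz (four_block_mat \<Phi> (0\<^sub>m n nz) (0\<^sub>m nz n) (- 1\<^sub>m nz))"
      using \<Phi> L_hurwitz hurwitz_minus_one by (intro hurwitz_block_upper) (auto simp: \<Phi>_def)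
    show "Y = four_block_mat \<Phi> (0\<^sub>m n nz) (0\<^sub>m nz n) (- 1\<^sub>m nz) + four_block_mat L (0\<^sub>m n nz) G2 (G1 + 1\<^sub>m nz) * Cbar"
      unfolding Y Cbar_eq using d
      by (simp add: block_mult block_add mat_one mat_zero mat_add_zero \<Phi>LC minus_one_cancel)
  qed (use Yc Jc R \<Phi> L G1 Cbarc Qbar Q\<xi> in auto)
  \<comment> \<open>Here injection through \<open>E\<zeta>\<close> removes the feedback term of \<open>A\<zeta>\<close>, which leaves copies of the companion
    matrix of \<open>A - L C\<close>.\<close>
  interpret rho: lq_detectable "k + nz" m A\<rho> B\<rho> Q\<rho> R "p + nz" "four_block_mat \<A> (0\<^sub>m k nz) (0\<^sub>m nz k) (- 1\<^sub>m nz)"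
    "four_block_mat E\<zeta> (0\<^sub>m k nz) G2 (G1 + 1\<^sub>m nz)" "Cbar * W" Qbar
  proof
    have CW: "Cbar * W \<in> carrier_mat (p + nz) (k + nz)" using Cbarc Wc by auto
    show Q\<rho>_eq: "Q\<rho> = (Cbar * W)\<^sup>T * Qbar * (Cbar * W)"
      unfolding Q\<rho> Q\<xi> using Cbarc Wc Qbar by (auto simp: pos_def_def mat_transpose mat_assoc)
    show "pos_semidef (k + nz) Q\<rho>" unfolding Q\<rho>_eq by (rule psd_congruence[OF pos_def_imp_psd[OF Qbar] CW])
    show "hurwitz (four_block_mat \<A> (0\<^sub>m k nz) (0\<^sub>m nz k) (- 1\<^sub>m nz))"
      using \<A> hurwitz_minus_one by (intro hurwitz_block_upper) auto
    have "Cbar * W = four_block_mat (C * M) (0\<^sub>m p nz) (0\<^sub>m nz k) (1\<^sub>m nz)"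
      unfolding Cbar_eq W_eq using d by (simp add: block_mult mat_one mat_zero mat_add_zero)
    then show "A\<rho> = four_block_mat \<A> (0\<^sub>m k nz) (0\<^sub>m nz k) (- 1\<^sub>m nz) + four_block_mat E\<zeta> (0\<^sub>m k nz) G2 (G1 + 1\<^sub>m nz) * (Cbar * W)"
      unfolding A\<rho>_eq A\<zeta>_eq using d
      by (simp add: block_mult block_add mat_one mat_zero mat_add_zero minus_one_cancel mat_assoc)
  qed (use A\<rho>c B\<rho>c R \<A> E\<zeta>c G1 Cbarc Wc Qbar in auto)

  obtain K0 where "K0 \<in> carrier_mat m (n + nz)" "hurwitz (Y + J * K0)"
    using augmented_stabilizable[OF A B C S stab S_spec rank model G1] by (auto simp: Y J)
  from xi.riccati_solvable[OF this] obtain P where P: "pos_semidef (n + nz) P" "riccati Y J Q\<xi> R P" by blast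
  have "pos_def (n + nz) P"
    by (rule augmented_riccati_pos_def[OF A C obs G1 G2 Jc R Qbar Y Cbar_eq P(1)]) (use P(2) in \<open>simp add: Q\<xi>\<close>)
  then have ex\<xi>: "\<exists>!P\<xi>. pos_def (n + nz) P\<xi> \<and> riccati Y J Q\<xi> R P\<xi>"
    using P(2) xi.riccati_unique pos_def_imp_psd by blast
  have main: "(\<exists>!P\<rho>. pos_semidef (k + nz) P\<rho> \<and> riccati A\<rho> B\<rho> Q\<rho> R P\<rho>) \<and>
       (\<forall>P\<rho>. pos_semidef (k + nz) P\<rho> \<and> riccati A\<rho> B\<rho> Q\<rho> R P\<rho> \<longrightarrow>
          P\<rho> = W\<^sup>T * P\<xi> * W \<and>
          (\<forall>K\<rho> K\<xi>. K\<rho> = - (mat_inv R * B\<rho>\<^sup>T * P\<rho>) \<and> K\<xi> = - (mat_inv R * J\<^sup>T * P\<xi>) \<longrightarrow>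
             K\<rho> = - (mat_inv R * B\<rho>\<^sup>T * W\<^sup>T * P\<xi> * W) \<and>
             K\<rho> = K\<xi> * W \<and>
             lqr_solution A\<rho> B\<rho> Q\<rho> R K\<rho>))"
    if pd: "pos_def (n + nz) P\<xi>" and ric: "riccati Y J Q\<xi> R P\<xi>" for P\<xi>
  proof -
    have P\<xi>: "P\<xi> \<in> carrier_mat (n + nz) (n + nz)" using pd by (simp add: pos_def_def)
    have psd: "pos_semidef (k + nz) (W\<^sup>T * P\<xi> * W)" by (rule psd_congruence[OF pos_def_imp_psd[OF pd] Wc])
    have ric\<rho>: "riccati A\<rho> B\<rho> Q\<rho> R (W\<^sup>T * P\<xi> * W)"
      unfolding Q\<rho>
      by (rule riccati_pullback[OF Yc Jc xi.Q_carrier(1) P\<xi> pos_def_inverse(1)[OF R] refl Wc A\<rho>c B\<rho>c WA WB ric])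
    have uniq: "P\<rho> = W\<^sup>T * P\<xi> * W" if "pos_semidef (k + nz) P\<rho>" "riccati A\<rho> B\<rho> Q\<rho> R P\<rho>" for P\<rho>
      by (rule rho.riccati_unique[OF that psd ric\<rho>])
    note dd = carrier_matD[OF P\<xi>] carrier_matD[OF Wc] carrier_matD[OF B\<rho>c] carrier_matD[OF Jc]
      carrier_matD[OF pos_def_inverse(1)[OF R]]
    have 1: "- (mat_inv R * B\<rho>\<^sup>T * (W\<^sup>T * P\<xi> * W)) = - (mat_inv R * B\<rho>\<^sup>T * W\<^sup>T * P\<xi> * W)"
      using dd by (simp add: mat_assoc)
    have "B\<rho>\<^sup>T * W\<^sup>T = J\<^sup>T" using arg_cong[OF WB, of transpose_mat] dd by (simp add: mat_transpose)
    moreover have "mat_inv R * B\<rho>\<^sup>T * (W\<^sup>T * P\<xi> * W) = mat_inv R * (B\<rho>\<^sup>T * W\<^sup>T) * P\<xi> * W" using dd by (simp add: mat_assoc)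
    ultimately have 2: "- (mat_inv R * B\<rho>\<^sup>T * (W\<^sup>T * P\<xi> * W)) = - (mat_inv R * J\<^sup>T * P\<xi>) * W"
      using dd by (simp add: mat_scale)
    have 3: "lqr_solution A\<rho> B\<rho> Q\<rho> R (- (mat_inv R * B\<rho>\<^sup>T * (W\<^sup>T * P\<xi> * W)))"
      using rho.feedback_optimal[OF psd ric\<rho>] by (simp add: rho.gain_def)
    show ?thesis
    proof (intro conjI allI impI; (elim conjE)?)
      show "\<exists>!P\<rho>. pos_semidef (k + nz) P\<rho> \<and> riccati A\<rho> B\<rho> Q\<rho> R P\<rho>" using psd ric\<rho> uniq by blast
    qed (use uniq 1 2 3 in auto)
  qed
  show ?thesis
    by (rule conjI[OF ex\<xi>], rule allI, rule impI, erule conjE, rule main[unfolded k_def])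
qed

end
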